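(* Let $1<p<\infty$, let $T$ and $H$ be forms of Toeplitz and Hankel type, respectively, and assume that $A=T+H$ is a compact operator on $H^p$. Then $T=C$ is a checkerboard form and $H=H(b)-C$, where $H(b)$ is a compact Hankel operator on $H^p$ with $b\in C(\mathbb{T})$.
   Context: $\mathbb{N}_0=\{0,1,2,\dots\}$. $L^p$ is the Lebesgue space of the unit circle $\mathbb{T}$ with normalized Lebesgue measure, $H^p=\{f\in L^p:\hat f_n=0\text{ for }n<0\}$; $\chi_j(z)=z^j$ for $j\in\mathbb{Z}$; $\langle f,g\rangle=\frac1{2\pi}\int_0^{2\pi}f(e^{i\theta})\overline{g(e^{i\theta})}\,d\theta$. $P:L^p\to H^p$ is the Riesz projection. $C(\mathbb{T})$ is the space of continuous functions on $\mathbb{T}$. Forms: let $\mathcal{D}_+=\operatorname{span}\{\chi_j:j\in\mathbb{N}_0\}$. A form is a sesquilinear map $\mathcal{D}_+\times\mathcal{D}_+\to\mathbb{C}$, written $(f,g)\mapsto\langle Bf,g\rangle$ even if not induced by an operator $B$. An operator $A$ on $H^p$ is identified with the form $(f,g)\mapsto\langle Af,g\rangle$ it induces; saying a form is a compact operator on $H^p$ means it is induced by a compact linear operator on $H^p$. Forms are added pointwise. A form $T$ is a Toeplitz form (of Toeplitz type) if $\langle T\chi_k,\chi_j\rangle=\langle T\chi_{k+1},\chi_{j+1}\rangle$ for all $j,k\in\mathbb{N}_0$. A form $H$ is a Hankel form (of Hankel type) if $\langle H\chi_{k+1},\chi_j\rangle=\langle H\chi_k,\chi_{j+1}\rangle$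 for all $j,k\in\mathbb{N}_0$. A checkerboard form is one that is both a Toeplitz and a Hankel form. For $b\in L^\infty$, $H(b)f=P(b\,Jf)$ on $H^p$, with $(Jf)(t)=\bar t f(\bar t)$; so $\langle H(b)\chi_k,\chi_j\rangle=\hat b_{j+k+1}$ for $j,k\in\mathbb{N}_0$. *)

theory Defs
  imports "HOL-Probability.Probability"
begin

text \<open>
  Functions on the unit circle are functions \<open>complex \<Rightarrow> complex\<close> of which only the values on
  \<open>sphere 0 1\<close> matter: the space of the measure below is the circle itself, so measurability and
  integrals do not see the values elsewhere. Elements of the Lebesgue and Hardy spaces are
  represented by functions, equality in these spaces being equality almost everywhere.
\<close>

definition circle :: "complex measure" where
  "circle = distr (uniform_measure lborel {0..2 * pi}) (restrict_space borel (sphere 0 1)) cis"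

definition chi :: "int \<Rightarrow> complex \<Rightarrow> complex" where
  "chi j z = z powi j"

definition pairing :: "(complex \<Rightarrow> complex) \<Rightarrow> (complex \<Rightarrow> complex) \<Rightarrow> complex" where
  "pairing f g = (LINT z|circle. f z * cnj (g z))"

definition fourier_coeff :: "(complex \<Rightarrow> complex) \<Rightarrow> int \<Rightarrow> complex" where
  "fourier_coeff f n = pairing f (chi n)"

definition Lp :: "real \<Rightarrow> (complex \<Rightarrow> complex) set" where
  "Lp p = {f \<in> borel_measurable circle. integrable circle (\<lambda>z. norm (f z) powr p)}"

definition Lp_norm :: "real \<Rightarrow> (complex \<Rightarrow> complex) \<Rightarrow> real" where
  "Lp_norm p f = (LINT z|circle. norm (f z) powr p) powr (1 / p)"

definition Hp :: "real \<Rightarrow> (complex \<Rightarrow> complex) set" where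
  "Hp p = {f \<in> Lp p. \<forall>n<0. fourier_coeff f n = 0}"

text \<open>
  The Riesz projection maps \<open>f\<close> to the element of the Hardy space with the Fourier series
  \<open>\<Sum>n\<ge>0. fourier_coeff f n * chi n\<close>. For \<open>1 < p < \<infinity>\<close> and \<open>f \<in> Lp p\<close> it exists (M. Riesz) and
  is unique up to a null set, so the choice operator only picks a representative.
\<close>

definition riesz_projection :: "real \<Rightarrow> (complex \<Rightarrow> complex) \<Rightarrow> complex \<Rightarrow> complex" where
  "riesz_projection p f =
     (SOME g. g \<in> Hp p \<and> (\<forall>n\<ge>0. fourier_coeff g n = fourier_coeff f n))"

definition flip :: "(complex \<Rightarrow> complex) \<Rightarrow> complex \<Rightarrow> complex" where
  "flip f t = cnj t * f (cnj t)"

definition hankel_operator ::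
    "real \<Rightarrow> (complex \<Rightarrow> complex) \<Rightarrow> (complex \<Rightarrow> complex) \<Rightarrow> complex \<Rightarrow> complex" where
  "hankel_operator p b f = riesz_projection p (\<lambda>t. b t * flip f t)"

definition linear_operator_on_Hp ::
    "real \<Rightarrow> ((complex \<Rightarrow> complex) \<Rightarrow> complex \<Rightarrow> complex) \<Rightarrow> bool" where
  "linear_operator_on_Hp p A \<longleftrightarrow>
     (\<forall>f\<in>Hp p. A f \<in> Hp p) \<and>
     (\<forall>f\<in>Hp p. \<forall>g\<in>Hp p. (AE z in circle. f z = g z) \<longrightarrow> (AE z in circle. A f z = A g z)) \<and>
     (\<forall>f\<in>Hp p. \<forall>g\<in>Hp p. \<forall>a b.
        AE z in circle. A (\<lambda>w. a * f w + b * g w) z = a * A f z + b * A g z)"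

definition compact_operator_on_Hp ::
    "real \<Rightarrow> ((complex \<Rightarrow> complex) \<Rightarrow> complex \<Rightarrow> complex) \<Rightarrow> bool" where
  "compact_operator_on_Hp p A \<longleftrightarrow>
     linear_operator_on_Hp p A \<and>
     (\<forall>F :: nat \<Rightarrow> complex \<Rightarrow> complex.
        (\<forall>n. F n \<in> Hp p) \<and> (\<exists>M. \<forall>n. Lp_norm p (F n) \<le> M) \<longrightarrow>
        (\<exists>r h. strict_mono r \<and> h \<in> Hp p \<and>
           (\<lambda>n. Lp_norm p (\<lambda>z. A (F (r n)) z - h z)) \<longlonglongrightarrow> 0))"

definition Dplus :: "(complex \<Rightarrow> complex) set" where
  "Dplus = {f. \<exists>n c. f = (\<lambda>z. \<Sum>j<n. c j * chi (int j) z)}"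

text \<open>
  A form is represented by any function on pairs of functions; only its restriction to
  \<open>Dplus \<times> Dplus\<close> is meaningful, so forms are compared by \<open>form_eq\<close>.
\<close>

type_synonym form = "(complex \<Rightarrow> complex) \<Rightarrow> (complex \<Rightarrow> complex) \<Rightarrow> complex"

definition sesquilinear_form :: "form \<Rightarrow> bool" where
  "sesquilinear_form B \<longleftrightarrow>
     (\<forall>f\<in>Dplus. \<forall>g\<in>Dplus. \<forall>h\<in>Dplus. \<forall>a b.
        B (\<lambda>z. a * f z + b * g z) h = a * B f h + b * B g h \<and>
        B h (\<lambda>z. a * f z + b * g z) = cnj a * B h f + cnj b * B h g)"

definition form_eq :: "form \<Rightarrow> form \<Rightarrow> bool" where
  "form_eq B B' \<longleftrightarrow> (\<forall>f\<in>Dplus. \<forall>g\<in>Dplus. B f g = B' f g)"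

definition toeplitz_form :: "form \<Rightarrow> bool" where
  "toeplitz_form T \<longleftrightarrow> sesquilinear_form T \<and>
     (\<forall>j k :: nat. T (chi (int k)) (chi (int j)) = T (chi (int (k + 1))) (chi (int (j + 1))))"

definition hankel_form :: "form \<Rightarrow> bool" where
  "hankel_form H \<longleftrightarrow> sesquilinear_form H \<and>
     (\<forall>j k :: nat. H (chi (int (k + 1))) (chi (int j)) = H (chi (int k)) (chi (int (j + 1))))"

definition checkerboard_form :: "form \<Rightarrow> bool" where
  "checkerboard_form C \<longleftrightarrow> toeplitz_form C \<and> hankel_form C"

definition operator_form :: "((complex \<Rightarrow> complex) \<Rightarrow> complex \<Rightarrow> complex) \<Rightarrow> form" where
  "operator_form A f g = pairing (A f) g"

definition is_compact_operator_form :: "real \<Rightarrow> form \<Rightarrow> bool" where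
  "is_compact_operator_form p B \<longleftrightarrow>
     (\<exists>A. compact_operator_on_Hp p A \<and> form_eq B (operator_form A))"

end

theory Submission
  imports Defs "HOL-Computational_Algebra.Fundamental_Theorem_Algebra"
begin

text \<open>
  Let \<open>a(j,k)\<close> be the \<open>j\<close>-th Fourier coefficient of \<open>A (chi k)\<close>. If \<open>A\<close> is
  compact, every diagonal of this matrix tends to zero: a subsequence of \<open>A (chi k)\<close> has a limit
  \<open>h\<close> in \<open>L^p\<close>, so \<open>a(j,k)\<close> is close to the \<open>j\<close>-th coefficient of \<open>h\<close> uniformly in \<open>j\<close>, and these
  coefficients tend to zero by the Riemann--Lebesgue lemma (\<open>compact_operator_diagonal_tendsto_0\<close>).
  For \<open>A = T + H\<close> the difference \<open>a(n+j, n+k+1) - a(n+j+1, n+k)\<close> does not depend on \<open>n\<close>, because the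
  Hankel entries cancel and the Toeplitz entries are constant along diagonals; hence it vanishes, and
  this says that \<open>T\<close> is of Hankel type as well. So \<open>C = T\<close>, and \<open>A\<close> itself is a compact operator of
  Hankel type, \<open>a(j,k) = \<alpha>(j+k)\<close>. It remains to find a continuous \<open>b\<close> with \<open>\<alpha>(n)\<close> as its
  coefficient at \<open>n + 1\<close>; this is Hartman's theorem on \<open>H^p\<close>.

  Let \<open>\<phi>(h)\<close> be the sum of \<open>\<alpha>(n)\<close> times the \<open>n\<close>-th coefficient of the
  polynomial \<open>h\<close>. Pairing \<open>A f\<close> with the polynomial whose coefficients are conjugate to those of \<open>g\<close>
  gives \<open>\<phi>(f g)\<close>, so \<open>\<bar>\<phi>(f g)\<bar>\<close> is at most a constant times the product of the \<open>p\<close>-norm of \<open>f\<close> and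
  the \<open>q\<close>-norm of \<open>g\<close>. A polynomial without zeros on the circle is \<open>h = B u\<close> with \<open>\<bar>B\<bar> = 1\<close> on the
  circle and with \<open>u\<close> zero-free, so that all powers of \<open>u\<close> exist in the disc algebra
  (\<open>poly_inner_outer\<close>). Splitting \<open>h\<close> into \<open>B u^(1/p)\<close> and \<open>u^(1/q)\<close> bounds \<open>\<phi>\<close> by the \<open>L^1\<close> norm
  (\<open>functional_L1_bound\<close>).

  Write \<open>R f\<close> for the rotation \<open>f(w z)\<close>. Compactness makes
  \<open>\<phi>(h - R h)\<close> small relative to the \<open>L^1\<close> norm of \<open>h\<close> as \<open>w\<close> tends to 1 (\<open>rotation_L1_small\<close>). By
  factorization it is enough to treat \<open>\<phi>(f (g - R g))\<close> and \<open>\<phi>((f - R f) g)\<close>. In the first, \<open>A f\<close>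
  ranges over a relatively compact set and \<open>g - R g\<close> tends to zero weakly. In the second, \<open>A\<close> is
  applied to \<open>f - R f\<close>; every limit point of the images is zero as soon as its coefficients vanish,
  which amounts to \<open>\<phi>(f - R f)\<close> being small relative to the \<open>p\<close>-norm of \<open>f\<close>. That follows from the
  first estimate by factoring \<open>f\<close> into \<open>m\<close> factors with \<open>m p \<ge> q\<close> and telescoping
  (\<open>functional_rotation_bound\<close>).

  Averaging over rotations, the Fejer means of \<open>\<alpha>\<close> converge to \<open>\<alpha>\<close> in the norm dual
  to \<open>L^1\<close> (\<open>fejer_coeffs_approximation\<close>). A functional with finitely many coefficients comes from
  a trigonometric polynomial whose supremum is at most 3/2 times the norm of the functional
  (\<open>finite_symbol\<close>): by Hahn--Banach the functional extends to some negative frequencies, and its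
  values at the rotations of a trapezoidal kernel are the values of that trigonometric polynomial.
  So a telescoping series of Fejer means converges uniformly to a continuous \<open>b\<close>
  (\<open>continuous_symbol\<close>).

  For \<open>f\<close> in \<open>H^p\<close> the function \<open>A f\<close> belongs to \<open>H^p\<close> and has the nonnegative
  coefficients of \<open>b * flip f\<close>, first for polynomials and then by density. Fourier coefficients determine
  a function up to a null set, so \<open>A f\<close> is the Riesz projection of \<open>b * flip f\<close>
  (\<open>hankel_operator_eq_AE\<close>).
\<close>

section \<open>Normalized Lebesgue measure on the circle\<close>

lemma cis_measurable_circle: "cis \<in> measurable lborel (restrict_space borel (sphere 0 1))"
  by (rule measurable_restrict_space2) (auto intro!: borel_measurable_continuous_onI continuous_intros)

lemma cis_measurable_uniform:
  "cis \<in> measurable (uniform_measure lborel A) (restrict_space borel (sphere 0 1))"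
  using cis_measurable_circle by (simp add: measurable_def)

lemma space_circle [simp]: "space circle = sphere 0 1"
  by (simp add: circle_def space_restrict_space)

lemma sets_circle: "sets circle = sets (restrict_space borel (sphere 0 1))"
  by (simp add: circle_def)

lemma prob_space_circle: "prob_space circle"
  unfolding circle_def
  by (intro prob_space.prob_space_distr prob_space_uniform_measure cis_measurable_uniform) auto

interpretation circle: prob_space circle
  by (rule prob_space_circle)

lemma borel_measurable_circle_continuous:
  "continuous_on (sphere 0 1) f \<Longrightarrow> f \<in> borel_measurable circle"
  for f :: "complex \<Rightarrow> 'a::topological_space"
  by (simp add: measurable_cong_sets[OF sets_circle refl] borel_measurable_continuous_on_restrict)

text \<open>
  The half-open interval makes the translates used for rotations disjoint.
\<close>

lemma nn_integral_circle:
  assumes "f \<in> borel_measurable circle"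
  shows "(\<integral>\<^sup>+z. f z \<partial>circle) = (\<integral>\<^sup>+t. f (cis t) * indicator {0..<2*pi} t \<partial>lborel) / ennreal (2*pi)"
proof -
  have f: "f \<in> borel_measurable (restrict_space borel (sphere 0 1))"
    using assms by (simp add: measurable_cong_sets[OF sets_circle refl])
  have f': "f \<in> borel_measurable (distr M (restrict_space borel (sphere 0 1)) cis)" for M
    using f by simp
  have m: "(\<lambda>t. f (cis t)) \<in> borel_measurable lborel"
    by (rule measurable_compose[OF cis_measurable_circle f])
  have "(\<integral>\<^sup>+z. f z \<partial>circle) = (\<integral>\<^sup>+t. f (cis t) * indicator {0..2*pi} t \<partial>lborel) / ennreal (2*pi)"
    unfolding circle_def
    by (subst nn_integral_distr[OF cis_measurable_uniform f'], subst nn_integral_uniform_measure[OF m]) auto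
  also have "(\<integral>\<^sup>+t. f (cis t) * indicator {0..2*pi} t \<partial>lborel)
      = (\<integral>\<^sup>+t. f (cis t) * indicator {0..<2*pi} t \<partial>lborel)"
    using AE_lborel_singleton[of "2*pi"]
    by (intro nn_integral_cong_AE) (auto simp: indicator_def elim!: eventually_mono)
  finally show ?thesis .
qed

lemma rotation_measurable: "norm w = 1 \<Longrightarrow> (\<lambda>z. w * z) \<in> measurable circle circle" for w :: complex
  unfolding measurable_cong_sets[OF refl sets_circle, of circle]
  by (rule measurable_restrict_space2) (auto simp: norm_mult intro!: borel_measurable_circle_continuous
      continuous_intros)

lemma cnj_measurable: "cnj \<in> measurable circle circle"
  unfolding measurable_cong_sets[OF refl sets_circle, of circle]
  by (rule measurable_restrict_space2) (auto intro!: borel_measurable_circle_continuous continuous_intros)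

lemma measurable_cis_compose:
  fixes f :: "complex \<Rightarrow> 'a::topological_space"
  assumes "f \<in> borel_measurable circle"
  shows "(\<lambda>t. f (cis t)) \<in> borel_measurable borel"
  using measurable_compose[OF cis_measurable_circle, of f borel] assms
  by (simp add: measurable_cong_sets[OF sets_circle refl])

text \<open>
  A rotation translates the angle; the part of the interval that leaves \<open>[0, 2 \<pi>)\<close> is moved back
  by one period.
\<close>

lemma nn_integral_circle_rotation:
  fixes f :: "complex \<Rightarrow> ennreal"
  assumes f: "f \<in> borel_measurable circle" and w: "norm w = 1"
  shows "(\<integral>\<^sup>+z. f (w * z) \<partial>circle) = (\<integral>\<^sup>+z. f z \<partial>circle)"
proof -
  obtain a where a: "0 \<le> a" "a < 2*pi" "w = cis a"
  proof
    show "0 \<le> Arg2pi w" "Arg2pi w < 2*pi" using Arg2pi_ge_0 Arg2pi_lt_2pi by auto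
    show "w = cis (Arg2pi w)" using Arg2pi_eq[of w] w by (simp add: cis_conv_exp)
  qed
  define g where "g t = f (cis t)" for t
  have g [measurable]: "g \<in> borel_measurable borel"
    unfolding g_def by (rule measurable_cis_compose[OF f])
  have per: "g (t + 2*pi) = g t" for t by (simp add: g_def flip: cis_mult)
  have "(\<integral>\<^sup>+t. g (a + t) * indicator {0..<2*pi} t \<partial>lborel)
      = (\<integral>\<^sup>+t. g (a + t) * indicator {a..<a+2*pi} (a + t) \<partial>lborel)"
    by (intro nn_integral_cong) (auto simp: indicator_def)
  also have "\<dots> = (\<integral>\<^sup>+t. g t * indicator {a..<a+2*pi} t \<partial>lborel)"
    using nn_integral_real_affine[of "\<lambda>t. g t * indicator {a..<a+2*pi} t" 1 a] by simp
  also have "\<dots> = (\<integral>\<^sup>+t. g t * indicator {a..<2*pi} t + g t * indicator {2*pi..<2*pi+a} t \<partial>lborel)"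
    using a by (intro nn_integral_cong) (auto simp: indicator_def)
  also have "\<dots> = (\<integral>\<^sup>+t. g t * indicator {a..<2*pi} t \<partial>lborel)
      + (\<integral>\<^sup>+t. g t * indicator {2*pi..<2*pi+a} t \<partial>lborel)"
    by (intro nn_integral_add) auto
  also have "(\<integral>\<^sup>+t. g t * indicator {2*pi..<2*pi+a} t \<partial>lborel)
      = (\<integral>\<^sup>+t. g (2*pi+t) * indicator {2*pi..<2*pi+a} (2*pi+t) \<partial>lborel)"
    using nn_integral_real_affine[of "\<lambda>t. g t * indicator {2*pi..<2*pi+a} t" 1 "2*pi"] by simp
  also have "\<dots> = (\<integral>\<^sup>+t. g t * indicator {0..<a} t \<partial>lborel)"
    using per by (intro nn_integral_cong) (auto simp: indicator_def add.commute)
  also have "(\<integral>\<^sup>+t. g t * indicator {a..<2*pi} t \<partial>lborel) + \<dots> = (\<integral>\<^sup>+t. g t * indicator {a..<2*pi} t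
      + g t * indicator {0..<a} t \<partial>lborel)"
    by (intro nn_integral_add[symmetric]) auto
  also have "\<dots> = (\<integral>\<^sup>+t. g t * indicator {0..<2*pi} t \<partial>lborel)"
    using a by (intro nn_integral_cong) (auto simp: indicator_def)
  finally have *: "(\<integral>\<^sup>+t. g (a + t) * indicator {0..<2*pi} t \<partial>lborel)
      = (\<integral>\<^sup>+t. g t * indicator {0..<2*pi} t \<partial>lborel)" .
  have "(\<integral>\<^sup>+z. f (w * z) \<partial>circle) = (\<integral>\<^sup>+t. f (w * cis t) * indicator {0..<2*pi} t \<partial>lborel) / ennreal (2*pi)"
    by (rule nn_integral_circle, rule measurable_compose[OF rotation_measurable[OF w] f])
  also have "\<dots> = (\<integral>\<^sup>+z. f z \<partial>circle)"
    using * by (simp add: nn_integral_circle[OF f] a(3) cis_mult g_def)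
  finally show ?thesis .
qed

lemma nn_integral_circle_cnj:
  fixes f :: "complex \<Rightarrow> ennreal"
  assumes f: "f \<in> borel_measurable circle"
  shows "(\<integral>\<^sup>+z. f (cnj z) \<partial>circle) = (\<integral>\<^sup>+z. f z \<partial>circle)"
proof -
  define g where "g t = f (cis t)" for t
  have g [measurable]: "g \<in> borel_measurable borel"
    unfolding g_def by (rule measurable_cis_compose[OF f])
  have per: "g (2*pi - t) = f (cnj (cis t))" for t
    by (simp add: g_def cis_cnj cis_divide[symmetric] inverse_eq_divide[symmetric])
  have "(\<integral>\<^sup>+t. g t * indicator {0..<2*pi} t \<partial>lborel) = (\<integral>\<^sup>+t. g (2*pi
      + (-1) * t) * indicator {0..<2*pi} (2*pi + (-1)*t) \<partial>lborel)"
    using nn_integral_real_affine[of "\<lambda>t. g t * indicator {0..<2*pi} t" "-1" "2*pi"] by simp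
  also have "\<dots> = (\<integral>\<^sup>+t. f (cnj (cis t)) * indicator {0..<2*pi} t \<partial>lborel)"
    using AE_lborel_singleton[of "2*pi"] AE_lborel_singleton[of "0"]
    by (intro nn_integral_cong_AE) (auto simp: indicator_def per[symmetric] elim!: eventually_elim2)
  finally show ?thesis
    using nn_integral_circle[OF f] nn_integral_circle[OF measurable_compose[OF cnj_measurable f]] by
        (simp add: g_def)
qed

lemma distr_circle_rotation: "norm w = 1 \<Longrightarrow> distr circle circle (\<lambda>z. w * z) = circle"
proof (rule measure_eqI)
  fix A assume w: "norm w = 1" and "A \<in> sets (distr circle circle (\<lambda>z. w * z))"
  then have A: "A \<in> sets circle" by simp
  have "emeasure (distr circle circle (\<lambda>z. w * z)) A = (\<integral>\<^sup>+z. indicator A z \<partial>distr circle circle (\<lambda>z. w * z))"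
    using A by simp
  also have "\<dots> = emeasure circle A"
    using A w by (subst nn_integral_distr[OF rotation_measurable])
      (auto simp: nn_integral_circle_rotation)
  finally show "emeasure (distr circle circle (\<lambda>z. w * z)) A = emeasure circle A" .
qed simp

lemma distr_circle_cnj: "distr circle circle cnj = circle"
proof (rule measure_eqI)
  fix A assume "A \<in> sets (distr circle circle cnj)"
  then have A: "A \<in> sets circle" by simp
  have "emeasure (distr circle circle cnj) A = (\<integral>\<^sup>+z. indicator A z \<partial>distr circle circle cnj)"
    using A by simp
  also have "\<dots> = emeasure circle A"
    using A by (subst nn_integral_distr[OF cnj_measurable]) (auto simp: nn_integral_circle_cnj)
  finally show "emeasure (distr circle circle cnj) A = emeasure circle A" .
qed simp

lemma integral_circle_rotation:
  fixes f :: "complex \<Rightarrow> 'a::{banach, second_countable_topology}"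
  assumes "f \<in> borel_measurable circle" "norm w = 1"
  shows "(LINT z|circle. f (w * z)) = (LINT z|circle. f z)"
  using integral_distr[OF rotation_measurable[OF assms(2)] assms(1)] by (simp add: distr_circle_rotation assms)

lemma integral_circle_cnj:
  fixes f :: "complex \<Rightarrow> 'a::{banach, second_countable_topology}"
  assumes "f \<in> borel_measurable circle"
  shows "(LINT z|circle. f (cnj z)) = (LINT z|circle. f z)"
  using integral_distr[OF cnj_measurable assms(1)] by (simp add: distr_circle_cnj)

lemma integrable_circle_cnj:
  fixes f :: "complex \<Rightarrow> 'a::{banach, second_countable_topology}"
  assumes "integrable circle f"
  shows "integrable circle (\<lambda>z. f (cnj z))"
  using integrable_distr[OF cnj_measurable] assms by (simp add: distr_circle_cnj)

lemma integrable_circle_continuous: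
  fixes f :: "complex \<Rightarrow> 'a::{banach, second_countable_topology}"
  assumes "continuous_on (sphere 0 1) f"
  shows "integrable circle f"
proof -
  have "bounded (f ` sphere 0 1)"
    using assms by (intro compact_imp_bounded compact_continuous_image) auto
  then obtain B where "\<And>z. z \<in> sphere 0 1 \<Longrightarrow> norm (f z) \<le> B" unfolding bounded_iff by (meson imageI)
  then show ?thesis
    by (intro circle.integrable_const_bound[of _ B] borel_measurable_circle_continuous assms AE_I2) simp
qed

lemma continuous_on_chi [continuous_intros]: "continuous_on (sphere 0 1) (chi n)"
  unfolding chi_def by (intro continuous_intros) auto

text \<open>
  Rotation by \<open>\<pi> / n\<close> changes the sign of \<open>chi n\<close> and preserves the integral.
\<close>

lemma integral_chi: "(LINT z|circle. chi n z) = (if n = 0 then 1 else 0)"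
proof (cases "n = 0")
  case False
  define w where "w = cis (pi / of_int n)"
  have "chi n (w * z) = - chi n z" for z
    using False by (simp add: chi_def power_int_mult_distrib w_def cis_power_int)
  moreover have "(LINT z|circle. chi n (w * z)) = (LINT z|circle. chi n z)"
    by (intro integral_circle_rotation borel_measurable_circle_continuous continuous_intros) (simp add: w_def)
  ultimately have "(LINT z|circle. chi n z) = - (LINT z|circle. chi n z)" by simp
  then show ?thesis using False by simp
qed (use circle.prob_space in \<open>simp add: chi_def\<close>)

lemma cnj_eq_inverse: "norm z = 1 \<Longrightarrow> cnj z = inverse z"
  using divide_conv_cnj[of z 1] by (simp add: inverse_eq_divide)

lemma integral_power_circle: "(LINT z|circle. z ^ n * cnj z ^ m) = (if n = m then 1 else 0)"
proof -
  have "(LINT z|circle. z ^ n * cnj z ^ m) = (LINT z|circle. chi (int n - int m) z)"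
  proof (rule Bochner_Integration.integral_cong)
    fix z assume "z \<in> space circle"
    then have z: "norm z = 1" by simp
    then have "cnj z = inverse z" by (rule cnj_eq_inverse)
    then show "z ^ n * cnj z ^ m = chi (int n - int m) z"
      using z by (subst chi_def, subst power_int_diff) (auto simp: field_simps)
  qed simp
  then show ?thesis by (simp add: integral_chi)
qed

section \<open>Lebesgue spaces on the circle\<close>

lemma LpD:
  assumes "f \<in> Lp p"
  shows "f \<in> borel_measurable circle" "integrable circle (\<lambda>z. norm (f z) powr p)"
  using assms by (auto simp: Lp_def)

lemma Lp_norm_nonneg [simp]: "0 \<le> Lp_norm p f"
  by (simp add: Lp_norm_def)

lemma Lp_norm_powr:
  assumes "0 < p"
  shows "Lp_norm p f powr p = (LINT z|circle. norm (f z) powr p)"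
  using assms by (simp add: Lp_norm_def powr_powr integral_nonneg_AE)

lemma Lp_norm_le:
  assumes "0 < p" "0 \<le> s" "(LINT z|circle. norm (f z) powr p) \<le> s powr p"
  shows "Lp_norm p f \<le> s"
proof -
  have "(LINT z|circle. norm (f z) powr p) powr (1/p) \<le> (s powr p) powr (1/p)"
    using assms by (intro powr_mono2) (auto intro!: integral_nonneg_AE)
  then show ?thesis using assms by (simp add: Lp_norm_def powr_powr)
qed

lemma Lp_norm_cong_AE:
  assumes "AE z in circle. f z = g z" "f \<in> borel_measurable circle" "g \<in> borel_measurable circle"
  shows "Lp_norm p f = Lp_norm p g"
  unfolding Lp_norm_def using assms
  by (auto intro!: arg_cong[where f="\<lambda>x. x powr (1/p)"] integral_cong_AE elim!: eventually_mono)

lemma Lp_norm_cong: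
  assumes "\<And>z. norm z = 1 \<Longrightarrow> norm (f z) = norm (g z)"
  shows "Lp_norm p f = Lp_norm p g"
  unfolding Lp_norm_def using assms
  by (auto intro!: arg_cong[where f="\<lambda>x. x powr (1/p)"] Bochner_Integration.integral_cong)

lemma Lp_cong:
  assumes "f \<in> Lp p" "\<And>z. norm z = 1 \<Longrightarrow> f z = g z"
  shows "g \<in> Lp p"
proof -
  have "g \<in> borel_measurable circle"
    using LpD(1)[OF assms(1)] assms(2) by (subst measurable_cong[of circle g f]) auto
  moreover have "integrable circle (\<lambda>z. norm (g z) powr p)"
    using LpD(2)[OF assms(1)] assms(2) by (subst Bochner_Integration.integrable_cong[of circle circle _
        "\<lambda>z. norm (f z) powr p"]) auto
  ultimately show ?thesis by (simp add: Lp_def)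
qed

lemma AE_eq_0_of_Lp_norm_eq_0:
  assumes "f \<in> Lp p" "Lp_norm p f = 0"
  shows "AE z in circle. f z = 0"
proof -
  have "(LINT z|circle. norm (f z) powr p) = 0" using assms by (simp add: Lp_norm_def)
  then have "AE z in circle. norm (f z) powr p = 0"
    using integral_nonneg_eq_0_iff_AE[OF LpD(2)[OF assms(1)]] by simp
  then show ?thesis by (auto elim!: eventually_mono)
qed

lemma Lp_norm_eq_0_of_AE:
  assumes "AE z in circle. f z = 0"
  shows "Lp_norm p f = 0"
proof -
  have "(LINT z|circle. norm (f z) powr p) = 0"
    using assms by (intro integral_eq_zero_AE) (auto elim!: eventually_mono)
  then show ?thesis by (simp add: Lp_norm_def)
qed

lemma Lp_cmult:
  assumes "f \<in> Lp p"
  shows "(\<lambda>z. c * f z) \<in> Lp p"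
  using assms by (auto simp: Lp_def norm_mult powr_mult)

lemma Lp_norm_cmult:
  assumes "0 < p"
  shows "Lp_norm p (\<lambda>z. c * f z) = norm c * Lp_norm p f"
  using assms by (simp add: Lp_norm_def norm_mult powr_mult powr_powr)

lemma powr_convex_combination:
  fixes x y l m p :: real
  assumes "1 \<le> p" "0 \<le> x" "0 \<le> y" "0 \<le> l" "0 \<le> m" "l + m = 1"
  shows "(l * x + m * y) powr p \<le> l * x powr p + m * y powr p"
proof (cases "x = 0 \<or> y = 0")
  case False
  then have "(l *\<^sub>R x + m *\<^sub>R y) powr p \<le> l * x powr p + m * y powr p"
    using assms powr_convex[OF assms(1)] unfolding convex_on_def by auto
  then show ?thesis by simp
next
  case True
  have *: "t powr p \<le> t" if "0 \<le> t" "t \<le> 1" for t :: real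
    using that assms by (cases "t = 0") (auto intro: powr_le_one_le simp: powr_le_one_le)
  show ?thesis
    using True assms *[of l] *[of m] by (auto simp: powr_mult mult_right_mono)
qed

lemma Lp_add:
  assumes p: "1 \<le> p" and f: "f \<in> Lp p" and g: "g \<in> Lp p"
  shows "(\<lambda>z. f z + g z) \<in> Lp p"
proof -
  have m [measurable]: "f \<in> borel_measurable circle" "g \<in> borel_measurable circle"
    using LpD f g by auto
  have "integrable circle (\<lambda>z. norm (f z + g z) powr p)"
  proof (rule Bochner_Integration.integrable_bound)
    show "integrable circle (\<lambda>z. 2 powr p * (norm (f z) powr p + norm (g z) powr p))"
      using LpD[OF f] LpD[OF g] by auto
    show "AE z in circle. norm (norm (f z + g z) powr p)
            \<le> norm (2 powr p * (norm (f z) powr p + norm (g z) powr p))"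
    proof (intro AE_I2)
      fix z
      have "norm (f z + g z) powr p \<le> (2 * ((1/2) * norm (f z) + (1/2) * norm (g z))) powr p"
        using p by (intro powr_mono2) (auto simp: norm_triangle_ineq)
      also have "\<dots> = 2 powr p * ((1/2) * norm (f z) + (1/2) * norm (g z)) powr p"
        by (subst powr_mult) auto
      also have "\<dots> \<le> 2 powr p * ((1/2) * norm (f z) powr p + (1/2) * norm (g z) powr p)"
        using p by (intro mult_left_mono powr_convex_combination) auto
      also have "\<dots> \<le> 2 powr p * (norm (f z) powr p + norm (g z) powr p)"
        by (intro mult_left_mono add_mono) auto
      finally show "norm (norm (f z + g z) powr p)
            \<le> norm (2 powr p * (norm (f z) powr p + norm (g z) powr p))" by simp
    qed
  qed simp
  then show ?thesis by (simp add: Lp_def)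
qed

text \<open>
  Minkowski's inequality. For \<open>s\<close> and \<open>t\<close> slightly larger than the two norms, \<open>f + g\<close> divided by
  \<open>s + t\<close> is a convex combination of \<open>f / s\<close> and \<open>g / t\<close>, and \<open>x powr p\<close> is convex.
\<close>

lemma Lp_norm_triangle:
  assumes p: "1 \<le> p" and f: "f \<in> Lp p" and g: "g \<in> Lp p"
  shows "Lp_norm p (\<lambda>z. f z + g z) \<le> Lp_norm p f + Lp_norm p g"
proof (rule field_le_epsilon)
  fix e :: real assume e: "e > 0"
  define s where "s = Lp_norm p f + e/2"
  define t where "t = Lp_norm p g + e/2"
  have st: "s > 0" "t > 0" using e by (auto simp: s_def t_def add_nonneg_pos)
  have fs: "(LINT z|circle. norm (f z) powr p) \<le> s powr p"
    using p e by (subst Lp_norm_powr[symmetric]) (auto intro!: powr_mono2 simp: s_def)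
  have gt: "(LINT z|circle. norm (g z) powr p) \<le> t powr p"
    using p e by (subst Lp_norm_powr[symmetric]) (auto intro!: powr_mono2 simp: t_def)
  let ?l = "s / (s + t)" and ?m = "t / (s + t)"
  have lm: "?l + ?m = 1" using st by (simp flip: add_divide_distrib)
  have "(LINT z|circle. norm (f z + g z) powr p) \<le>
     (LINT z|circle. (s+t) powr p * (?l / s powr p * norm (f z) powr p + ?m / t powr p * norm (g z) powr p))"
  proof (rule integral_mono)
    show "integrable circle (\<lambda>z. norm (f z + g z) powr p)"
      using LpD[OF Lp_add[OF p f g]] by simp
    show "integrable circle (\<lambda>z. (s+t) powr p * (?l / s powr p * norm (f z) powr p
        + ?m / t powr p * norm (g z) powr p))"
      using LpD[OF f] LpD[OF g] by (intro integrable_mult_right Bochner_Integration.integrable_add) auto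
    fix z
    have "(s+t) * (?l * (norm (f z) / s) + ?m * (norm (g z) / t)) = norm (f z) + norm (g z)"
      using st by (simp add: distrib_left)
    then have "norm (f z + g z) powr p \<le> ((s+t) * (?l * (norm (f z) / s) + ?m * (norm (g z) / t))) powr p"
      using p by (intro powr_mono2) (auto simp: norm_triangle_ineq)
    also have "\<dots> = (s+t) powr p * (?l * (norm (f z) / s) + ?m * (norm (g z) / t)) powr p"
      using st by (subst powr_mult) auto
    also have "\<dots> \<le> (s+t) powr p * (?l * (norm (f z) / s) powr p + ?m * (norm (g z) / t) powr p)"
      using p st lm by (intro mult_left_mono powr_convex_combination) auto
    also have "\<dots> = (s+t) powr p * (?l / s powr p * norm (f z) powr p + ?m / t powr p * norm (g z) powr p)"
      using st by (simp add: powr_divide)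
    finally show "norm (f z + g z) powr p \<le> \<dots>" .
  qed
  also have "\<dots> = (s+t) powr p * (?l / s powr p * (LINT z|circle. norm (f z) powr p)
      + ?m / t powr p * (LINT z|circle. norm (g z) powr p))"
    using LpD[OF f] LpD[OF g] by (subst integral_mult_right_zero, subst Bochner_Integration.integral_add) auto
  also have "\<dots> \<le> (s+t) powr p * (?l / s powr p * s powr p + ?m / t powr p * t powr p)"
    using fs gt st by (intro mult_left_mono add_mono) auto
  also have "\<dots> = (s+t) powr p" using st lm by simp
  finally have "Lp_norm p (\<lambda>z. f z + g z) \<le> s + t"
    using p st by (intro Lp_norm_le) auto
  then show "Lp_norm p (\<lambda>z. f z + g z) \<le> Lp_norm p f + Lp_norm p g + e"
    by (simp add: s_def t_def)
qed

lemma Lp_diff: "1 \<le> p \<Longrightarrow> f \<in> Lp p \<Longrightarrow> g \<in> Lp p \<Longrightarrow> (\<lambda>z. f z - g z) \<in> Lp p"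
  using Lp_add[of p f "\<lambda>z. (-1) * g z"] Lp_cmult[of g p "-1"] by simp

lemma Lp_norm_diff_le:
  assumes "1 \<le> p" "f \<in> Lp p" "g \<in> Lp p"
  shows "Lp_norm p (\<lambda>z. f z - g z) \<le> Lp_norm p f + Lp_norm p g"
  using Lp_norm_triangle[OF assms(1,2) Lp_cmult[OF assms(3), of "-1"]] Lp_norm_cmult[of p "-1" g] assms by simp

lemma Lp_norm_diff_commute: "Lp_norm p (\<lambda>z. f z - g z) = Lp_norm p (\<lambda>z. g z - f z)"
  by (intro Lp_norm_cong) (simp add: norm_minus_commute)

lemma Lp_norm_triangle_diff:
  assumes "1 \<le> p" "f \<in> Lp p" "g \<in> Lp p" "h \<in> Lp p"
  shows "Lp_norm p (\<lambda>z. f z - h z) \<le> Lp_norm p (\<lambda>z. f z - g z) + Lp_norm p (\<lambda>z. g z - h z)"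
  using Lp_norm_triangle[OF assms(1) Lp_diff[OF assms(1,2,3)] Lp_diff[OF assms(1,3,4)]] by simp

lemma Lp_norm_diff_ge:
  assumes "1 \<le> p" "f \<in> Lp p" "g \<in> Lp p"
  shows "\<bar>Lp_norm p f - Lp_norm p g\<bar> \<le> Lp_norm p (\<lambda>z. f z - g z)"
  using Lp_norm_triangle[OF assms(1) assms(3) Lp_diff[OF assms(1,2,3)]]
    Lp_norm_triangle[OF assms(1) assms(2) Lp_diff[OF assms(1,3,2)]] Lp_norm_diff_commute[of p f g]
  by simp

lemma Lp_sum:
  assumes "1 \<le> p" "finite I" "\<And>i. i \<in> I \<Longrightarrow> f i \<in> Lp p"
  shows "(\<lambda>z. \<Sum>i\<in>I. f i z) \<in> Lp p \<and> Lp_norm p (\<lambda>z. \<Sum>i\<in>I. f i z) \<le> (\<Sum>i\<in>I. Lp_norm p (f i))"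
  using assms(2,3)
proof (induction I)
  case empty
  then show ?case using assms(1) Lp_norm_eq_0_of_AE[of "\<lambda>_. 0" p] by (auto simp: Lp_def)
next
  case (insert i I)
  have a: "f i \<in> Lp p" "(\<lambda>z. \<Sum>i\<in>I. f i z) \<in> Lp p" using insert by auto
  show ?case
    using Lp_add[OF assms(1) a] Lp_norm_triangle[OF assms(1) a] insert by (simp add: order.trans)
qed

lemma Lp_norm_bounded:
  assumes "0 < p" "f \<in> borel_measurable circle" "0 \<le> B" "AE z in circle. norm (f z) \<le> B"
  shows "f \<in> Lp p" "Lp_norm p f \<le> B"
proof -
  have b: "AE z in circle. norm (norm (f z) powr p) \<le> B powr p"
    using assms by (auto elim!: eventually_mono intro: powr_mono2)
  have i: "integrable circle (\<lambda>z. norm (f z) powr p)"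
    using assms(2) by (intro circle.integrable_const_bound[OF b]) auto
  then show "f \<in> Lp p" using assms by (simp add: Lp_def)
  have "(LINT z|circle. norm (f z) powr p) \<le> (LINT z|circle. B powr p)"
    using i b by (intro integral_mono_AE) auto
  then show "Lp_norm p f \<le> B" using assms circle.prob_space by (intro Lp_norm_le) auto
qed

lemma Lp_norm_le_on_circle:
  assumes "0 < p" "f \<in> borel_measurable circle" "\<And>z. norm z = 1 \<Longrightarrow> norm (f z) \<le> B"
  shows "f \<in> Lp p" "Lp_norm p f \<le> B"
proof -
  have "norm (f 1) \<le> B" using assms(3)[of 1] by simp
  then have "0 \<le> B" using norm_ge_zero order.trans by blast
  then show "f \<in> Lp p" "Lp_norm p f \<le> B"
    using assms by (auto intro!: Lp_norm_bounded[of p f B] AE_I2)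
qed

lemma Lp_continuous:
  assumes "0 < p" "continuous_on (sphere 0 1) f"
  shows "f \<in> Lp p"
proof -
  have "bounded (f ` sphere 0 1)"
    using assms by (intro compact_imp_bounded compact_continuous_image) auto
  then obtain B where "\<And>z. z \<in> sphere 0 1 \<Longrightarrow> norm (f z) \<le> B" unfolding bounded_iff by (meson imageI)
  then show ?thesis
    by (intro Lp_norm_le_on_circle[of p f B] borel_measurable_circle_continuous assms) auto
qed

text \<open>
  Young's inequality is applied to \<open>f / s\<close> and \<open>g / t\<close> with \<open>s\<close> and \<open>t\<close> slightly larger than the
  norms, which covers the case of a vanishing norm.
\<close>

lemma Hoelder_circle:
  assumes p: "1 < p" "1 < q" "1 / p + 1 / q = 1" and f: "f \<in> Lp p" and g: "g \<in> Lp q"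
  shows "integrable circle (\<lambda>z. f z * g z)"
    and "(LINT z|circle. norm (f z * g z)) \<le> Lp_norm p f * Lp_norm q g"
proof -
  have m [measurable]: "f \<in> borel_measurable circle" "g \<in> borel_measurable circle"
    using LpD f g by auto
  have Y: "norm (f z * g z) \<le> s * t * (norm (f z) powr p / s powr p / p + norm (g z) powr q / t powr q / q)"
    if "s > 0" "t > 0" for s t z
  proof -
    have "norm (f z * g z) = s * t * ((norm (f z) / s) * (norm (g z) / t))"
      using that by (simp add: norm_mult)
    also have "\<dots> \<le> s * t * ((norm (f z) / s) powr p / p + (norm (g z) / t) powr q / q)"
      using that p by (intro mult_left_mono Youngs_inequality) auto
    finally show ?thesis using that by (simp add: powr_divide)
  qed
  have i: "integrable circle (\<lambda>z. s * t * (norm (f z) powr p / s powr p / p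
      + norm (g z) powr q / t powr q / q))" for s t
    using LpD[OF f] LpD[OF g] by auto
  show int: "integrable circle (\<lambda>z. f z * g z)"
    using Y[of 1 1] by (intro Bochner_Integration.integrable_bound[OF i[of 1 1]])
        (auto intro!: AE_I2 order.trans[OF _ abs_ge_self])
  have main: "(LINT z|circle. norm (f z * g z)) \<le> (Lp_norm p f + e) * (Lp_norm q g + e)" if "e > 0" for e
  proof -
    define s where "s = Lp_norm p f + e"
    define t where "t = Lp_norm q g + e"
    have st: "s > 0" "t > 0" using that by (auto simp: s_def t_def add_nonneg_pos)
    have fs: "(LINT z|circle. norm (f z) powr p) \<le> s powr p"
      using p that by (subst Lp_norm_powr[symmetric]) (auto intro!: powr_mono2 simp: s_def)
    have gt: "(LINT z|circle. norm (g z) powr q) \<le> t powr q"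
      using p that by (subst Lp_norm_powr[symmetric]) (auto intro!: powr_mono2 simp: t_def)
    have "(LINT z|circle. norm (f z * g z)) \<le> (LINT z|circle. s * t * (norm (f z) powr p / s powr p / p
        + norm (g z) powr q / t powr q / q))"
      using int Y[OF st] i[of s t] by (intro integral_mono) auto
    also have "\<dots> = s * t * ((LINT z|circle. norm (f z) powr p) / s powr p / p
        + (LINT z|circle. norm (g z) powr q) / t powr q / q)"
      using LpD[OF f] LpD[OF g] by (subst integral_mult_right_zero, subst Bochner_Integration.integral_add) auto
    also have "\<dots> \<le> s * t * (1 / p + 1 / q)"
      using p st fs gt by (intro mult_left_mono add_mono divide_right_mono) auto
    also have "\<dots> = s * t" using p by simp
    finally show ?thesis by (simp add: s_def t_def)
  qed
  have "((\<lambda>e. (Lp_norm p f + e) * (Lp_norm q g + e)) \<longlongrightarrow> (Lp_norm p f + 0) * (Lp_norm q g + 0)) (at_right 0)"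
    by (intro tendsto_intros)
  then have "(LINT z|circle. norm (f z * g z)) \<le> (Lp_norm p f + 0) * (Lp_norm q g + 0)"
    using main by (intro tendsto_lowerbound[of _ _ "at_right 0"])
        (auto simp: eventually_at_right_less intro: eventually_at_rightI[of 0 1])
  then show "(LINT z|circle. norm (f z * g z)) \<le> Lp_norm p f * Lp_norm q g" by simp
qed

lemma Lp_imp_integrable:
  assumes p: "1 < p" and f: "f \<in> Lp p"
  shows "integrable circle f" "(LINT z|circle. norm (f z)) \<le> Lp_norm p f"
proof -
  define q where "q = p / (p - 1)"
  have q: "1 < q" "1 / p + 1 / q = 1" using p by (auto simp: q_def field_simps)
  have one: "(\<lambda>z. 1) \<in> Lp q" "Lp_norm q (\<lambda>z. 1) \<le> 1"
    using q Lp_norm_le_on_circle[of q "\<lambda>z. 1" 1] by auto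
  show "integrable circle f" using Hoelder_circle(1)[OF p q f one(1)] by simp
  have "(LINT z|circle. norm (f z)) \<le> Lp_norm p f * Lp_norm q (\<lambda>z. 1)"
    using Hoelder_circle(2)[OF p q f one(1)] by simp
  also have "\<dots> \<le> Lp_norm p f * 1" using one by (intro mult_left_mono) auto
  finally show "(LINT z|circle. norm (f z)) \<le> Lp_norm p f" by simp
qed

lemma norm_chi [simp]: "norm z = 1 \<Longrightarrow> norm (chi n z) = 1"
  by (simp add: chi_def norm_power_int)

lemma integrable_mult_continuous:
  fixes f g :: "complex \<Rightarrow> complex"
  assumes f: "integrable circle f" and g: "continuous_on (sphere 0 1) g"
  shows "integrable circle (\<lambda>z. f z * g z)"
proof -
  have "bounded (g ` sphere 0 1)"
    using g by (intro compact_imp_bounded compact_continuous_image) auto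
  then obtain B where B: "\<And>z. z \<in> sphere 0 1 \<Longrightarrow> norm (g z) \<le> B" unfolding bounded_iff by (meson imageI)
  show ?thesis
  proof (rule Bochner_Integration.integrable_bound)
    show "integrable circle (\<lambda>z. of_real B * f z)" using f by auto
    show "AE z in circle. norm (f z * g z) \<le> norm (of_real B * f z)"
    proof (intro AE_I2)
      fix z assume "z \<in> space circle"
      then have "norm (g z) \<le> \<bar>B\<bar>" using B[of z] by simp
      then show "norm (f z * g z) \<le> norm (of_real B * f z)"
        using mult_left_mono[of "norm (g z)" "\<bar>B\<bar>" "norm (f z)"] by (simp add: norm_mult mult.commute)
    qed
    show "(\<lambda>z. f z * g z) \<in> borel_measurable circle"
      using f borel_measurable_circle_continuous[OF g] by (intro borel_measurable_times) auto
  qed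
qed

lemma integrable_fourier:
  assumes "integrable circle f"
  shows "integrable circle (\<lambda>z. f z * cnj (chi n z))"
  by (intro integrable_mult_continuous assms continuous_intros)

lemma fourier_coeff_linear:
  assumes "integrable circle f" "integrable circle g"
  shows "fourier_coeff (\<lambda>z. a * f z + b * g z) n = a * fourier_coeff f n + b * fourier_coeff g n"
proof -
  have "fourier_coeff (\<lambda>z. a * f z + b * g z) n
      = (LINT z|circle. a * (f z * cnj (chi n z)) + b * (g z * cnj (chi n z)))"
    by (simp add: fourier_coeff_def pairing_def algebra_simps)
  then show ?thesis using integrable_fourier[OF assms(1)] integrable_fourier[OF assms(2)]
    by (simp add: fourier_coeff_def pairing_def)
qed

lemma fourier_coeff_diff:
  assumes "integrable circle f" "integrable circle g"
  shows "fourier_coeff (\<lambda>z. f z - g z) n = fourier_coeff f n - fourier_coeff g n"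
  using fourier_coeff_linear[OF assms, of 1 "-1"] by simp

lemma norm_fourier_coeff_le:
  assumes "integrable circle f"
  shows "norm (fourier_coeff f n) \<le> (LINT z|circle. norm (f z))"
proof -
  have "norm (fourier_coeff f n) \<le> (LINT z|circle. norm (f z * cnj (chi n z)))"
    unfolding fourier_coeff_def pairing_def by (rule integral_norm_bound)
  also have "\<dots> = (LINT z|circle. norm (f z))"
    by (intro Bochner_Integration.integral_cong) (auto simp: norm_mult)
  finally show ?thesis .
qed

lemma norm_fourier_coeff_le_Lp:
  assumes "1 < p" "f \<in> Lp p"
  shows "norm (fourier_coeff f n) \<le> Lp_norm p f"
  using norm_fourier_coeff_le[OF Lp_imp_integrable(1)[OF assms]] Lp_imp_integrable(2)[OF assms]
      by (rule order.trans)

lemma fourier_coeff_cong_AE: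
  assumes "AE z in circle. f z = g z" "f \<in> borel_measurable circle" "g \<in> borel_measurable circle"
  shows "fourier_coeff f n = fourier_coeff g n"
  unfolding fourier_coeff_def pairing_def using assms
  by (intro integral_cong_AE borel_measurable_times borel_measurable_circle_continuous[of
      "\<lambda>z. cnj (chi n z)"] continuous_intros)
     (auto elim!: eventually_mono)

section \<open>Density of trigonometric polynomials\<close>

text \<open>
  Given inductively because the statements about Fejer means are linear and so reduce to single
  characters.
\<close>

inductive trig_poly :: "(complex \<Rightarrow> complex) \<Rightarrow> bool" where
  monomial: "trig_poly (\<lambda>z. c * chi n z)"
| add: "trig_poly f \<Longrightarrow> trig_poly g \<Longrightarrow> trig_poly (\<lambda>z. f z + g z)"

lemma trig_poly_continuous: "trig_poly f \<Longrightarrow> continuous_on (sphere 0 1) f"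
  by (induction rule: trig_poly.induct) (auto intro!: continuous_intros)

lemma trig_poly_cmult: "trig_poly f \<Longrightarrow> trig_poly (\<lambda>z. c * f z)"
proof (induction rule: trig_poly.induct)
  case (monomial d n)
  then show ?case using trig_poly.monomial[of "c * d" n] by (simp add: mult.assoc)
next
  case (add f g)
  then show ?case using trig_poly.add by (simp add: distrib_left)
qed

lemma trig_poly_const: "trig_poly (\<lambda>z. c)"
  using trig_poly.monomial[of c 0] by (simp add: chi_def)

lemma chi_mult: "norm z = 1 \<Longrightarrow> chi m z * chi n z = chi (m + n) z"
  by (subst (3) chi_def, subst power_int_add) (auto simp: chi_def)

lemma trig_poly_chi_mult: "trig_poly f \<Longrightarrow> \<exists>h. trig_poly h \<and> (\<forall>z\<in>sphere 0 1. chi n z * f z = h z)"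
proof (induction rule: trig_poly.induct)
  case (monomial c m)
  then show ?case by (intro exI[of _ "\<lambda>z. c * chi (n + m) z"])
      (auto simp: chi_mult[symmetric] intro: trig_poly.monomial)
next
  case (add f g)
  then obtain h k where "trig_poly h" "\<forall>z\<in>sphere 0 1. chi n z * f z = h z" "trig_poly k"
      "\<forall>z\<in>sphere 0 1. chi n z * g z = k z"
    by blast
  then show ?case by (intro exI[of _ "\<lambda>z. h z + k z"]) (auto simp: distrib_left intro: trig_poly.add)
qed

lemma trig_poly_mult: "trig_poly f \<Longrightarrow> trig_poly g \<Longrightarrow> \<exists>h. trig_poly h \<and> (\<forall>z\<in>sphere 0 1. f z * g z = h z)"
proof (induction rule: trig_poly.induct)
  case (monomial c n)
  then obtain h where h: "trig_poly h" "\<forall>z\<in>sphere 0 1. chi n z * g z = h z"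
    using trig_poly_chi_mult by blast
  then show ?case by (intro exI[of _ "\<lambda>z. c * h z"]) (auto intro: trig_poly_cmult)
next
  case (add f f')
  then obtain h k where "trig_poly h" "\<forall>z\<in>sphere 0 1. f z * g z = h z" "trig_poly k"
      "\<forall>z\<in>sphere 0 1. f' z * g z = k z"
    by blast
  then show ?case by (intro exI[of _ "\<lambda>z. h z + k z"]) (auto simp: distrib_right intro: trig_poly.add)
qed

text \<open>
  Turns the real polynomials of the Stone--Weierstrass theorem into trigonometric ones: on the
  circle, \<open>Re z\<close> and \<open>Im z\<close> are combinations of \<open>z\<close> and \<open>1 / z\<close>.
\<close>

lemma real_polynomial_function_trig:
  assumes "real_polynomial_function f"
  shows "\<exists>h. trig_poly h \<and> (\<forall>z\<in>sphere 0 1. complex_of_real (f z) = h z)"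
  using assms
proof (induction rule: real_polynomial_function.induct)
  case (linear f)
  interpret bounded_linear f by fact
  define c where "c = Complex (f 1 / 2) (- f \<i> / 2)"
  define h where "h = (\<lambda>z. c * chi 1 z + cnj c * chi (-1) z)"
  have "trig_poly h" unfolding h_def by (intro trig_poly.intros)
  moreover have "complex_of_real (f z) = h z" if "z \<in> sphere 0 1" for z
  proof -
    have "z = Re z *\<^sub>R 1 + Im z *\<^sub>R \<i>" by (simp add: complex_eq_iff)
    then have "f z = f (Re z *\<^sub>R 1 + Im z *\<^sub>R \<i>)" by (rule arg_cong)
    also have "\<dots> = Re z * f 1 + Im z * f \<i>" by (simp only: add scaleR real_scaleR_def)
    finally have fz: "f z = Re z * f 1 + Im z * f \<i>" .
    have "chi (-1) z = cnj z" using that by (simp add: chi_def power_int_minus cnj_eq_inverse)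
    then show ?thesis by (simp add: h_def fz complex_eq_iff c_def chi_def algebra_simps)
  qed
  ultimately show ?case by blast
next
  case (const c)
  then show ?case using trig_poly_const[of "of_real c"] by blast
next
  case (add f g)
  then obtain h k where "trig_poly h" "\<forall>z\<in>sphere 0 1. of_real (f z) = h z" "trig_poly k"
      "\<forall>z\<in>sphere 0 1. of_real (g z) = k z"
    by blast
  then show ?case by (intro exI[of _ "\<lambda>z. h z + k z"]) (auto intro: trig_poly.add)
next
  case (mult f g)
  then obtain h k where hk: "trig_poly h" "\<forall>z\<in>sphere 0 1. of_real (f z) = h z" "trig_poly k"
      "\<forall>z\<in>sphere 0 1. of_real (g z) = k z"
    by blast
  with trig_poly_mult[OF hk(1,3)] show ?case by auto
qed

lemma trig_poly_uniformly_dense: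
  assumes f: "continuous_on (sphere 0 1) f" and e: "e > 0"
  shows "\<exists>h. trig_poly h \<and> (\<forall>z\<in>sphere 0 1. norm (f z - h z) < e)"
proof -
  obtain g1 where g1: "real_polynomial_function g1" "\<And>z. z \<in> sphere 0 1 \<Longrightarrow> \<bar>Re (f z) - g1 z\<bar> < e/2"
    by (rule Stone_Weierstrass_real_polynomial_function[of "sphere 0 1" "\<lambda>z. Re (f z)" "e/2"])
       (use f e in \<open>auto intro!: continuous_intros\<close>)
  obtain g2 where g2: "real_polynomial_function g2" "\<And>z. z \<in> sphere 0 1 \<Longrightarrow> \<bar>Im (f z) - g2 z\<bar> < e/2"
    by (rule Stone_Weierstrass_real_polynomial_function[of "sphere 0 1" "\<lambda>z. Im (f z)" "e/2"])
       (use f e in \<open>auto intro!: continuous_intros\<close>)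
  obtain h1 h2 where h: "trig_poly h1" "\<forall>z\<in>sphere 0 1. of_real (g1 z) = h1 z"
      "trig_poly h2" "\<forall>z\<in>sphere 0 1. of_real (g2 z) = h2 z"
    using real_polynomial_function_trig g1(1) g2(1) by metis
  have "trig_poly (\<lambda>z. h1 z + \<i> * h2 z)" using h by (intro trig_poly.add trig_poly_cmult)
  moreover have "norm (f z - (h1 z + \<i> * h2 z)) < e" if z: "z \<in> sphere 0 1" for z
  proof -
    have "f z - (h1 z + \<i> * h2 z) = Complex (Re (f z) - g1 z) (Im (f z) - g2 z)"
      using h(2,4) z by (auto simp: complex_eq_iff simp flip: h(2,4)[rule_format])
    then have "norm (f z - (h1 z + \<i> * h2 z)) \<le> \<bar>Re (f z) - g1 z\<bar> + \<bar>Im (f z) - g2 z\<bar>"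
      using cmod_le[of "f z - (h1 z + \<i> * h2 z)"] by simp
    then show ?thesis using g1(2)[OF z] g2(2)[OF z] by simp
  qed
  ultimately show ?thesis by blast
qed

text \<open>
  Membership in the \<open>L^p\<close> closure of the trigonometric polynomials.
\<close>

definition Lp_approximable :: "real \<Rightarrow> (complex \<Rightarrow> complex) \<Rightarrow> bool" where
  "Lp_approximable p f \<longleftrightarrow> (\<forall>e>0. \<exists>g. trig_poly g \<and> Lp_norm p (\<lambda>z. f z - g z) < e)"

lemma Lp_trig_poly: "0 < p \<Longrightarrow> trig_poly f \<Longrightarrow> f \<in> Lp p"
  by (intro Lp_continuous trig_poly_continuous)

lemma Lp_approximable_closed:
  assumes p: "1 \<le> p" and f: "f \<in> Lp p" and s: "\<And>e. e > 0 \<Longrightarrow> \<exists>g\<in>Lp p. Lp_approximable p g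
      \<and> Lp_norm p (\<lambda>z. f z - g z) < e"
  shows "Lp_approximable p f"
  unfolding Lp_approximable_def
proof (intro allI impI)
  fix e :: real assume e: "e > 0"
  obtain g where g: "g \<in> Lp p" "Lp_approximable p g" "Lp_norm p (\<lambda>z. f z - g z) < e/2"
    using s[of "e/2"] e by auto
  obtain h where h: "trig_poly h" "Lp_norm p (\<lambda>z. g z - h z) < e/2"
    using g(2) e unfolding Lp_approximable_def by (meson half_gt_zero)
  have "Lp_norm p (\<lambda>z. f z - h z) < e"
    using Lp_norm_triangle_diff[OF p f g(1) Lp_trig_poly[OF _ h(1)]] p g(3) h(2) by simp
  then show "\<exists>g. trig_poly g \<and> Lp_norm p (\<lambda>z. f z - g z) < e" using h by blast
qed

lemma Lp_approximable_add:
  assumes p: "1 \<le> p" and f: "f \<in> Lp p" "g \<in> Lp p" and a: "Lp_approximable p f" "Lp_approximable p g"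
  shows "Lp_approximable p (\<lambda>z. f z + g z)"
  unfolding Lp_approximable_def
proof (intro allI impI)
  fix e :: real assume e: "e > 0"
  obtain h where h: "trig_poly h" "Lp_norm p (\<lambda>z. f z - h z) < e/2"
    using a(1) e unfolding Lp_approximable_def by (meson half_gt_zero)
  obtain k where k: "trig_poly k" "Lp_norm p (\<lambda>z. g z - k z) < e/2"
    using a(2) e unfolding Lp_approximable_def by (meson half_gt_zero)
  have hk: "h \<in> Lp p" "k \<in> Lp p" using p h k by (auto intro: Lp_trig_poly)
  have "Lp_norm p (\<lambda>z. f z + g z - (h z + k z)) < e"
    using Lp_norm_triangle[OF p Lp_diff[OF p f(1) hk(1)] Lp_diff[OF p f(2) hk(2)]] h(2) k(2) by
        (simp add: algebra_simps)
  then show "\<exists>h. trig_poly h \<and> Lp_norm p (\<lambda>z. f z + g z - h z) < e"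
    using trig_poly.add[OF h(1) k(1)] by blast
qed

lemma Lp_approximable_cmult:
  assumes p: "1 \<le> p" and a: "Lp_approximable p f"
  shows "Lp_approximable p (\<lambda>z. c * f z)"
  unfolding Lp_approximable_def
proof (intro allI impI)
  fix e :: real assume e: "e > 0"
  obtain h where h: "trig_poly h" "Lp_norm p (\<lambda>z. f z - h z) < e / (norm c + 1)"
    using a e unfolding Lp_approximable_def by (meson add_nonneg_pos divide_pos_pos norm_ge_zero zero_less_one)
  have "Lp_norm p (\<lambda>z. c * f z - c * h z) = norm c * Lp_norm p (\<lambda>z. f z - h z)"
    using p Lp_norm_cmult[of p c "\<lambda>z. f z - h z"] by (simp add: algebra_simps)
  also have "\<dots> \<le> (norm c + 1) * Lp_norm p (\<lambda>z. f z - h z)" by (intro mult_right_mono) auto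
  also have "\<dots> < e" using h(2) by (subst (asm) pos_less_divide_eq) (auto simp: add_nonneg_pos mult.commute)
  finally show "\<exists>h. trig_poly h \<and> Lp_norm p (\<lambda>z. c * f z - h z) < e"
    using trig_poly_cmult[OF h(1)] by blast
qed

lemma Lp_approximable_sum:
  assumes p: "1 \<le> p" and "finite I" "\<And>i. i \<in> I \<Longrightarrow> f i \<in> Lp p \<and> Lp_approximable p (f i)"
  shows "Lp_approximable p (\<lambda>z. \<Sum>i\<in>I. f i z)"
  using assms(2,3)
proof (induction I)
  case empty
  have "Lp_norm p (\<lambda>z. 0) = 0" by (rule Lp_norm_eq_0_of_AE) simp
  then show ?case by (auto simp: Lp_approximable_def intro!: exI[of _ "\<lambda>z. 0"] trig_poly_const)
next
  case (insert i I)
  then show ?case using Lp_sum[OF p insert(1), of f] by (simp add: Lp_approximable_add[OF p])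
qed

lemma Lp_approximable_continuous:
  assumes p: "1 \<le> p" and f: "continuous_on (sphere 0 1) f"
  shows "Lp_approximable p f"
  unfolding Lp_approximable_def
proof (intro allI impI)
  fix e :: real assume e: "e > 0"
  obtain h where h: "trig_poly h" "\<forall>z\<in>sphere 0 1. norm (f z - h z) < e/2"
    using trig_poly_uniformly_dense[OF f, of "e/2"] e by auto
  have "Lp_norm p (\<lambda>z. f z - h z) \<le> e/2"
    using p h f trig_poly_continuous[OF h(1)]
    by (intro Lp_norm_le_on_circle(2) borel_measurable_circle_continuous continuous_intros)
        (auto intro: less_imp_le)
  then show "\<exists>g. trig_poly g \<and> Lp_norm p (\<lambda>z. f z - g z) < e" using h(1) e by (intro exI[of _ h]) auto
qed

lemma Lp_norm_dominated_convergence: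
  fixes s :: "nat \<Rightarrow> complex \<Rightarrow> complex"
  assumes p: "0 < p" and m: "\<And>i. s i \<in> borel_measurable circle" "f \<in> borel_measurable circle"
    and w: "integrable circle (\<lambda>z. w z powr p)"
    and le: "\<And>i z. norm z = 1 \<Longrightarrow> norm (f z - s i z) \<le> w z"
    and lim: "\<And>z. norm z = 1 \<Longrightarrow> (\<lambda>i. s i z) \<longlonglongrightarrow> f z"
  shows "(\<lambda>i. Lp_norm p (\<lambda>z. f z - s i z)) \<longlonglongrightarrow> 0"
proof -
  note [measurable] = m
  have "(\<lambda>i. LINT z|circle. norm (f z - s i z) powr p) \<longlonglongrightarrow> (LINT z|circle. 0)"
  proof (rule integral_dominated_convergence[OF _ _ w])
    show "AE z in circle. (\<lambda>i. norm (f z - s i z) powr p) \<longlonglongrightarrow> 0"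
    proof (intro AE_I2)
      fix z assume "z \<in> space circle"
      then have "(\<lambda>i. norm (f z - s i z)) \<longlonglongrightarrow> norm (f z - f z)"
        using lim[of z] by (intro tendsto_intros) auto
      then have "(\<lambda>i. norm (f z - s i z) powr p) \<longlonglongrightarrow> norm (f z - f z) powr p"
        using p by (intro tendsto_powr') auto
      then show "(\<lambda>i. norm (f z - s i z) powr p) \<longlonglongrightarrow> 0" by simp
    qed
    show "AE z in circle. norm (norm (f z - s i z) powr p) \<le> w z powr p" for i
      using le p by (intro AE_I2) (auto intro!: powr_mono2)
  qed auto
  then have "(\<lambda>i. (LINT z|circle. norm (f z - s i z) powr p) powr (1/p)) \<longlonglongrightarrow> 0 powr (1/p)"
    using p by (intro tendsto_powr') (auto intro!: eventuallyI integral_nonneg_AE)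
  then show ?thesis by (simp add: Lp_norm_def)
qed

lemma Lp_approximable_limit:
  fixes s :: "nat \<Rightarrow> complex \<Rightarrow> complex"
  assumes p: "1 \<le> p" and m: "\<And>i. s i \<in> Lp p" "f \<in> Lp p"
    and w: "integrable circle (\<lambda>z. w z powr p)"
    and le: "\<And>i z. norm z = 1 \<Longrightarrow> norm (f z - s i z) \<le> w z"
    and lim: "\<And>z. norm z = 1 \<Longrightarrow> (\<lambda>i. s i z) \<longlonglongrightarrow> f z"
    and a: "\<And>i. Lp_approximable p (s i)"
  shows "Lp_approximable p f"
proof (rule Lp_approximable_closed[OF p m(2)])
  fix e :: real assume "e > 0"
  moreover have "(\<lambda>i. Lp_norm p (\<lambda>z. f z - s i z)) \<longlonglongrightarrow> 0"
    using p LpD(1)[OF m(1)] LpD(1)[OF m(2)] w le lim by (intro Lp_norm_dominated_convergence[of p s f w]) auto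
  ultimately have "\<forall>\<^sub>F i in sequentially. Lp_norm p (\<lambda>z. f z - s i z) < e" by (auto dest: order_tendstoD)
  then obtain i where "Lp_norm p (\<lambda>z. f z - s i z) < e" by (meson eventually_sequentially order_refl)
  then show "\<exists>g\<in>Lp p. Lp_approximable p g \<and> Lp_norm p (\<lambda>z. f z - g z) < e" using a m by blast
qed

lemma indicator_measurable_circle: "A \<in> sets borel \<Longrightarrow> (\<lambda>z. indicator A z :: complex) \<in> borel_measurable circle"
  unfolding measurable_cong_sets[OF sets_circle refl]
  by (intro measurable_restrict_space1) auto

lemma indicator_Lp: "0 < p \<Longrightarrow> A \<in> sets borel \<Longrightarrow> (\<lambda>z. indicator A z :: complex) \<in> Lp p"
  using indicator_measurable_circle by (intro Lp_norm_le_on_circle(1)[of _ _ 1]) (auto split: split_indicator)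

text \<open>
  A Dynkin argument starting from closed sets, whose indicators are bounded pointwise limits of
  continuous functions of the distance to the set.
\<close>

lemma Lp_approximable_indicator:
  assumes p: "1 \<le> p" and A: "A \<in> sets (borel :: complex measure)"
  shows "Lp_approximable p (\<lambda>z. indicator A z)"
proof -
  have "Int_stable (Collect closed :: complex set set)" "Collect closed \<subseteq> Pow (UNIV :: complex set)"
    "A \<in> sigma_sets UNIV (Collect closed)" using A by (auto simp: borel_eq_closed Int_stable_def)
  then show ?thesis
  proof (induction rule: sigma_sets_induct_disjoint)
    case (basic C)
    then have C: "closed C" by simp
    show ?case
    proof (cases "C = {}")
      case True
      then show ?thesis using Lp_approximable_continuous[OF p, of "\<lambda>z. 0"] by simp
    next
      case False
      define s where "s i z = complex_of_real (max 0 (1 - real i * infdist z C))" for i z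
      show ?thesis
      proof (rule Lp_approximable_limit[OF p, of s _ "\<lambda>z. 1"])
        have c: "continuous_on (sphere 0 1) (s i)" for i
          unfolding s_def by (intro continuous_intros)
        show "s i \<in> Lp p" "Lp_approximable p (s i)" for i
          using p c by (auto intro: Lp_continuous Lp_approximable_continuous)
        show "indicator C \<in> Lp p" using p C by (intro indicator_Lp) auto
        show "norm (indicator C z - s i z) \<le> 1" for i z
        proof (cases "z \<in> C")
          case False
          have "norm (s i z) = max 0 (1 - real i * infdist z C)"
            unfolding s_def by (subst norm_of_real) simp
          then show ?thesis using False infdist_nonneg[of z C] by simp
        qed (simp add: s_def)
        show "(\<lambda>i. s i z) \<longlonglongrightarrow> indicator C z" for z
        proof (cases "z \<in> C")
          case True
          then show ?thesis by (simp add: s_def)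
        next
          case z: False
          then have d: "infdist z C > 0"
            using C False in_closed_iff_infdist_zero[of C z] infdist_nonneg[of z C] by (auto simp: less_le)
          obtain n where "real n * infdist z C > 1" using reals_Archimedean3[OF d] by blast
          then have "real i * infdist z C \<ge> 1" if "i \<ge> n" for i
            using that mult_right_mono[of "real n" "real i" "infdist z C"] d by linarith
          then have "\<forall>\<^sub>F i in sequentially. s i z = 0"
            unfolding eventually_sequentially s_def by (intro exI[of _ n]) (auto simp: max_absorb1)
          then show ?thesis using z by (simp add: tendsto_eventually)
        qed
      qed auto
    qed
  next
    case empty
    then show ?case using Lp_approximable_continuous[OF p, of "\<lambda>z. 0"] by simp
  next
    case (compl B)
    then have B: "B \<in> sets borel" by (simp add: borel_eq_closed)
    have "indicator (UNIV - B) z = (1::complex) + (- 1) * indicator B z" for z :: complex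
      by (auto simp: indicator_def)
    then show ?case
      using Lp_approximable_add[OF p _ Lp_cmult[OF indicator_Lp[OF _ B]] Lp_approximable_continuous[OF p]
          Lp_approximable_cmult[OF p compl(2)], of "\<lambda>z. 1" "-1"] p
      by (simp add: Lp_continuous)
  next
    case (union B)
    then have B: "B i \<in> sets borel" for i by (auto simp: borel_eq_closed)
    define s where "s n z = (\<Sum>i<n. indicator (B i) z :: complex)" for n :: nat and z
    have s: "s n z = indicator (\<Union>i<n. B i) z" for n z
      unfolding s_def using union(1) by (subst indicator_UN_disjoint) (auto intro: disjoint_family_on_mono)
    show ?case
    proof (rule Lp_approximable_limit[OF p, of s _ "\<lambda>z. 1"])
      have "(\<lambda>z. indicator (B i) z) \<in> Lp p" for i using p B by (intro indicator_Lp) auto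
      then show "s i \<in> Lp p" "Lp_approximable p (s i)" for i
        using Lp_sum[OF p, of "{..<i}" "\<lambda>i z. indicator (B i) z"]
          Lp_approximable_sum[OF p, of "{..<i}" "\<lambda>i z. indicator (B i) z"] union(3)
        unfolding s_def by simp_all
      show "indicator (\<Union> (range B)) \<in> Lp p" using p B by (intro indicator_Lp) auto
      show "norm (indicator (\<Union> (range B)) z - s i z) \<le> 1" for i z
        by (auto simp: s indicator_def)
      show "(\<lambda>i. s i z) \<longlonglongrightarrow> indicator (\<Union> (range B)) z" for z
        unfolding s by (rule LIMSEQ_indicator_UN)
    qed auto
  qed
qed

text \<open>
  Simple functions dominated by twice \<open>\<bar>f\<bar>\<close> reduce the claim to indicators.
\<close>

lemma Lp_approximable_Lp:
  assumes p: "1 \<le> p" and f: "f \<in> Lp p"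
  shows "Lp_approximable p f"
proof -
  note fm = LpD(1)[OF f]
  obtain s where s: "\<And>i. simple_function circle (s i)"
      "\<And>z. z \<in> space circle \<Longrightarrow> (\<lambda>i. s i z) \<longlonglongrightarrow> f z"
      "\<And>i z. z \<in> space circle \<Longrightarrow> dist (s i z) 0 \<le> 2 * dist (f z) 0"
    using borel_measurable_implies_sequence_metric[OF fm, of 0] by blast
  show ?thesis
  proof (rule Lp_approximable_limit[OF p _ f, of s "\<lambda>z. 3 * norm (f z)"])
    have sm: "s i \<in> borel_measurable circle" for i using s(1) by (rule borel_measurable_simple_function)
    show "integrable circle (\<lambda>z. (3 * norm (f z)) powr p)"
      using LpD(2)[OF f] by (simp add: powr_mult)
    show "norm (f z - s i z) \<le> 3 * norm (f z)" if "norm z = 1" for i z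
      using s(3)[of z i] that norm_triangle_ineq4[of "f z" "s i z"] by simp
    show "(\<lambda>i. s i z) \<longlonglongrightarrow> f z" if "norm z = 1" for z
      using s(2) that by simp
    fix i
    let ?r = "\<lambda>z. \<Sum>y\<in>s i ` space circle. y * indicator (s i -` {y} \<inter> space circle) z"
    have fin: "finite (s i ` space circle)" using s(1) by (simp add: simple_function_def)
    have r: "s i z = ?r z" if "norm z = 1" for z
    proof -
      have "?r z = (\<Sum>y\<in>s i ` space circle. if y = s i z then y else 0)"
        using that by (intro sum.cong) (auto simp: indicator_def)
      then show ?thesis using that fin by simp
    qed
    have mem: "(\<lambda>z. y * indicator (s i -` {y} \<inter> space circle) z) \<in> Lp p
        \<and> Lp_approximable p (\<lambda>z. y * indicator (s i -` {y} \<inter> space circle) z)" for y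
    proof -
      have "s i -` {y} \<inter> space circle \<in> sets circle" using measurable_sets[OF sm, of "{y}"] by simp
      then obtain B where B: "B \<in> sets borel" "s i -` {y} \<inter> space circle = B \<inter> sphere 0 1"
        by (auto simp: sets_circle sets_restrict_space)
      have B': "B \<inter> sphere 0 1 \<in> sets borel" using B(1) by (intro sets.Int) auto
      show ?thesis unfolding B(2) using p B' by (intro conjI Lp_cmult indicator_Lp Lp_approximable_cmult
          Lp_approximable_indicator) auto
    qed
    have r': "?r \<in> Lp p" "Lp_approximable p ?r"
      using Lp_sum[OF p fin, of "\<lambda>y z. y * indicator (s i -` {y} \<inter> space circle) z"]
        Lp_approximable_sum[OF p fin, of "\<lambda>y z. y * indicator (s i -` {y} \<inter> space circle) z"] mem by blast+
    have "Lp_norm p (\<lambda>z. s i z - g z) = Lp_norm p (\<lambda>z. ?r z - g z)" for g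
      by (intro Lp_norm_cong) (simp only: r)
    with r'(2) show "Lp_approximable p (s i)" unfolding Lp_approximable_def by presburger
    show "s i \<in> Lp p" using r by (intro Lp_cong[OF r'(1)]) presburger
  qed
qed

section \<open>Fejer means\<close>

lemma roots_of_unity_sum:
  fixes n :: int and M :: nat
  assumes "\<bar>n\<bar> < int M"
  shows "(\<Sum>k<M. cis (2 * pi * real k / real M) powi n) = (if n = 0 then of_nat M else 0)"
proof (cases "n = 0")
  case False
  define z where "z = cis (2 * pi * of_int n / real M)"
  have M: "M > 0" using assms by linarith
  have pow: "cis (2 * pi * real k / real M) powi n = z ^ k" for k
    by (simp add: z_def cis_power_int Complex.DeMoivre mult_ac)
  have "z ^ M = cis (2 * pi * of_int n)" using M by (simp add: z_def Complex.DeMoivre)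
  also have "\<dots> = 1" by (simp add: cis_multiple_2pi)
  finally have zM: "z ^ M = 1" .
  have "z \<noteq> 1"
  proof
    assume "z = 1"
    then have "cos (2 * pi * of_int n / real M) = 1" by (simp add: z_def complex_eq_iff)
    then obtain x :: int where "2 * pi * of_int n / real M = of_int x * 2 * pi"
      by (auto simp: cos_one_2pi_int)
    then have "real_of_int n = real_of_int (x * int M)" using M by (simp add: field_simps)
    then have "n = x * int M" by linarith
    with assms False show False by (auto simp: abs_mult)
  qed
  then have "(\<Sum>k<M. z ^ k) = 0" using zM by (simp add: geometric_sum)
  then show ?thesis using False by (simp add: pow)
qed simp

text \<open>
  The Fourier coefficients of the Fejer kernel of order \<open>N\<close>.
\<close>

definition fejer_weight :: "nat \<Rightarrow> int \<Rightarrow> real" where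
  "fejer_weight N n = max 0 (1 - \<bar>real_of_int n\<bar> / real N)"

lemma fejer_weight_bounds: "0 \<le> fejer_weight N n" "fejer_weight N n \<le> 1"
  by (auto simp: fejer_weight_def)

lemma fejer_weight_0 [simp]: "fejer_weight N 0 = 1"
  by (simp add: fejer_weight_def)

lemma fejer_weight_eq_0: "0 < N \<Longrightarrow> \<bar>n\<bar> \<ge> int N \<Longrightarrow> fejer_weight N n = 0"
  by (auto simp: fejer_weight_def field_simps max_def)

lemma fejer_weight_tendsto: "(\<lambda>N. fejer_weight N n) \<longlonglongrightarrow> 1"
proof -
  have "(\<lambda>N. max 0 (1 - \<bar>real_of_int n\<bar> / real N)) \<longlonglongrightarrow> max 0 (1 - 0)"
    by (intro tendsto_intros lim_const_over_n)
  then show ?thesis by (simp add: fejer_weight_def)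
qed

lemma card_fejer_pairs:
  "card {(a, b). a < N \<and> b < N \<and> int a - int b + n = 0} = nat (int N - \<bar>n\<bar>)"
proof (cases "n \<ge> 0")
  case True
  have "{(a, b). a < N \<and> b < N \<and> int a - int b + n = 0} = (\<lambda>a. (a, a + nat n)) ` {..<nat (int N - n)}"
    using True by (auto simp: image_iff)
  also have "card \<dots> = nat (int N - \<bar>n\<bar>)" using True by (subst card_image) (auto simp: inj_on_def)
  finally show ?thesis .
next
  case False
  have "{(a, b). a < N \<and> b < N \<and> int a - int b + n = 0} = (\<lambda>a. (a + nat (-n), a)) ` {..<nat (int N + n)}"
    using False by (auto simp: image_iff)
  also have "card \<dots> = nat (int N - \<bar>n\<bar>)" using False by (subst card_image) (auto simp: inj_on_def)
  finally show ?thesis .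
qed

text \<open>
  The Fejer kernel sampled at the \<open>M\<close>-th roots of unity. Below frequency \<open>M - N\<close> no aliasing
  occurs, so the finite probability measure with masses \<open>c k\<close> at \<open>w k\<close> has exactly the Fejer
  coefficients. Since the kernel is the squared modulus of a geometric sum divided by \<open>N\<close>, its mass away from
  1 is of order \<open>1 / N\<close>.
\<close>

lemma fejer_nodes:
  fixes N M :: nat
  assumes N: "0 < N" and M: "N \<le> M"
  obtains c :: "nat \<Rightarrow> real" and w :: "nat \<Rightarrow> complex"
  where "\<And>k. 0 \<le> c k" "\<And>k. norm (w k) = 1" "(\<Sum>k<M. c k) = 1"
    "\<And>k. c k * (norm (w k - 1))\<^sup>2 \<le> 4 / (real N * real M)"
    "\<And>n::int. \<bar>n\<bar> + int N \<le> int M \<Longrightarrow> (\<Sum>k<M. of_real (c k) * w k powi n) = of_real (fejer_weight N n)"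
proof -
  define w where "w k = cis (2 * pi * real k / real M)" for k
  define D where "D k = (\<Sum>a<N. w k ^ a)" for k
  define c where "c k = (norm (D k))\<^sup>2 / (real N * real M)" for k
  have M0: "M > 0" using assms by simp
  have nw: "norm (w k) = 1" for k by (simp add: w_def)
  have wn: "w k \<noteq> 0" for k by (simp add: w_def)
  have main: "(\<Sum>k<M. of_real (c k) * w k powi n) = of_real (fejer_weight N n)" if n: "\<bar>n\<bar> + int N \<le> int M" for n
  proof -
    have DD: "of_real (c k) * w k powi n = (\<Sum>(a,b)\<in>{..<N}\<times>{..<N}. w k powi (int a - int b
        + n)) / (of_nat N * of_nat M)" for k
    proof -
      have "of_real ((norm (D k))\<^sup>2) = D k * cnj (D k)" by (rule complex_norm_square)
      also have "\<dots> = (\<Sum>a<N. \<Sum>b<N. w k ^ a * cnj (w k) ^ b)" by (simp add: D_def sum_product)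
      also have "\<dots> = (\<Sum>(a,b)\<in>{..<N}\<times>{..<N}. w k powi (int a - int b))"
        using wn[of k] nw[of k] by (simp add: sum.cartesian_product power_int_diff cnj_eq_inverse field_simps)
      finally have "of_real ((norm (D k))\<^sup>2) * w k powi n = (\<Sum>(a,b)\<in>{..<N}\<times>{..<N}. w k powi (int a - int b
          + n))"
        using wn[of k] by (simp add: sum_distrib_right case_prod_beta power_int_add)
      then show ?thesis by (simp add: c_def)
    qed
    have "(\<Sum>k<M. of_real (c k) * w k powi n) = (\<Sum>k<M. (\<Sum>(a,b)\<in>{..<N}\<times>{..<N}. w k powi (int a - int b
        + n))) / (of_nat N * of_nat M)"
      by (simp add: DD sum_divide_distrib)
    also have "(\<Sum>k<M. (\<Sum>(a,b)\<in>{..<N}\<times>{..<N}. w k powi (int a - int b + n))) = (\<Sum>x\<in>{..<N}\<times>{..<N}.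
        \<Sum>k<M. w k powi (int (fst x) - int (snd x) + n))"
      by (subst sum.swap) (simp add: case_prod_beta)
    also have "\<dots> = (\<Sum>x\<in>{..<N}\<times>{..<N}. if int (fst x) - int (snd x) + n = 0 then of_nat M else 0)"
      unfolding w_def using n by (intro sum.cong roots_of_unity_sum) auto
    also have "\<dots> = of_nat M * of_nat (card {x\<in>{..<N}\<times>{..<N}. int (fst x) - int (snd x) + n = 0})"
      by (simp add: sum.If_cases Int_def mult.commute)
    also have "{x\<in>{..<N}\<times>{..<N}. int (fst x) - int (snd x) + n = 0} = {(a, b). a < N \<and> b < N \<and> int a - int b
        + n = 0}"
      by auto
    finally have "(\<Sum>k<M. of_real (c k) * w k powi n) = of_nat M * of_nat (nat (int N - \<bar>n\<bar>)) / (of_nat N *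
        of_nat M)"
      by (simp add: card_fejer_pairs)
    also have "\<dots> = complex_of_real (real (nat (int N - \<bar>n\<bar>)) / real N)" using M0 by simp
    also have "real (nat (int N - \<bar>n\<bar>)) / real N = fejer_weight N n"
      using N by (cases "\<bar>n\<bar> \<le> int N") (auto simp: fejer_weight_def field_simps max_def)
    finally show ?thesis .
  qed
  show thesis
  proof
    show "0 \<le> c k" "norm (w k) = 1" for k by (auto simp: c_def nw)
    have "complex_of_real (\<Sum>k<M. c k) = 1" using main[of 0] M by simp
    then show "(\<Sum>k<M. c k) = 1" using of_real_eq_1_iff by blast
    show "c k * (norm (w k - 1))\<^sup>2 \<le> 4 / (real N * real M)" for k
    proof -
      have "D k * (w k - 1) = w k ^ N - 1"
        unfolding D_def by (subst mult.commute, rule power_diff_1_eq[symmetric])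
      then have "norm (D k) * norm (w k - 1) = norm (w k ^ N - 1)" by (simp flip: norm_mult)
      also have "\<dots> \<le> 2" using norm_triangle_ineq4[of "w k ^ N" 1] nw[of k] by (simp add: norm_power)
      finally have "(norm (D k) * norm (w k - 1))\<^sup>2 \<le> 2\<^sup>2" by (intro power_mono) auto
      then show ?thesis using M0 N by (simp add: c_def power_mult_distrib divide_right_mono)
    qed
    show "\<And>n::int. \<bar>n\<bar> + int N \<le> int M \<Longrightarrow> (\<Sum>k<M. of_real (c k) * w k powi n) = of_real (fejer_weight N n)"
      by (rule main)
  qed
qed

lemma fourier_coeff_sum:
  assumes "\<And>i. i \<in> I \<Longrightarrow> integrable circle (f i)"
  shows "fourier_coeff (\<lambda>z. \<Sum>i\<in>I. f i z) n = (\<Sum>i\<in>I. fourier_coeff (f i) n)"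
  unfolding fourier_coeff_def pairing_def sum_distrib_right
  by (intro Bochner_Integration.integral_sum integrable_fourier assms)

definition fejer_mean :: "nat \<Rightarrow> (complex \<Rightarrow> complex) \<Rightarrow> complex \<Rightarrow> complex" where
  "fejer_mean N f z = (\<Sum>n\<in>{- int N..int N}. of_real (fejer_weight N n) * fourier_coeff f n * chi n z)"

lemma fejer_mean_continuous: "continuous_on (sphere 0 1) (fejer_mean N f)"
  unfolding fejer_mean_def by (intro continuous_intros)

lemma fejer_mean_Lp: "0 < p \<Longrightarrow> fejer_mean N f \<in> Lp p"
  by (intro Lp_continuous fejer_mean_continuous)

lemma fejer_mean_add:
  assumes "integrable circle f" "integrable circle g"
  shows "fejer_mean N (\<lambda>z. f z + g z) z = fejer_mean N f z + fejer_mean N g z"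
  using fourier_coeff_linear[OF assms, of 1 1] by (simp add: fejer_mean_def algebra_simps sum.distrib)

lemma fejer_mean_diff:
  assumes "integrable circle f" "integrable circle g"
  shows "fejer_mean N (\<lambda>z. f z - g z) = (\<lambda>z. fejer_mean N f z - fejer_mean N g z)"
  by (rule ext) (simp add: fejer_mean_def fourier_coeff_diff[OF assms] left_diff_distrib right_diff_distrib
      sum_subtractf)

lemma chi_cnj_mult: "norm z = 1 \<Longrightarrow> chi m z * cnj (chi n z) = chi (m - n) z"
proof -
  assume z: "norm z = 1"
  have "cnj (chi n z) = inverse (chi n z)" using z by (intro cnj_eq_inverse) simp
  also have "\<dots> = chi (- n) z" by (simp add: chi_def power_int_minus)
  finally show ?thesis using chi_mult[OF z, of m "-n"] by simp
qed

lemma fourier_coeff_monomial: "fourier_coeff (\<lambda>z. c * chi n z) m = (if m = n then c else 0)"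
proof -
  have "fourier_coeff (\<lambda>z. c * chi n z) m = (LINT z|circle. c * chi (n - m) z)"
    unfolding fourier_coeff_def pairing_def
    by (intro Bochner_Integration.integral_cong) (auto simp: mult.assoc chi_cnj_mult)
  then show ?thesis by (simp add: integral_chi)
qed

lemma fejer_mean_monomial:
  assumes "0 < N"
  shows "fejer_mean N (\<lambda>z. c * chi n z) z = of_real (fejer_weight N n) * (c * chi n z)"
proof (cases "\<bar>n\<bar> \<le> int N")
  case True
  have "fejer_mean N (\<lambda>z. c * chi n z) z = (\<Sum>m\<in>{- int N..int N}. if m
      = n then of_real (fejer_weight N n) * c * chi n z else 0)"
    unfolding fejer_mean_def by (intro sum.cong) (auto simp: fourier_coeff_monomial)
  moreover have "- int N \<le> n" "n \<le> int N" using True by auto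
  ultimately show ?thesis by (simp add: mult.assoc)
next
  case False
  have "fejer_mean N (\<lambda>z. c * chi n z) z = 0"
    unfolding fejer_mean_def using False by (intro sum.neutral) (auto simp: fourier_coeff_monomial)
  then show ?thesis using fejer_weight_eq_0[of N n] False assms by simp
qed

lemma integrable_trig_poly: "trig_poly f \<Longrightarrow> integrable circle f"
  by (intro integrable_circle_continuous trig_poly_continuous)

lemma fejer_mean_trig_poly_tendsto:
  assumes "trig_poly f"
  shows "\<forall>e>0. \<forall>\<^sub>F N in sequentially. \<forall>z\<in>sphere 0 1. norm (f z - fejer_mean N f z) < e"
  using assms
proof (induction rule: trig_poly.induct)
  case (monomial c n)
  show ?case
  proof (intro allI impI)
    fix e :: real assume e: "e > 0"
    have "(\<lambda>N. (1 - fejer_weight N n) * norm c) \<longlonglongrightarrow> (1 - 1) * norm c"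
      by (intro tendsto_intros fejer_weight_tendsto)
    then have "\<forall>\<^sub>F N in sequentially. (1 - fejer_weight N n) * norm c < e"
      using e by (auto dest: order_tendstoD)
    then show "\<forall>\<^sub>F N in sequentially. \<forall>z\<in>sphere 0 1. norm (c * chi n z - fejer_mean N (\<lambda>z. c * chi n z) z) < e"
      using eventually_gt_at_top[of 0]
    proof eventually_elim
      case (elim N)
      have "norm (c * chi n z - fejer_mean N (\<lambda>z. c * chi n z) z) = (1 - fejer_weight N n) * norm c" if
          "z \<in> sphere 0 1" for z
      proof -
        have "c * chi n z - fejer_mean N (\<lambda>z. c * chi n z) z = of_real (1 - fejer_weight N n) * (c * chi n z)"
          using elim(2) by (subst fejer_mean_monomial) (auto simp: algebra_simps)
        then show ?thesis using that fejer_weight_bounds[of N n] by (simp only: norm_mult norm_of_real) simp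
      qed
      then show ?case using elim by simp
    qed
  qed
next
  case (add f g)
  show ?case
  proof (intro allI impI)
    fix e :: real assume e: "e > 0"
    have "\<forall>\<^sub>F N in sequentially. \<forall>z\<in>sphere 0 1. norm (f z - fejer_mean N f z) < e/2"
      "\<forall>\<^sub>F N in sequentially. \<forall>z\<in>sphere 0 1. norm (g z - fejer_mean N g z) < e/2"
      using add.IH half_gt_zero[OF e] by blast+
    then show "\<forall>\<^sub>F N in sequentially. \<forall>z\<in>sphere 0 1. norm (f z + g z - fejer_mean N (\<lambda>z. f z + g z) z) < e"
    proof eventually_elim
      case (elim N)
      show ?case
      proof
        fix z :: complex assume z: "z \<in> sphere 0 1"
        have "f z + g z - fejer_mean N (\<lambda>z. f z + g z) z = (f z - fejer_mean N f z) + (g z - fejer_mean N g z)"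
          using add by (simp add: fejer_mean_add integrable_trig_poly)
        then have "norm (f z + g z - fejer_mean N (\<lambda>z. f z + g z) z) \<le> norm (f z - fejer_mean N f z)
            + norm (g z - fejer_mean N g z)"
          by (simp only: norm_triangle_ineq)
        then show "norm (f z + g z - fejer_mean N (\<lambda>z. f z + g z) z) < e" using elim z by fastforce
      qed
    qed
  qed
qed

definition fejer_quadrature :: "nat \<Rightarrow> nat \<Rightarrow> nat \<Rightarrow> (nat \<Rightarrow> real) \<Rightarrow> (nat \<Rightarrow> complex) \<Rightarrow> bool" where
  "fejer_quadrature N m M c w \<longleftrightarrow>
     (\<forall>n::int. \<bar>n\<bar> \<le> int m \<longrightarrow> (\<Sum>k<M. of_real (c k) * w k powi n) = of_real (fejer_weight N n))"

lemma fejer_quadrature_mono: "fejer_quadrature N m M c w \<Longrightarrow> m' \<le> m \<Longrightarrow> fejer_quadrature N m' M c w"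
  by (simp add: fejer_quadrature_def)

text \<open>
  Makes the Fejer mean of a trigonometric polynomial a finite convex combination of its rotations,
  to which the triangle inequality in \<open>L^p\<close> applies.
\<close>

lemma trig_poly_fejer_average:
  assumes "trig_poly f"
  shows "\<exists>m. \<forall>N M c w z. 0 < N \<longrightarrow> fejer_quadrature N m M c w \<longrightarrow>
     fejer_mean N f z = (\<Sum>k<M. of_real (c k) * f (w k * z))"
  using assms
proof (induction rule: trig_poly.induct)
  case (monomial d n)
  show ?case
  proof (intro exI[of _ "nat \<bar>n\<bar>"] allI impI)
    fix N M c w z assume N: "0 < N" and q: "fejer_quadrature N (nat \<bar>n\<bar>) M c w"
    have "(\<Sum>k<M. of_real (c k) * (d * chi n (w k * z))) = d * chi n z * (\<Sum>k<M. of_real (c k) * w k powi n)"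
      by (simp add: chi_def power_int_mult_distrib sum_distrib_left mult_ac)
    also have "\<dots> = d * chi n z * of_real (fejer_weight N n)" using q by (simp add: fejer_quadrature_def)
    finally show "fejer_mean N (\<lambda>z. d * chi n z) z = (\<Sum>k<M. of_real (c k) * (d * chi n (w k * z)))"
      using N by (simp add: fejer_mean_monomial)
  qed
next
  case (add f g)
  from add.IH(1) obtain m1 where m1: "\<forall>N M c w z. 0 < N \<longrightarrow> fejer_quadrature N m1 M c w \<longrightarrow>
     fejer_mean N f z = (\<Sum>k<M. of_real (c k) * f (w k * z))" ..
  from add.IH(2) obtain m2 where m2: "\<forall>N M c w z. 0 < N \<longrightarrow> fejer_quadrature N m2 M c w \<longrightarrow>
     fejer_mean N g z = (\<Sum>k<M. of_real (c k) * g (w k * z))" ..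
  show ?case
  proof (intro exI[of _ "max m1 m2"] allI impI)
    fix N M c w z assume N: "0 < N" and q: "fejer_quadrature N (max m1 m2) M c w"
    have "fejer_quadrature N m1 M c w" "fejer_quadrature N m2 M c w"
      using fejer_quadrature_mono[OF q] by auto
    then have "fejer_mean N f z = (\<Sum>k<M. of_real (c k) * f (w k * z))"
       "fejer_mean N g z = (\<Sum>k<M. of_real (c k) * g (w k * z))" using m1 m2 N by auto
    then show "fejer_mean N (\<lambda>z. f z + g z) z = (\<Sum>k<M. of_real (c k) * (f (w k * z) + g (w k * z)))"
      using add.hyps by (simp add: fejer_mean_add integrable_trig_poly distrib_left sum.distrib)
  qed
qed

lemma Lp_rotation:
  assumes "f \<in> Lp p" "norm w = 1"
  shows "(\<lambda>z. f (w * z)) \<in> Lp p" "Lp_norm p (\<lambda>z. f (w * z)) = Lp_norm p f"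
proof -
  have m: "(\<lambda>z. f (w * z)) \<in> borel_measurable circle"
    using measurable_compose[OF rotation_measurable[OF assms(2)] LpD(1)[OF assms(1)]] .
  have i: "integrable (distr circle circle (\<lambda>z. w * z)) (\<lambda>z. norm (f z) powr p)"
    using LpD[OF assms(1)] by (simp add: distr_circle_rotation assms)
  then have "integrable circle (\<lambda>z. norm (f (w * z)) powr p)"
    using LpD(1)[OF assms(1)] by (subst (asm) integrable_distr_eq[OF rotation_measurable[OF assms(2)]]) auto
  with m show "(\<lambda>z. f (w * z)) \<in> Lp p" by (simp add: Lp_def)
  show "Lp_norm p (\<lambda>z. f (w * z)) = Lp_norm p f"
    using LpD(1)[OF assms(1)] assms(2) integral_circle_rotation[of "\<lambda>z. norm (f z) powr p" w]
    by (simp add: Lp_norm_def)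
qed

lemma fejer_mean_trig_poly_contraction:
  assumes p: "1 \<le> p" and f: "trig_poly f" and N: "0 < N"
  shows "Lp_norm p (fejer_mean N f) \<le> Lp_norm p f"
proof -
  obtain m where m: "\<forall>N M c w z. 0 < N \<longrightarrow> fejer_quadrature N m M c w \<longrightarrow>
     fejer_mean N f z = (\<Sum>k<M. of_real (c k) * f (w k * z))" using trig_poly_fejer_average[OF f] ..
  obtain c w where cw: "\<And>k. 0 \<le> c k" "\<And>k. norm (w k) = 1" "(\<Sum>k<N+m. c k) = 1"
    "fejer_quadrature N m (N+m) c w"
    by (rule fejer_nodes[OF N, of "N+m"]) (auto simp: fejer_quadrature_def)
  have fL: "f \<in> Lp p" using p f by (intro Lp_trig_poly) auto
  have eq: "fejer_mean N f = (\<lambda>z. \<Sum>k<N+m. of_real (c k) * f (w k * z))"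
    using m N cw(4) by blast
  have mem: "(\<lambda>z. of_real (c k) * f (w k * z)) \<in> Lp p" for k
    by (intro Lp_cmult Lp_rotation fL cw)
  have nrm: "Lp_norm p (\<lambda>z. of_real (c k) * f (w k * z)) = c k * Lp_norm p f" for k
    using p cw(1) by (simp add: Lp_norm_cmult Lp_rotation(2)[OF fL cw(2)])
  have "Lp_norm p (fejer_mean N f) \<le> (\<Sum>k<N+m. c k * Lp_norm p f)"
    using Lp_sum[OF p, of "{..<N+m}" "\<lambda>k z. of_real (c k) * f (w k * z)"] mem unfolding eq nrm by simp
  also have "\<dots> = Lp_norm p f" using cw(3) by (simp flip: sum_distrib_right)
  finally show ?thesis .
qed

text \<open>
  For fixed \<open>N\<close> this continuity carries the contraction property from trigonometric polynomials
  over to \<open>L^p\<close>.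
\<close>

lemma fejer_mean_crude_bound:
  assumes p: "1 < p" and f: "f \<in> Lp p"
  shows "Lp_norm p (fejer_mean N f) \<le> (2 * real N + 1) * Lp_norm p f"
proof (rule Lp_norm_le_on_circle(2))
  show "0 < p" using p by simp
  show "fejer_mean N f \<in> borel_measurable circle" by (intro borel_measurable_circle_continuous
      fejer_mean_continuous)
  fix z :: complex assume z: "norm z = 1"
  have "norm (fejer_mean N f z) \<le> (\<Sum>n\<in>{- int N..int N}. 1 * Lp_norm p f * 1)"
    unfolding fejer_mean_def
  proof (intro sum_norm_le)
    fix n
    have "norm (of_real (fejer_weight N n) * fourier_coeff f n * chi n z)
        = fejer_weight N n * norm (fourier_coeff f n) * 1"
      using z fejer_weight_bounds[of N n] by (simp add: norm_mult)
    also have "\<dots> \<le> 1 * Lp_norm p f * 1"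
      using fejer_weight_bounds norm_fourier_coeff_le_Lp[OF p f] by (intro mult_mono) auto
    finally show "norm (of_real (fejer_weight N n) * fourier_coeff f n * chi n z) \<le> 1 * Lp_norm p f * 1" .
  qed
  then show "norm (fejer_mean N f z) \<le> (2 * real N + 1) * Lp_norm p f" by simp
qed

lemma fejer_mean_contraction:
  assumes p: "1 < p" and f: "f \<in> Lp p" and N: "0 < N"
  shows "Lp_norm p (fejer_mean N f) \<le> Lp_norm p f"
proof (rule field_le_epsilon)
  fix e :: real assume e: "e > 0"
  \<comment> \<open>The crude bound applied to an error below \<open>d\<close>, plus that error itself, is at most \<open>e\<close>.\<close>
  define d where "d = e / (2 * real N + 2)"
  have d: "d > 0" using e by (simp add: d_def)
  obtain g where g: "trig_poly g" "Lp_norm p (\<lambda>z. f z - g z) < d"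
    using Lp_approximable_Lp[of p f] p f d unfolding Lp_approximable_def by auto
  have gL: "g \<in> Lp p" using p g by (intro Lp_trig_poly) auto
  have p1: "1 \<le> p" using p by simp
  have fg: "(\<lambda>z. f z - g z) \<in> Lp p" by (intro Lp_diff p1 f gL)
  have "Lp_norm p (\<lambda>z. fejer_mean N f z - fejer_mean N g z) \<le> (2 * real N + 1) * d"
  proof -
    have "Lp_norm p (\<lambda>z. fejer_mean N f z - fejer_mean N g z) = Lp_norm p (fejer_mean N (\<lambda>z. f z - g z))"
      using Lp_imp_integrable(1)[OF p f] Lp_imp_integrable(1)[OF p gL] by (simp add: fejer_mean_diff)
    also have "\<dots> \<le> (2 * real N + 1) * Lp_norm p (\<lambda>z. f z - g z)" by (rule fejer_mean_crude_bound[OF p fg])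
    also have "\<dots> \<le> (2 * real N + 1) * d" using g by (intro mult_left_mono) auto
    finally show ?thesis .
  qed
  moreover have "Lp_norm p (fejer_mean N g) \<le> Lp_norm p g" using p1 g N
      by (intro fejer_mean_trig_poly_contraction)
  moreover have "Lp_norm p g \<le> Lp_norm p f + d" using Lp_norm_diff_ge[OF p1 f gL] g by linarith
  moreover have "\<bar>Lp_norm p (fejer_mean N f) - Lp_norm p (fejer_mean N g)\<bar>
      \<le> Lp_norm p (\<lambda>z. fejer_mean N f z - fejer_mean N g z)"
    using p by (intro Lp_norm_diff_ge fejer_mean_Lp) auto
  ultimately have "Lp_norm p (fejer_mean N f) \<le> Lp_norm p f + (2 * real N + 2) * d" by (simp add: algebra_simps)
  then show "Lp_norm p (fejer_mean N f) \<le> Lp_norm p f + e" by (simp add: d_def)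
qed

text \<open>
  Fejer means are contractions and converge on the dense set of trigonometric polynomials.
\<close>

theorem fejer_mean_tendsto:
  assumes p: "1 < p" and f: "f \<in> Lp p"
  shows "(\<lambda>N. Lp_norm p (\<lambda>z. f z - fejer_mean N f z)) \<longlonglongrightarrow> 0"
proof (rule LIMSEQ_I)
  fix e :: real assume e: "0 < e"
  obtain g where g: "trig_poly g" "Lp_norm p (\<lambda>z. f z - g z) < e/4"
    using Lp_approximable_Lp[of p f] p f e unfolding Lp_approximable_def
        by (metis less_eq_real_def zero_less_divide_iff zero_less_numeral)
  have gL: "g \<in> Lp p" using p g by (intro Lp_trig_poly) auto
  have p1: "1 \<le> p" using p by simp
  have fg: "(\<lambda>z. f z - g z) \<in> Lp p" by (intro Lp_diff p1 f gL)
  have FL: "fejer_mean N h \<in> Lp p" for N h using p by (intro fejer_mean_Lp) auto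
  have "\<forall>\<^sub>F N in sequentially. \<forall>z\<in>sphere 0 1. norm (g z - fejer_mean N g z) < e/4"
    by (rule fejer_mean_trig_poly_tendsto[OF g(1), THEN spec, THEN mp]) (use e in simp)
  then have "\<forall>\<^sub>F N in sequentially. Lp_norm p (\<lambda>z. f z - fejer_mean N f z) < e"
    using eventually_gt_at_top[of 0]
  proof eventually_elim
    case (elim N)
    have 1: "Lp_norm p (\<lambda>z. g z - fejer_mean N g z) \<le> e/4"
      using p elim LpD(1)[OF Lp_diff[OF p1 gL FL[of N g]]] by (intro Lp_norm_le_on_circle(2))
          (auto intro: less_imp_le)
    have "Lp_norm p (\<lambda>z. fejer_mean N g z - fejer_mean N f z) = Lp_norm p (fejer_mean N (\<lambda>z. f z - g z))"
      using Lp_imp_integrable(1)[OF p f] Lp_imp_integrable(1)[OF p gL] by (subst Lp_norm_diff_commute)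
          (simp add: fejer_mean_diff)
    also have "\<dots> \<le> Lp_norm p (\<lambda>z. f z - g z)" using elim by (intro fejer_mean_contraction p fg) auto
    finally have 2: "Lp_norm p (\<lambda>z. fejer_mean N g z - fejer_mean N f z) \<le> e/4" using g by simp
    show ?case
      using Lp_norm_triangle_diff[OF p1 f gL FL[of N f]] Lp_norm_triangle_diff[OF p1 gL FL[of N g] FL[of N
          f]] 1 2 g(2) e by linarith
  qed
  then show "\<exists>no. \<forall>n\<ge>no. norm (Lp_norm p (\<lambda>z. f z - fejer_mean n f z) - 0) < e"
    by (simp add: eventually_sequentially)
qed

lemma AE_eq_of_fourier_coeff_eq:
  assumes p: "1 < p" and f: "f \<in> Lp p" "g \<in> Lp p" and eq: "\<And>n. fourier_coeff f n = fourier_coeff g n"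
  shows "AE z in circle. f z = g z"
proof -
  have d: "(\<lambda>z. f z - g z) \<in> Lp p" using p f by (intro Lp_diff) auto
  have "fejer_mean N (\<lambda>z. f z - g z) z = 0" for N z
    using Lp_imp_integrable(1)[OF p f(1)] Lp_imp_integrable(1)[OF p f(2)] by
        (simp add: fejer_mean_def fourier_coeff_diff eq)
  then have "Lp_norm p (\<lambda>z. f z - g z) = 0"
    using fejer_mean_tendsto[OF p d] by (simp add: LIMSEQ_const_iff)
  then show ?thesis using AE_eq_0_of_Lp_norm_eq_0[OF d] by simp
qed

lemma fourier_coeff_tendsto_0:
  assumes p: "1 < p" and f: "f \<in> Lp p"
  shows "(\<lambda>n. fourier_coeff f (int n)) \<longlonglongrightarrow> 0"
proof (rule LIMSEQ_I)
  fix e :: real assume e: "0 < e"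
  obtain N where N: "Lp_norm p (\<lambda>z. f z - fejer_mean N f z) < e"
    using order_tendstoD(2)[OF fejer_mean_tendsto[OF p f] e] by (auto simp: eventually_sequentially)
  have FL: "fejer_mean N f \<in> Lp p" using p by (intro fejer_mean_Lp) auto
  have "norm (fourier_coeff f (int n)) < e" if "n > N" for n
  proof -
    have "fourier_coeff (fejer_mean N f) (int n) = (\<Sum>m\<in>{- int N..int N}. fourier_coeff (\<lambda>z. of_real
        (fejer_weight N m) * fourier_coeff f m * chi m z) (int n))"
      unfolding fejer_mean_def
      by (intro fourier_coeff_sum integrable_circle_continuous continuous_intros)
    also have "\<dots> = 0" using that by (intro sum.neutral ballI) (auto simp: fourier_coeff_monomial)
    finally have "fourier_coeff (\<lambda>z. f z - fejer_mean N f z) (int n) = fourier_coeff f (int n)"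
      by (simp add: fourier_coeff_diff[OF Lp_imp_integrable(1)[OF p f] Lp_imp_integrable(1)[OF p FL]])
    then show ?thesis using norm_fourier_coeff_le_Lp[OF p Lp_diff[OF _ f FL], of "int n"] p N by simp
  qed
  then show "\<exists>no. \<forall>n\<ge>no. norm (fourier_coeff f (int n) - 0) < e" by (intro exI[of _ "Suc N"]) auto
qed

section \<open>Functionals and norms on analytic polynomials\<close>

text \<open>
  The linear functional on polynomials that maps the monomial of degree \<open>i\<close> to \<open>a i\<close>.
\<close>

definition functional :: "(nat \<Rightarrow> complex) \<Rightarrow> complex poly \<Rightarrow> complex" where
  "functional a h = (\<Sum>i\<le>degree h. a i * coeff h i)"

lemma functional_altdef: "degree h \<le> n \<Longrightarrow> functional a h = (\<Sum>i\<le>n. a i * coeff h i)"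
  unfolding functional_def by (intro sum.mono_neutral_left) (auto simp: coeff_eq_0)

lemma functional_add: "functional a (f + g) = functional a f + functional a g"
proof -
  let ?n = "max (degree f) (degree g)"
  have "degree (f + g) \<le> ?n" by (rule degree_add_le_max)
  then show ?thesis by (simp add: functional_altdef[of _ ?n] distrib_left sum.distrib)
qed

lemma functional_smult: "functional a (smult c f) = c * functional a f"
  using functional_altdef[of "smult c f" "degree f" a] degree_smult_le[of c f]
  by (simp add: functional_def sum_distrib_left mult_ac)

lemma functional_diff: "functional a (f - g) = functional a f - functional a g"
  using functional_add[of a f "smult (-1) g"] functional_smult[of a "-1" g] by simp

lemma functional_0 [simp]: "functional a 0 = 0"
  by (simp add: functional_def)

lemma functional_sum: "functional a (\<Sum>i\<in>I. f i) = (\<Sum>i\<in>I. functional a (f i))"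
  by (induction I rule: infinite_finite_induct) (auto simp: functional_add)

lemma functional_diff_left: "functional (\<lambda>i. a i - b i) f = functional a f - functional b f"
  by (simp add: functional_def left_diff_distrib sum_subtractf)

abbreviation poly_norm :: "real \<Rightarrow> complex poly \<Rightarrow> real" where
  "poly_norm p h \<equiv> Lp_norm p (poly h)"

lemma poly_Lp: "0 < p \<Longrightarrow> poly h \<in> Lp p" for h :: "complex poly"
  by (intro Lp_continuous continuous_intros)

lemma poly_norm_le_sup:
  assumes "0 < p" "\<And>z. norm z = 1 \<Longrightarrow> norm (poly h z) \<le> B"
  shows "poly_norm p h \<le> B"
  using assms LpD(1)[OF poly_Lp[OF assms(1)]] by (intro Lp_norm_le_on_circle(2)) auto

lemma poly_norm_triangle: "1 \<le> p \<Longrightarrow> poly_norm p (f + g) \<le> poly_norm p f + poly_norm p g"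
  using Lp_norm_triangle[OF _ poly_Lp poly_Lp, of p f g] by (simp add: poly_add[abs_def])

lemma poly_norm_smult: "0 < p \<Longrightarrow> poly_norm p (smult c f) = norm c * poly_norm p f"
  using Lp_norm_cmult[of p c "poly f"] by (simp add: poly_smult[abs_def])

lemma poly_norm_diff_ge: "1 \<le> p \<Longrightarrow> \<bar>poly_norm p f - poly_norm p g\<bar> \<le> poly_norm p (f - g)"
  using Lp_norm_diff_ge[OF _ poly_Lp poly_Lp, of p f g] by (simp add: poly_diff[abs_def])

text \<open>
  The substitution \<open>z \<mapsto> c z\<close>: a rotation for \<open>\<bar>c\<bar> = 1\<close>, and a contraction of the disc for
  \<open>0 < c < 1\<close>.
\<close>

definition dilate :: "complex \<Rightarrow> complex poly \<Rightarrow> complex poly" where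
  "dilate c h = pcompose h [:0, c:]"

lemma poly_dilate [simp]: "poly (dilate c h) z = poly h (c * z)"
  by (simp add: dilate_def poly_pcompose mult.commute)

lemma coeff_dilate [simp]: "coeff (dilate c h) i = c ^ i * coeff h i"
  by (simp add: dilate_def coeff_pcompose_linear)

lemma degree_dilate_le: "degree (dilate c h) \<le> degree h"
  by (intro degree_le) (simp add: coeff_eq_0)

lemma dilate_mult: "dilate c (f * g) = dilate c f * dilate c g"
  by (simp add: dilate_def pcompose_mult)

lemma dilate_power: "dilate c (f ^ n) = dilate c f ^ n"
  by (induction n) (auto simp: dilate_mult dilate_def pcompose_mult pcompose_1)

lemma functional_dilate: "functional a (dilate c h) = (\<Sum>i\<le>degree h. a i * c ^ i * coeff h i)"
  using functional_altdef[OF degree_dilate_le, of a c h] by (simp add: mult.assoc)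

lemma poly_norm_rotation: "norm w = 1 \<Longrightarrow> 0 < p \<Longrightarrow> poly_norm p (dilate w h) = poly_norm p h"
  using Lp_rotation(2)[OF poly_Lp, of p w h] by (simp add: poly_dilate[abs_def])

section \<open>Inner-outer factorization of polynomials\<close>

text \<open>
  Boundary values of functions continuous on the closed disc and holomorphic inside, described
  through polynomial approximation on the circle.
\<close>

definition disc_algebra :: "(complex \<Rightarrow> complex) \<Rightarrow> bool" where
  "disc_algebra f \<longleftrightarrow> (\<exists>h. uniform_limit (sphere 0 1) (\<lambda>n. poly (h n)) f sequentially)"

lemma disc_algebra_poly: "disc_algebra (poly h)"
  unfolding disc_algebra_def by (intro exI[of _ "\<lambda>_. h"]) (simp add: uniform_limit_const)

lemma disc_algebra_const: "disc_algebra (\<lambda>z. c)"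
  using disc_algebra_poly[of "[:c:]"] by (simp add: poly_pCons[abs_def])

lemma uniform_limit_poly_continuous:
  "uniform_limit (sphere 0 1) (\<lambda>n::nat. poly (h n)) f sequentially \<Longrightarrow> continuous_on (sphere 0 1) f"
  for f :: "complex \<Rightarrow> complex"
  by (rule uniform_limit_theorem[rotated]) (auto intro!: always_eventually continuous_intros)

lemma uniform_limit_poly_bounded:
  "uniform_limit (sphere 0 1) (\<lambda>n::nat. poly (h n)) f sequentially \<Longrightarrow> bounded (f ` sphere 0 1)"
  for f :: "complex \<Rightarrow> complex"
  by (intro compact_imp_bounded compact_continuous_image uniform_limit_poly_continuous) auto

lemma uniform_limit_poly_mult:
  fixes f g :: "complex \<Rightarrow> complex"
  assumes "uniform_limit (sphere 0 1) (\<lambda>n::nat. poly (h n)) f sequentially"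
      "uniform_limit (sphere 0 1) (\<lambda>n::nat. poly (k n)) g sequentially"
  shows "uniform_limit (sphere 0 1) (\<lambda>n::nat. poly (h n * k n)) (\<lambda>z. f z * g z) sequentially"
  using uniform_lim_mult[OF assms assms[THEN uniform_limit_poly_bounded]] by (simp add: poly_mult[abs_def])

lemma disc_algebra_mult: "disc_algebra f \<Longrightarrow> disc_algebra g \<Longrightarrow> disc_algebra (\<lambda>z. f z * g z)"
  unfolding disc_algebra_def by (elim exE, rule exI, erule (1) uniform_limit_poly_mult)

text \<open>
  The binomial series converges absolutely at \<open>\<bar>w\<bar> < 1\<close>, hence uniformly in \<open>z\<close> on the circle.
\<close>

lemma disc_algebra_binomial:
  fixes w s :: complex
  assumes w: "norm w < 1"
  shows "disc_algebra (\<lambda>z. (1 - w * z) powr s)"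
proof -
  define t where "t i z = (s gchoose i) * (- w * z) ^ i" for i and z :: complex
  obtain r where r: "norm w < r" "r < 1" using w dense by blast
  have "summable (\<lambda>n. (s gchoose n) * complex_of_real r ^ n)"
    using gen_binomial_complex[of "of_real r" s] r order.trans[OF norm_ge_zero, of w r] by
        (auto intro: sums_summable)
  then have sm: "summable (\<lambda>n. norm ((s gchoose n) * w ^ n))"
    by (rule powser_insidea) (use r in auto)
  have "uniform_limit (sphere 0 1) (\<lambda>n z. \<Sum>i<n. t i z) (\<lambda>z. suminf (\<lambda>i. t i z)) sequentially"
    using sm by (intro Weierstrass_m_test) (auto simp: t_def norm_mult norm_power)
  also have "(\<lambda>n z. \<Sum>i<n. t i z) = (\<lambda>n. poly (\<Sum>i<n. monom ((s gchoose i) * (- w) ^ i) i))"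
    by (intro ext) (simp only: poly_sum poly_monom t_def power_mult_distrib mult.assoc)
  finally have "uniform_limit (sphere 0 1) (\<lambda>n. poly (\<Sum>i<n. monom ((s gchoose i) * (- w) ^ i) i)) (\<lambda>z.
      suminf (\<lambda>i. t i z)) sequentially" .
  moreover have "suminf (\<lambda>i. t i z) = (1 - w * z) powr s" if "z \<in> sphere 0 1" for z
    using gen_binomial_complex[of "- w * z" s] that w by (simp add: t_def norm_mult sums_iff)
  ultimately have "uniform_limit (sphere 0 1) (\<lambda>n. poly (\<Sum>i<n. monom ((s gchoose i) * (- w) ^ i) i)) (\<lambda>z. (1
      - w * z) powr s) sequentially"
    by (subst uniform_limit_cong'[where g="\<lambda>n. poly (\<Sum>i<n. monom ((s gchoose i) * (- w) ^ i) i)"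
        and i="\<lambda>z. suminf (\<lambda>i. t i z)"]) auto
  then show ?thesis unfolding disc_algebra_def
    by (intro exI[where x="\<lambda>n. \<Sum>i<n. monom ((s gchoose i) * (- w) ^ i) i"])
qed

text \<open>
  \<open>B\<close> is the unimodular factor of \<open>f\<close>, and \<open>U s\<close> is a branch of the \<open>s\<close>-th power of the zero-free
  factor. The branches are chosen coherently, so that exponents add.
\<close>

definition inner_outer :: "(complex \<Rightarrow> complex) \<Rightarrow> (complex \<Rightarrow> complex) \<Rightarrow> (real \<Rightarrow> complex \<Rightarrow> complex) \<Rightarrow> bool" where
  "inner_outer f B U \<longleftrightarrow> disc_algebra B \<and> (\<forall>s. disc_algebra (U s)) \<and>
     (\<forall>z\<in>sphere 0 1. norm (B z) = 1 \<and> B z * U 1 z = f z \<and>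
       (\<forall>s. norm (U s z) = norm (f z) powr s) \<and> (\<forall>s t. U (s + t) z = U s z * U t z))"

lemma inner_outer_mult:
  assumes "inner_outer f B U" "inner_outer g B' U'"
  shows "inner_outer (\<lambda>z. f z * g z) (\<lambda>z. B z * B' z) (\<lambda>s z. U s z * U' s z)"
  unfolding inner_outer_def
proof (intro conjI ballI allI)
  have 1: "disc_algebra B" "disc_algebra B'" "\<And>s. disc_algebra (U s)" "\<And>s. disc_algebra (U' s)"
    using assms unfolding inner_outer_def by blast+
  then show "disc_algebra (\<lambda>z. B z * B' z)" "\<And>s. disc_algebra (\<lambda>z. U s z * U' s z)"
    by (blast intro: disc_algebra_mult)+
  fix z :: complex assume z: "z \<in> sphere 0 1"
  have 2: "norm (B z) = 1" "B z * U 1 z = f z" "\<And>s. norm (U s z) = norm (f z) powr s" "\<And>s t. U (s + t) z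
      = U s z * U t z"
    using assms(1) z unfolding inner_outer_def by blast+
  have 3: "norm (B' z) = 1" "B' z * U' 1 z = g z" "\<And>s. norm (U' s z) = norm (g z) powr s" "\<And>s t. U' (s
      + t) z = U' s z * U' t z"
    using assms(2) z unfolding inner_outer_def by blast+
  show "norm (B z * B' z) = 1" by (simp add: norm_mult 2 3)
  show "B z * B' z * (U 1 z * U' 1 z) = f z * g z" by (simp add: mult_ac flip: 2(2) 3(2))
  show "norm (U s z * U' s z) = norm (f z * g z) powr s" for s by (simp add: norm_mult powr_mult 2 3)
  show "U (s + t) z * U' (s + t) z = U s z * U' s z * (U t z * U' t z)" for s t by (simp add: 2(4) 3(4) mult_ac)
qed

lemma inner_outer_const:
  assumes "c \<noteq> 0"
  shows "inner_outer (\<lambda>z. c) (\<lambda>z. c / norm c) (\<lambda>s z. of_real (norm c powr s))"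
  using assms by (auto simp: inner_outer_def disc_algebra_const norm_divide powr_add)

lemma inner_outer_linear_outside:
  assumes r: "norm r > 1"
  shows "inner_outer (\<lambda>z. 1 - z / r) (\<lambda>z. 1) (\<lambda>s z. (1 - z / r) powr of_real s)"
proof -
  have r0: "r \<noteq> 0" using r by auto
  have n: "norm (inverse r) < 1" using r r0 by (simp add: norm_inverse inverse_less_1_iff)
  have eq: "(1 - z / r) = 1 - inverse r * z" for z using r0 by (simp add: field_simps)
  have nz: "1 - z / r \<noteq> 0" if "norm z = 1" for z using that r r0 by (auto simp: field_simps)
  show ?thesis unfolding inner_outer_def
  proof (intro conjI ballI allI)
    show "disc_algebra (\<lambda>z. (1 - z / r) powr of_real s)" for s unfolding eq by (intro disc_algebra_binomial n)
  qed (auto simp: disc_algebra_const norm_powr_real_powr' powr_add nz)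
qed

text \<open>
  A zero inside the disc is reflected in the circle: \<open>1 - cnj r * z\<close> has the same modulus as
  \<open>z - r\<close> on the circle, and the quotient is a Blaschke factor.
\<close>

lemma inner_outer_linear_inside:
  assumes r: "norm r < 1"
  shows "inner_outer (\<lambda>z. z - r) (\<lambda>z. (z - r) * (1 - cnj r * z) powr (-1)) (\<lambda>s z. (1 - cnj r * z) powr
      of_real s)"
proof -
  have nz: "1 - cnj r * z \<noteq> 0" if "norm z = 1" for z
  proof
    assume "1 - cnj r * z = 0"
    then have "norm (cnj r * z) = 1" by simp
    then show False using that r by (simp add: norm_mult)
  qed
  have nrm: "norm (1 - cnj r * z) = norm (z - r)" if z: "norm z = 1" for z
  proof -
    have "1 - cnj r * z = z * cnj (z - r)" using complex_norm_square[of z] z by (simp add: algebra_simps)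
    then show ?thesis using z by (simp only: norm_mult complex_mod_cnj)
  qed
  have nz': "z - r \<noteq> 0" if "norm z = 1" for z using that r by auto
  show ?thesis unfolding inner_outer_def
  proof (intro conjI ballI allI)
    have "disc_algebra (\<lambda>z. z - r)" using disc_algebra_poly[of "[:-r,1:]"] by (simp add: poly_pCons[abs_def])
    then show "disc_algebra (\<lambda>z. (z - r) * (1 - cnj r * z) powr (-1))"
      using r by (intro disc_algebra_mult disc_algebra_binomial) auto
    show "disc_algebra (\<lambda>z. (1 - cnj r * z) powr of_real s)" for s using r by (intro disc_algebra_binomial) auto
    fix z :: complex assume "z \<in> sphere 0 1"
    then have z: "norm z = 1" by simp
    have p1: "(1 - cnj r * z) powr (-1) = inverse (1 - cnj r * z)" using nz[OF z] by (simp add: powr_minus)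
    have p2: "(1 - cnj r * z) powr of_real 1 = 1 - cnj r * z" using nz[OF z] by simp
    show "norm ((z - r) * (1 - cnj r * z) powr (-1)) = 1"
      unfolding p1 norm_mult norm_inverse nrm[OF z] using nz'[OF z] by simp
    show "(z - r) * (1 - cnj r * z) powr (-1) * (1 - cnj r * z) powr of_real 1 = z - r"
      unfolding p1 p2 mult.assoc using left_inverse[OF nz[OF z]] by (simp only: mult_1_right)
    show "norm ((1 - cnj r * z) powr of_real s) = norm (z - r) powr s" for s
      by (simp add: norm_powr_real_powr' nrm[OF z])
    show "(1 - cnj r * z) powr of_real (s + t) = (1 - cnj r * z) powr of_real s * (1 - cnj r * z) powr
        of_real t" for s t
      by (simp add: powr_add)
  qed
qed

lemma poly_inner_outer:
  assumes nz: "\<And>z. norm z = 1 \<Longrightarrow> poly h z \<noteq> 0"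
  shows "\<exists>B U. inner_outer (poly h) B U"
proof -
  obtain root where root: "smult (lead_coeff h) (\<Prod>i<degree h. [:- root i, 1:]) = h"
    by (rule complex_poly_decompose')
  have h0: "lead_coeff h \<noteq> 0" using nz[of 1] by auto
  have rt: "norm (root i) \<noteq> 1" if "i < degree h" for i
  proof
    assume "norm (root i) = 1"
    moreover have "poly h (root i) = 0" using that by (subst root[symmetric]) (auto simp: poly_prod)
    ultimately show False using nz by blast
  qed
  have lin: "\<exists>B U. inner_outer (\<lambda>z. z - root i) B U" if i: "i < degree h" for i
  proof (cases "norm (root i) < 1")
    case False
    then have 1: "norm (root i) > 1" using rt[OF i] by linarith
    then have r0: "- root i \<noteq> 0" by auto
    have "(\<lambda>z. z - root i) = (\<lambda>z. - root i * (1 - z / root i))" using r0 by (auto simp: field_simps)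
    then show ?thesis using inner_outer_mult[OF inner_outer_const[OF r0] inner_outer_linear_outside[OF 1]]
        by auto
  qed (use inner_outer_linear_inside in blast)
  have "\<exists>B U. inner_outer (\<lambda>z. lead_coeff h * (\<Prod>i<n. z - root i)) B U" if "n \<le> degree h" for n
    using that
  proof (induction n)
    case 0
    then show ?case using inner_outer_const[OF h0] by auto
  next
    case (Suc n)
    then obtain B U B' U' where "inner_outer (\<lambda>z. lead_coeff h * (\<Prod>i<n. z - root i)) B U"
        "inner_outer (\<lambda>z. z - root n) B' U'"
      using lin[of n] by auto
    from inner_outer_mult[OF this] show ?case by (auto simp: mult.assoc)
  qed
  from this[of "degree h"] have "\<exists>B U. inner_outer (\<lambda>z. lead_coeff h * (\<Prod>i<degree h. z - root i)) B U" by simp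
  moreover have "(\<lambda>z. lead_coeff h * (\<Prod>i<degree h. z - root i)) = poly h"
    by (subst (3) root[symmetric]) (simp add: poly_prod fun_eq_iff)
  ultimately show ?thesis by metis
qed

section \<open>Bounds obtained by factoring\<close>

lemma poly_norm_tendsto_uniform_limit:
  assumes p: "1 \<le> p" and u: "uniform_limit (sphere 0 1) (\<lambda>n::nat. poly (h n)) f sequentially"
  shows "(\<lambda>n. poly_norm p (h n)) \<longlonglongrightarrow> Lp_norm p f"
proof (rule LIMSEQ_I)
  fix e :: real assume e: "e > 0"
  have f: "f \<in> Lp p" using p by (intro Lp_continuous uniform_limit_poly_continuous[OF u]) auto
  have "\<forall>\<^sub>F n in sequentially. \<forall>z\<in>sphere 0 1. dist (poly (h n) z) (f z) < e/2"
    using u e by (intro uniform_limitD) auto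
  then have "\<forall>\<^sub>F n in sequentially. norm (poly_norm p (h n) - Lp_norm p f) < e"
  proof eventually_elim
    case (elim n)
    have "Lp_norm p (\<lambda>z. poly (h n) z - f z) \<le> e/2"
    proof (rule Lp_norm_le_on_circle(2))
      show "(\<lambda>z. poly (h n) z - f z) \<in> borel_measurable circle"
        using p f by (intro LpD(1)[of _ p] Lp_diff poly_Lp) auto
    qed (use p elim in \<open>auto simp: dist_norm intro: less_imp_le\<close>)
    then show ?case using Lp_norm_diff_ge[OF p poly_Lp f, of "h n"] p e by simp
  qed
  then show "\<exists>no. \<forall>n\<ge>no. norm (poly_norm p (h n) - Lp_norm p f) < e"
    by (simp add: eventually_sequentially)
qed

lemma functional_tendsto_uniform_limit:
  assumes K: "\<And>f. norm (functional a f) \<le> K * poly_norm p f" "0 \<le> K" and p: "0 < p"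
    and u: "uniform_limit (sphere 0 1) (\<lambda>n::nat. poly (h n)) (poly f) sequentially"
  shows "(\<lambda>n. functional a (h n)) \<longlonglongrightarrow> functional a f"
proof (rule LIMSEQ_I)
  fix e :: real assume e: "e > 0"
  have "\<forall>\<^sub>F n in sequentially. \<forall>z\<in>sphere 0 1. dist (poly (h n) z) (poly f z) < e / (K + 1)"
    using u e K(2) by (intro uniform_limitD) auto
  then have "\<forall>\<^sub>F n in sequentially. norm (functional a (h n) - functional a f) < e"
  proof eventually_elim
    case (elim n)
    have "poly_norm p (h n - f) \<le> e / (K + 1)"
      using p elim by (intro poly_norm_le_sup) (auto simp: dist_norm intro: less_imp_le)
    then have "norm (functional a (h n - f)) \<le> K * (e / (K + 1))"
      using K by (meson mult_left_mono order.trans)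
    also have "\<dots> < e" using K(2) e by (simp add: field_simps)
    finally show ?case by (simp add: functional_diff)
  qed
  then show "\<exists>no. \<forall>n\<ge>no. norm (functional a (h n) - functional a f) < e"
    by (simp add: eventually_sequentially)
qed

text \<open>
  For \<open>h \<noteq> 0\<close> the dilates \<open>h(r z)\<close> have no zeros on the circle when \<open>r < 1\<close> is close to 1, and both
  sides depend continuously on \<open>r\<close>.
\<close>

lemma functional_bound_of_zero_free:
  assumes s: "1 \<le> s" and bound: "\<And>h. (\<And>z. norm z = 1 \<Longrightarrow> poly h z \<noteq> 0) \<Longrightarrow> norm (functional b h)
      \<le> K * poly_norm s h"
  shows "norm (functional b h) \<le> K * poly_norm s h"
proof (cases "h = 0")
  case True
  then show ?thesis using Lp_norm_eq_0_of_AE[of "\<lambda>_. 0" s] by (simp add: poly_0[abs_def])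
next
  case False
  define d where "d r = dilate (of_real r) h" for r :: real
  have fin: "finite (norm ` {z. poly h z = 0})" using poly_roots_finite[OF False] by simp
  have l1: "((\<lambda>r. functional b (d r)) \<longlongrightarrow> functional b h) (at_left 1)"
  proof -
    have "((\<lambda>r. \<Sum>i\<le>degree h. b i * of_real r ^ i * coeff h i) \<longlongrightarrow> (\<Sum>i\<le>degree h. b i * of_real 1 ^ i * coeff h
        i)) (at_left (1::real))"
      by (intro tendsto_intros)
    then show ?thesis by (simp add: functional_dilate d_def functional_def[of b h])
  qed
  have l2: "((\<lambda>r. poly_norm s (d r)) \<longlongrightarrow> poly_norm s h) (at_left 1)"
  proof (rule tendsto_norm_zero_cancel[THEN LIM_zero_cancel], rule tendsto_sandwich[OF _ _ tendsto_const])
    have "((\<lambda>r. \<Sum>i\<le>degree h. norm (coeff h i) * \<bar>r ^ i - 1\<bar>) \<longlongrightarrow> (\<Sum>i\<le>degree h. norm (coeff h i) * \<bar>1 ^ i -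
        1\<bar>)) (at_left (1::real))"
      by (intro tendsto_intros)
    then show "((\<lambda>r. \<Sum>i\<le>degree h. norm (coeff h i) * \<bar>r ^ i - 1\<bar>) \<longlongrightarrow> 0) (at_left (1::real))" by simp
    show "\<forall>\<^sub>F r in at_left 1. norm (poly_norm s (d r) - poly_norm s h)
        \<le> (\<Sum>i\<le>degree h. norm (coeff h i) * \<bar>r ^ i - 1\<bar>)"
    proof (intro always_eventually allI)
      fix r :: real
      have "norm (poly_norm s (d r) - poly_norm s h) \<le> poly_norm s (d r - h)" using poly_norm_diff_ge[OF s]
          by simp
      also have "\<dots> \<le> (\<Sum>i\<le>degree h. norm (coeff h i) * \<bar>r ^ i - 1\<bar>)"
      proof (rule poly_norm_le_sup)
        fix z :: complex assume z: "norm z = 1"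
        have "poly (d r - h) z = (\<Sum>i\<le>degree h. coeff h i * (of_real (r ^ i - 1) * z ^ i))"
          unfolding poly_diff d_def poly_dilate unfolding poly_altdef
          by (simp add: power_mult_distrib algebra_simps sum_subtractf)
        also have "norm \<dots> \<le> (\<Sum>i\<le>degree h. norm (coeff h i) * \<bar>r ^ i - 1\<bar>)"
          using z by (intro sum_norm_le) (simp only: norm_mult norm_power norm_of_real power_one
              mult_1_right order.refl)
        finally show "norm (poly (d r - h) z) \<le> (\<Sum>i\<le>degree h. norm (coeff h i) * \<bar>r ^ i - 1\<bar>)" .
      qed (use s in auto)
      finally show "norm (poly_norm s (d r) - poly_norm s h) \<le> (\<Sum>i\<le>degree h. norm (coeff h i) * \<bar>r ^ i - 1\<bar>)" .
    qed
  qed auto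
  have "\<forall>\<^sub>F r in at_left (1::real). r \<notin> norm ` {z. poly h z = 0}"
    using islimpt_finite[OF fin, of 1] by (auto simp: islimpt_iff_eventually eventually_at_filter elim!:
        eventually_mono)
  moreover have "\<forall>\<^sub>F r in at_left (1::real). r > 0"
    by (rule eventually_at_leftI[of 0]) auto
  ultimately have ev: "\<forall>\<^sub>F r in at_left 1. norm (functional b (d r)) \<le> K * poly_norm s (d r)"
  proof eventually_elim
    case (elim r)
    show ?case
    proof (rule bound)
      fix z :: complex assume "norm z = 1"
      then show "poly (d r) z \<noteq> 0" using elim by (force simp: d_def norm_mult)
    qed
  qed
  show ?thesis
    by (rule tendsto_le[OF _ tendsto_mult[OF tendsto_const l2] tendsto_norm[OF l1] ev]) auto
qed

lemma inner_outer_power: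
  assumes "inner_outer f B U" "norm z = 1" "m > 0"
  shows "U s z ^ m = U (real m * s) z"
  using assms(3)
proof (induction m rule: nat_induct_non_zero)
  case (Suc n)
  have "U (s + real n * s) z = U s z * U (real n * s) z"
    using assms(1,2) unfolding inner_outer_def by simp
  then show ?case using Suc by (simp add: algebra_simps)
qed simp

text \<open>
  A zero-free \<open>h = B u\<close> is the product of \<open>B u^(1/p)\<close> and \<open>u^(1/q)\<close>. The \<open>p\<close>-norm of the first factor
  and the \<open>q\<close>-norm of the second are the powers \<open>1 / p\<close> and \<open>1 / q\<close> of the \<open>L^1\<close> norm of \<open>h\<close>. The
  hypothesis is about polynomial factors and carries over to these by approximation.
\<close>

theorem functional_L1_bound:
  assumes p: "1 < p" "1 < q" "1 / p + 1 / q = 1" and K: "0 \<le> K"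
    and bound: "\<And>f g. norm (functional a (f * g)) \<le> K * poly_norm p f * poly_norm q g"
  shows "norm (functional a h) \<le> K * poly_norm 1 h"
proof (rule functional_bound_of_zero_free)
  have one: "poly_norm q 1 \<le> 1" using p by (intro poly_norm_le_sup) auto
  have Kp: "norm (functional a f) \<le> K * poly_norm p f" for f
    using bound[of f 1] mult_left_mono[OF one, of "K * poly_norm p f"] K by simp
  fix h :: "complex poly" assume nz: "\<And>z. norm z = 1 \<Longrightarrow> poly h z \<noteq> 0"
  obtain B U where BU: "inner_outer (poly h) B U" using poly_inner_outer[of h] nz by blast
  note BU' = BU[unfolded inner_outer_def]
  have "disc_algebra (\<lambda>z. B z * U (1/p) z)" "disc_algebra (U (1/q))" using BU' by
      (auto intro: disc_algebra_mult)
  then obtain f g where f: "uniform_limit (sphere 0 1) (\<lambda>n. poly (f n)) (\<lambda>z. B z * U (1/p) z) sequentially"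
    and g: "uniform_limit (sphere 0 1) (\<lambda>n. poly (g n)) (U (1/q)) sequentially"
    unfolding disc_algebra_def by metis
  have eq: "B z * U (1/p) z * U (1/q) z = poly h z" if "z \<in> sphere 0 1" for z
  proof -
    have "U (1/p + 1/q) z = U (1/p) z * U (1/q) z" using BU' that by blast
    then have "U 1 z = U (1/p) z * U (1/q) z" by (simp only: p(3))
    moreover have "B z * U 1 z = poly h z" using BU' that by blast
    ultimately show ?thesis by (simp only: mult.assoc)
  qed
  have "uniform_limit (sphere 0 1) (\<lambda>n. poly (f n * g n)) (poly h) sequentially"
    using uniform_limit_poly_mult[OF f g] eq uniform_limit_cong'[of "sphere 0 1" "\<lambda>n. poly (f n * g n)"
        "\<lambda>n. poly (f n * g n)" "\<lambda>z. B z * U (1/p) z * U (1/q) z" "poly h" sequentially] by blast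
  then have "(\<lambda>n. functional a (f n * g n)) \<longlonglongrightarrow> functional a h"
    using p K by (intro functional_tendsto_uniform_limit[OF Kp]) auto
  moreover have "(\<lambda>n. poly_norm p (f n)) \<longlonglongrightarrow> Lp_norm p (\<lambda>z. B z * U (1/p) z)"
    "(\<lambda>n. poly_norm q (g n)) \<longlonglongrightarrow> Lp_norm q (U (1/q))"
    using p f g by (auto intro!: poly_norm_tendsto_uniform_limit)
  ultimately have "norm (functional a h) \<le> K * Lp_norm p (\<lambda>z. B z * U (1/p) z) * Lp_norm q (U (1/q))"
    using bound by (intro tendsto_le[OF _ tendsto_mult[OF tendsto_mult[OF tendsto_const]] tendsto_norm]) auto
  also have "Lp_norm p (\<lambda>z. B z * U (1/p) z) = poly_norm 1 h powr (1/p)"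
  proof -
    have "(LINT z|circle. norm (B z * U (1/p) z) powr p) = (LINT z|circle. norm (poly h z) powr 1)"
      using BU' p by (intro Bochner_Integration.integral_cong) (auto simp: norm_mult powr_powr)
    then show ?thesis by (simp add: Lp_norm_def powr_powr integral_nonneg_AE)
  qed
  also have "Lp_norm q (U (1/q)) = poly_norm 1 h powr (1/q)"
  proof -
    have "(LINT z|circle. norm (U (1/q) z) powr q) = (LINT z|circle. norm (poly h z) powr 1)"
      using BU' p by (intro Bochner_Integration.integral_cong) (auto simp: norm_mult powr_powr)
    then show ?thesis by (simp add: Lp_norm_def powr_powr integral_nonneg_AE)
  qed
  also have "K * poly_norm 1 h powr (1/p) * poly_norm 1 h powr (1/q) = K * poly_norm 1 h"
    using p by (simp add: mult.assoc flip: powr_add)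
  finally show "norm (functional a h) \<le> K * poly_norm 1 h" .
qed auto

text \<open>
  Bounds norms of lower order by norms of order \<open>t\<close> when the latter are at most 2, with a crude
  constant in place of a further use of Hoelder's inequality.
\<close>

lemma poly_norm_le_of_powr_bound:
  assumes s: "1 \<le> s" and t: "1 \<le> t" and c: "0 \<le> c"
    and X: "\<And>z. norm z = 1 \<Longrightarrow> norm (poly X z) \<le> c * M z"
    and M: "\<And>z. norm z = 1 \<Longrightarrow> 0 \<le> M z \<and> M z powr s \<le> 1 + norm (poly x z) powr t + norm (poly y z) powr t
        + norm (poly u z) powr t"
    and nrm: "poly_norm t x \<le> 2" "poly_norm t y \<le> 2" "poly_norm t u \<le> 2"
  shows "poly_norm s X \<le> c * (1 + 3 * 2 powr t)"
proof (rule Lp_norm_le)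
  have i: "integrable circle (\<lambda>z. norm (poly h z) powr t)" for h :: "complex poly"
    using LpD(2)[OF poly_Lp[of t h]] t by simp
  have le: "(LINT z|circle. norm (poly h z) powr t) \<le> 2 powr t" if "poly_norm t h \<le> 2" for h :: "complex poly"
    using that t by (subst Lp_norm_powr[symmetric]) (auto intro!: powr_mono2)
  have "(LINT z|circle. norm (poly X z) powr s) \<le> (LINT z|circle. c powr s * (1 + norm (poly x z) powr t
      + norm (poly y z) powr t + norm (poly u z) powr t))"
  proof (rule integral_mono)
    show "integrable circle (\<lambda>z. norm (poly X z) powr s)" using LpD(2)[OF poly_Lp[of s X]] s by simp
    show "integrable circle (\<lambda>z. c powr s * (1 + norm (poly x z) powr t + norm (poly y z) powr t
        + norm (poly u z) powr t))"
      by (intro integrable_mult_right Bochner_Integration.integrable_add i) auto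
    fix z assume "z \<in> space circle"
    then have z: "norm z = 1" by simp
    have "norm (poly X z) powr s \<le> (c * M z) powr s" using X[OF z] s by (intro powr_mono2) auto
    also have "\<dots> = c powr s * M z powr s" by (rule powr_mult)
    also have "\<dots> \<le> c powr s * (1 + norm (poly x z) powr t + norm (poly y z) powr t + norm (poly u z) powr t)"
      using M[OF z] by (intro mult_left_mono) auto
    finally show "norm (poly X z) powr s \<le> c powr s * (1 + norm (poly x z) powr t + norm (poly y z) powr t
        + norm (poly u z) powr t)" .
  qed
  also have "\<dots> = c powr s * (1 + (LINT z|circle. norm (poly x z) powr t)
      + (LINT z|circle. norm (poly y z) powr t) + (LINT z|circle. norm (poly u z) powr t))"
    using i circle.prob_space by (simp add: Bochner_Integration.integral_add)
  also have "\<dots> \<le> c powr s * (1 + 3 * 2 powr t)"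
    using le[OF nrm(1)] le[OF nrm(2)] le[OF nrm(3)] by (intro mult_left_mono) auto
  also have "\<dots> \<le> c powr s * (1 + 3 * 2 powr t) powr s"
    using s powr_mono[of 1 s "1 + 3 * 2 powr t"] by (intro mult_left_mono) auto
  also have "\<dots> = (c * (1 + 3 * 2 powr t)) powr s" by (rule powr_mult[symmetric])
  finally show "(LINT z|circle. norm (poly X z) powr s) \<le> (c * (1 + 3 * 2 powr t)) powr s" .
qed (use s c in auto)

lemma powr_le_one_plus_powr:
  fixes x s t :: real
  assumes "0 \<le> x" "0 \<le> s" "s \<le> t"
  shows "x powr s \<le> 1 + x powr t"
proof (cases "x \<le> 1")
  case True
  then have "x powr s \<le> 1" using assms by (intro powr_le1) auto
  then show ?thesis by (simp add: add_increasing2)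
next
  case False
  then have "x powr s \<le> x powr t" using assms by (intro powr_mono) auto
  then show ?thesis by simp
qed

text \<open>
  With \<open>R\<close> the rotation, the difference for the product \<open>b v^(m-1)\<close> is a sum of terms
  \<open>X (b - R b)\<close> and \<open>X (v - R v)\<close>. Each cofactor \<open>X\<close> is a sum of products of \<open>m - 1\<close> factors that are
  bounded in the norm of order \<open>m p\<close>, hence bounded in \<open>L^p\<close>; the other factors are bounded in \<open>L^q\<close> since
  \<open>q \<le> m p\<close>.
\<close>

lemma telescoped_product_bound:
  fixes p q \<epsilon> :: real and m :: nat
  assumes p: "1 < p" "1 < q" and m: "0 < m" "q \<le> real m * p" and w: "norm w = 1" and \<epsilon>: "0 \<le> \<epsilon>"
    and bound: "\<And>f g. norm (functional a (f * (g - dilate w g))) \<le> \<epsilon> * poly_norm p f * poly_norm q g"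
    and b: "poly_norm (real m * p) b \<le> 2" and v: "poly_norm (real m * p) v \<le> 2"
  defines "C \<equiv> real m * (1 + 3 * 2 powr (real m * p))"
  shows "norm (functional a (b * v ^ (m - 1) - dilate w (b * v ^ (m - 1)))) \<le> \<epsilon> * (2 * C\<^sup>2)"
proof -
  define t where "t = real m * p"
  define k where "k = m - 1"
  have mk: "m = Suc k" using m by (simp add: k_def)
  have t: "1 \<le> t" using p m mult_mono[of 1 "real m" 1 p] by (simp add: t_def)
  have qt: "q \<le> t" using m by (simp add: t_def)
  have kp: "real k * p \<le> t" using p by (simp add: t_def mk algebra_simps)
  let ?R = "dilate w"
  have Rb: "poly_norm t (?R b) \<le> 2" and Rv: "poly_norm t (?R v) \<le> 2"
    using b v t by (auto simp: poly_norm_rotation[OF w] t_def)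
  have bv: "poly_norm t b \<le> 2" "poly_norm t v \<le> 2" using b v by (auto simp: t_def)
  have C: "1 * (1 + 3 * 2 powr t) \<le> C" unfolding C_def t_def[symmetric] using m by (intro mult_right_mono) auto
  have nq: "poly_norm q h \<le> C" if "poly_norm t h \<le> 2" for h
  proof -
    have *: "norm (poly h z) powr q \<le> 1 + norm (poly h z) powr t + norm (poly h z) powr t
        + norm (poly h z) powr t" for z
      using powr_le_one_plus_powr[OF norm_ge_zero _ qt, of "poly h z"] powr_ge_zero[of
          "norm (poly h z)" t] p by linarith
    have "poly_norm q h \<le> 1 * (1 + 3 * 2 powr t)"
      using that p t *
      by (intro poly_norm_le_of_powr_bound[of q t 1 h "\<lambda>z. norm (poly h z)" h h h]) auto
    then show ?thesis using C by linarith
  qed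
  define M where "M z = max (norm (poly (?R b) z)) (max (norm (poly v z)) (norm (poly (?R v) z)))" for z
  have M0: "0 \<le> M z" for z by (simp add: M_def le_max_iff_disj)
  have Mp: "(M z ^ k) powr p \<le> 1 + norm (poly (?R b) z) powr t + norm (poly v z) powr t
      + norm (poly (?R v) z) powr t" for z
  proof -
    have "(M z ^ k) powr p \<le> 1 + M z powr t"
    proof (cases "M z = 0")
      case True
      then show ?thesis using p t by (cases k) auto
    next
      case False
      then have "(M z ^ k) powr p = M z powr (real k * p)" using M0[of z] by
          (simp add: powr_powr flip: powr_realpow)
      also have "\<dots> \<le> 1 + M z powr t" using M0[of z] p kp by (intro powr_le_one_plus_powr) auto
      finally show ?thesis .
    qed
    also have "M z powr t \<le> norm (poly (?R b) z) powr t + norm (poly v z) powr t + norm (poly (?R v) z) powr t"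
      unfolding M_def by (simp add: max_def)
    finally show ?thesis by simp
  qed
  have X: "poly_norm p X \<le> C" if "\<And>z. norm z = 1 \<Longrightarrow> norm (poly X z) \<le> real m * M z ^ k" for X
    unfolding C_def t_def[symmetric]
    by (rule poly_norm_le_of_powr_bound[of p t "real m" X "\<lambda>z. M z ^ k" "?R b" v "?R v"])
       (use p t m that Mp M0 Rb Rv bv in auto)
  have X1: "poly_norm p (v ^ k) \<le> C"
  proof (rule X)
    fix z :: complex
    have "norm (poly (v ^ k) z) \<le> M z ^ k" by (auto simp: M_def norm_power intro!: power_mono)
    also have "\<dots> \<le> real m * M z ^ k" using mult_right_mono[of 1 "real m" "M z ^ k"] m M0[of z] by simp
    finally show "norm (poly (v ^ k) z) \<le> real m * M z ^ k" .
  qed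
  define Y where "Y = ?R b * (\<Sum>i<k. (?R v) ^ (k - Suc i) * v ^ i)"
  have X2: "poly_norm p Y \<le> C"
  proof (rule X)
    fix z :: complex
    have 1: "norm (poly (?R b) z) \<le> M z" "norm (poly v z) \<le> M z" "norm (poly (?R v) z) \<le> M z" by
        (auto simp: M_def)
    show "norm (poly Y z) \<le> real m * M z ^ k"
    proof (cases k)
      case 0
      then show ?thesis by (simp add: Y_def)
    next
      case (Suc j)
      have "norm (poly (\<Sum>i<k. (?R v) ^ (k - Suc i) * v ^ i) z) \<le> (\<Sum>i<k. M z ^ j)"
        unfolding poly_sum
      proof (intro sum_norm_le)
        fix i assume i: "i \<in> {..<k}"
        have "norm (poly ((?R v) ^ (k - Suc i) * v ^ i) z) \<le> M z ^ (k - Suc i) * M z ^ i"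
          unfolding poly_mult poly_power norm_mult norm_power using 1 M0[of z]
              by (intro mult_mono power_mono) auto
        also have "\<dots> = M z ^ j" using i Suc by (simp flip: power_add)
        finally show "norm (poly ((?R v) ^ (k - Suc i) * v ^ i) z) \<le> M z ^ j" .
      qed
      then have "norm (poly Y z) \<le> M z * (real k * M z ^ j)"
        unfolding Y_def poly_mult norm_mult using 1 M0[of z] by (intro mult_mono) auto
      also have "\<dots> = real k * M z ^ k" by (simp add: Suc)
      also have "\<dots> \<le> real m * M z ^ k" using M0[of z] by (intro mult_right_mono) (auto simp: mk)
      finally show ?thesis .
    qed
  qed
  have "v ^ k - (?R v) ^ k = (v - ?R v) * (\<Sum>i<k. (?R v) ^ (k - Suc i) * v ^ i)"
    by (rule power_diff_sumr2)
  then have "Y * (v - ?R v) = ?R b * (v ^ k - (?R v) ^ k)"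
    by (simp only: Y_def mult.assoc mult.commute mult.left_commute)
  then have split: "b * v ^ (m - 1) - ?R (b * v ^ (m - 1)) = v ^ k * (b - ?R b) + Y * (v - ?R v)"
    unfolding k_def[symmetric] dilate_mult dilate_power by (simp only:) (simp add: algebra_simps)
  have C0: "0 \<le> C" by (simp add: C_def)
  have "norm (functional a (b * v ^ (m - 1) - ?R (b * v ^ (m - 1))))
      \<le> norm (functional a (v ^ k * (b - ?R b))) + norm (functional a (Y * (v - ?R v)))"
    unfolding split functional_add by (rule norm_triangle_ineq)
  also have "\<dots> \<le> \<epsilon> * poly_norm p (v ^ k) * poly_norm q b + \<epsilon> * poly_norm p Y * poly_norm q v"
    by (intro add_mono bound)
  also have "\<dots> \<le> \<epsilon> * C * C + \<epsilon> * C * C"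
    using X1 X2 nq bv \<epsilon> C0 by (intro add_mono mult_mono) auto
  finally show ?thesis by (simp add: power2_eq_square algebra_simps)
qed

text \<open>
  Moves the smallness from the exponent \<open>q\<close> to the exponent \<open>p\<close>: a zero-free \<open>f = B u\<close> with norm 1 is
  the product of \<open>B u^(1/m)\<close> and of \<open>m - 1\<close> copies of \<open>u^(1/m)\<close>, all of norm 1 in the space of order
  \<open>m p\<close>.
\<close>

theorem functional_rotation_bound:
  fixes p q \<epsilon> :: real and m :: nat
  assumes p: "1 < p" "1 < q" and m: "0 < m" "q \<le> real m * p" and w: "norm w = 1" and \<epsilon>: "0 \<le> \<epsilon>"
    and K: "0 \<le> K" "\<And>f. norm (functional a f) \<le> K * poly_norm p f"
    and bound: "\<And>f g. norm (functional a (f * (g - dilate w g))) \<le> \<epsilon> * poly_norm p f * poly_norm q g"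
  shows "norm (functional a (f - dilate w f)) \<le> \<epsilon> * (2 * (real m * (1
      + 3 * 2 powr (real m * p)))\<^sup>2) * poly_norm p f"
proof -
  define C where "C = 2 * (real m * (1 + 3 * 2 powr (real m * p)))\<^sup>2"
  define b where "b i = a i * (1 - w ^ i)" for i
  have fb: "functional a (f - dilate w f) = functional b f" for f
  proof -
    show ?thesis unfolding functional_diff functional_dilate functional_def[of a f] functional_def[of b f] b_def
      by (simp add: algebra_simps sum_subtractf)
  qed
  have p0: "0 < p" using p by simp
  have Kb: "norm (functional b f) \<le> (2 * K) * poly_norm p f" for f
  proof -
    have "norm (functional b f) \<le> norm (functional a f) + norm (functional a (dilate w f))"
      by (simp add: functional_diff norm_triangle_ineq4 flip: fb)
    also have "\<dots> \<le> K * poly_norm p f + K * poly_norm p (dilate w f)" by (intro add_mono K)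
    finally show ?thesis by (simp add: poly_norm_rotation[OF w p0])
  qed
  have "norm (functional b f) \<le> \<epsilon> * C * poly_norm p f"
  proof (rule functional_bound_of_zero_free)
    fix f :: "complex poly" assume nz: "\<And>z. norm z = 1 \<Longrightarrow> poly f z \<noteq> 0"
    have unit: "norm (functional b f) \<le> \<epsilon> * C" if nrm: "poly_norm p f = 1" and nz: "\<And>z. norm z = 1
        \<Longrightarrow> poly f z \<noteq> 0" for f
    proof -
      obtain B U where BU: "inner_outer (poly f) B U" using poly_inner_outer[of f] nz by blast
      note BU' = BU[unfolded inner_outer_def]
      define V where "V = U (1 / real m)"
      have dV: "disc_algebra V" "disc_algebra (\<lambda>z. B z * V z)" unfolding V_def using BU' by
          (auto intro: disc_algebra_mult)
      then obtain g v where g: "uniform_limit (sphere 0 1) (\<lambda>n. poly (g n)) (\<lambda>z. B z * V z) sequentially"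
        and v: "uniform_limit (sphere 0 1) (\<lambda>n. poly (v n)) V sequentially"
        unfolding disc_algebra_def by metis
      have vk: "uniform_limit (sphere 0 1) (\<lambda>n. poly (g n * v n ^ k)) (\<lambda>z. B z * V z * V z ^ k)
          sequentially" for k
      proof (induction k)
        case (Suc k)
        from uniform_limit_poly_mult[OF Suc v] show ?case by (simp only: power_Suc2 mult.assoc)
      qed (use g in simp)
      have eq: "B z * V z * V z ^ (m - 1) = poly f z" if "z \<in> sphere 0 1" for z
      proof -
        have "V z * V z ^ (m - 1) = U 1 z" using inner_outer_power[OF BU _ m(1), of z "1 / real m"] that m(1)
          by (simp add: V_def flip: power_Suc)
        then show ?thesis using BU' that by (simp add: mult.assoc)
      qed
      have lim: "uniform_limit (sphere 0 1) (\<lambda>n. poly (g n * v n ^ (m - 1))) (poly f) sequentially"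
        using vk[of "m-1"] eq uniform_limit_cong'[of "sphere 0 1" "\<lambda>n. poly (g n * v n ^ (m-1))"
            "\<lambda>n. poly (g n * v n ^ (m-1))" "\<lambda>z. B z * V z * V z ^ (m-1)" "poly f" sequentially] by blast
      have "Lp_norm (real m * p) V = 1" "Lp_norm (real m * p) (\<lambda>z. B z * V z) = 1"
      proof -
        have 1: "(LINT z|circle. norm (poly f z) powr p) = 1" using nrm Lp_norm_powr[OF p0, of "poly f"] by simp
        have "(LINT z|circle. norm (V z) powr (real m * p)) = (LINT z|circle. norm (poly f z) powr p)"
          using BU' m(1) by (intro Bochner_Integration.integral_cong) (auto simp: V_def powr_powr)
        moreover have "(LINT z|circle. norm (B z * V z) powr (real m * p))
            = (LINT z|circle. norm (poly f z) powr p)"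
          using BU' m(1) by (intro Bochner_Integration.integral_cong) (auto simp: V_def norm_mult powr_powr)
        ultimately show "Lp_norm (real m * p) V = 1" "Lp_norm (real m * p) (\<lambda>z. B z * V z) = 1"
          by (simp_all add: Lp_norm_def 1)
      qed
      moreover have mp: "1 \<le> real m * p" using p m mult_mono[of 1 "real m" 1 p] by simp
      ultimately have gv: "(\<lambda>n. poly_norm (real m * p) (g n)) \<longlonglongrightarrow> 1" "(\<lambda>n. poly_norm (real m * p) (v n)) \<longlonglongrightarrow> 1"
        using poly_norm_tendsto_uniform_limit[OF mp g] poly_norm_tendsto_uniform_limit[OF mp v] by auto
      then have "\<forall>\<^sub>F n in sequentially. poly_norm (real m * p) (g n) < 2"
          "\<forall>\<^sub>F n in sequentially. poly_norm (real m * p) (v n) < 2"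
        using order_tendstoD(2)[OF gv(1), of 2] order_tendstoD(2)[OF gv(2), of 2] by simp_all
      then have ev: "\<forall>\<^sub>F n in sequentially. norm (functional b (g n * v n ^ (m - 1))) \<le> \<epsilon> * C"
        by eventually_elim (unfold fb[symmetric] C_def, rule telescoped_product_bound[OF p m w \<epsilon> bound], auto)
      have "(\<lambda>n. functional b (g n * v n ^ (m - 1))) \<longlonglongrightarrow> functional b f"
        using K by (intro functional_tendsto_uniform_limit[OF Kb _ p0 lim]) auto
      then show ?thesis by (intro tendsto_upperbound[OF tendsto_norm ev]) auto
    qed
    show "norm (functional b f) \<le> \<epsilon> * C * poly_norm p f"
    proof (cases "poly_norm p f = 0")
      case True
      then show ?thesis using Kb[of f] by simp
    next
      case False
      define c where "c = complex_of_real (1 / poly_norm p f)"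
      have c: "norm c = 1 / poly_norm p f" unfolding c_def by (simp only: norm_of_real) simp
      have "poly_norm p (smult c f) = 1" using False p0 by (simp add: poly_norm_smult c)
      moreover have "poly (smult c f) z \<noteq> 0" if "norm z = 1" for z using nz[OF that] False by (simp add: c_def)
      ultimately have "norm (functional b (smult c f)) \<le> \<epsilon> * C" by (rule unit)
      then show ?thesis using False by (simp add: functional_smult norm_mult c field_simps less_le)
    qed
  qed (use p in auto)
  then show ?thesis by (simp add: fb C_def)
qed

section \<open>Extension to negative frequencies\<close>

text \<open>
  The functional with coefficients \<open>a\<close> has norm at most \<open>C\<close> in the dual of \<open>H^1\<close>.
\<close>

definition L1_bounded :: "real \<Rightarrow> (nat \<Rightarrow> complex) \<Rightarrow> bool" where
  "L1_bounded C a \<longleftrightarrow> (\<forall>h. norm (functional a h) \<le> C * poly_norm 1 h)"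

text \<open>
  The one-dimensional step of the Hahn--Banach theorem. For \<open>x\<close> and \<open>y\<close> in \<open>X\<close>, subadditivity gives
  \<open>u y - N (y - v) \<le> N (x + v) - u x\<close>, and any \<open>r\<close> between the two sides works.
\<close>

lemma hahn_banach_real_step:
  fixes N u :: "complex poly \<Rightarrow> real"
  assumes N_add: "\<And>f g. N (f + g) \<le> N f + N g" and N_scale: "\<And>t f. N (smult (of_real t) f) = \<bar>t\<bar> * N f"
    and u_add: "\<And>f g. u (f + g) = u f + u g" and u_scale: "\<And>t f. u (smult (of_real t) f) = t * u f"
    and X: "0 \<in> X" "\<And>f g. f \<in> X \<Longrightarrow> g \<in> X \<Longrightarrow> f + g \<in> X" "\<And>t f. f \<in> X \<Longrightarrow> smult (of_real t) f \<in> X"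
    and le: "\<And>f. f \<in> X \<Longrightarrow> u f \<le> N f"
  shows "\<exists>r. \<forall>x\<in>X. \<forall>t. u x + t * r \<le> N (x + smult (of_real t) v)"
proof -
  have key: "u y - N (y - v) \<le> N (x + v) - u x" if "x \<in> X" "y \<in> X" for x y
  proof -
    have "u x + u y = u (x + y)" by (simp add: u_add)
    also have "\<dots> \<le> N (x + y)" using that by (intro le X)
    also have "x + y = (x + v) + (y - v)" by simp
    also have "N \<dots> \<le> N (x + v) + N (y - v)" by (rule N_add)
    finally show ?thesis by simp
  qed
  define r where "r = (SUP y\<in>X. u y - N (y - v))"
  have bdd: "bdd_above ((\<lambda>y. u y - N (y - v)) ` X)" using key[OF X(1)] by (intro bdd_aboveI2)
  have r1: "u y - N (y - v) \<le> r" if "y \<in> X" for y unfolding r_def using that bdd by (rule cSUP_upper)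
  have r2: "r \<le> N (x + v) - u x" if "x \<in> X" for x unfolding r_def using X(1) key[OF that]
      by (intro cSUP_least) auto
  have "u x + t * r \<le> N (x + smult (of_real t) v)" if x: "x \<in> X" for x t
  proof -
    consider "t = 0" | "t > 0" | "t < 0" by linarith
    then show ?thesis
    proof cases
      case 1
      then show ?thesis using le[OF x] by simp
    next
      case 2
      have "u x + t * r = t * (u (smult (of_real (1/t)) x) + r)" unfolding u_scale using 2 by
          (simp add: field_simps)
      also have "\<dots> \<le> t * N (smult (of_real (1/t)) x + v)"
        using r2[OF X(3)[OF x, of "1/t"]] 2 by (intro mult_left_mono) auto
      also have "\<dots> = N (smult (of_real t) (smult (of_real (1/t)) x + v))" unfolding N_scale using 2 by simp
      also have "smult (of_real t) (smult (of_real (1/t)) x + v) = x + smult (of_real t) v" using 2 by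
          (simp add: smult_add_right)
      finally show ?thesis .
    next
      case 3
      define s where "s = - t"
      have s: "s > 0" "t = - s" using 3 by (auto simp: s_def)
      have "u x + t * r = s * (u (smult (of_real (1/s)) x) - r)" unfolding u_scale using s by
          (simp add: field_simps)
      also have "\<dots> \<le> s * N (smult (of_real (1/s)) x - v)"
        using r1[OF X(3)[OF x, of "1/s"]] s by (intro mult_left_mono) auto
      also have "\<dots> = N (smult (of_real s) (smult (of_real (1/s)) x - v))" unfolding N_scale using s by simp
      also have "smult (of_real s) (smult (of_real (1/s)) x - v) = x + smult (of_real t) v" using s by
          (simp add: smult_diff_right)
      finally show ?thesis .
    qed
  qed
  then show ?thesis by blast
qed

lemma functional_Suc: "functional (case_nat c a) f = c * coeff f 0 + functional (case_nat 0 a) f"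
  by (simp add: functional_altdef[of f "degree f"] sum.atMost_shift)

lemma functional_pCons: "functional (case_nat 0 a) (pCons c f) = functional a f"
proof -
  have "functional (case_nat 0 a) (pCons c f) = (\<Sum>i\<le>Suc (degree f). case_nat 0 a i * coeff (pCons c f) i)"
    by (rule functional_altdef[OF degree_pCons_le])
  also have "\<dots> = functional a f" unfolding functional_def by (subst sum.atMost_Suc_shift) simp
  finally show ?thesis .
qed

text \<open>
  Multiplication by \<open>z\<close> preserves the \<open>L^1\<close> norm on the circle, so \<open>a\<close> defines a bounded functional on
  the multiples of \<open>z\<close>. A Hahn--Banach extension to all polynomials assigns a value \<open>c\<close> to the
  constant 1. Over the complex numbers this takes two real steps, in the directions \<open>1\<close> and \<open>\<i>\<close>;
  the bound for the real part then gives the bound for the modulus after multiplication by a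
  unimodular constant.
\<close>

lemma L1_bounded_extend:
  assumes "L1_bounded C a" and C: "0 \<le> C"
  shows "\<exists>c. L1_bounded C (case_nat c a)"
proof -
  define N where "N h = C * poly_norm 1 h" for h
  define u where "u f = Re (functional (case_nat 0 a) f)" for f
  have N_add: "N (f + g) \<le> N f + N g" for f g
    using mult_left_mono[OF poly_norm_triangle[of 1 f g] C] by (simp add: N_def distrib_left)
  have N_scale: "N (smult (of_real t) f) = \<bar>t\<bar> * N f" for t f by (simp add: N_def poly_norm_smult)
  have u_add: "u (f + g) = u f + u g" for f g by (simp add: u_def functional_add)
  have u_scale: "u (smult (of_real t) f) = t * u f" for t f by (simp add: u_def functional_smult)
  have le1: "u f \<le> N f" if "coeff f 0 = 0" for f
  proof -
    obtain c h where "f = pCons c h" by (rule pCons_cases)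
    with that have f: "f = pCons 0 h" by simp
    have "u f \<le> norm (functional a h)" by (simp add: u_def f functional_pCons complex_Re_le_cmod)
    also have "\<dots> \<le> C * poly_norm 1 h" using assms(1) by (simp add: L1_bounded_def)
    also have "poly_norm 1 h = poly_norm 1 f" by (intro Lp_norm_cong) (simp add: f norm_mult)
    finally show ?thesis by (simp add: N_def)
  qed
  obtain r1 where r1: "\<forall>x\<in>{f. coeff f 0 = 0}. \<forall>t. u x + t * r1 \<le> N (x + smult (of_real t) 1)"
    using hahn_banach_real_step[of N u "{f. coeff f 0 = 0}" 1] N_add N_scale u_add u_scale le1 by auto
  define u2 where "u2 f = u f + Re (coeff f 0) * r1" for f
  have le2: "u2 f \<le> N f" if "Im (coeff f 0) = 0" for f
  proof -
    have "u (f - [:coeff f 0:]) + Re (coeff f 0) * r1 \<le> N ((f - [:coeff f 0:])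
        + smult (of_real (Re (coeff f 0))) 1)"
      using r1 by simp
    moreover have "smult (of_real (Re (coeff f 0))) 1 = [:coeff f 0:]"
      using that by (simp add: complex_eq_iff one_pCons)
    moreover have "u (f - [:coeff f 0:]) = u f" by (simp add: u_def functional_diff functional_pCons)
    ultimately show ?thesis by (simp add: u2_def)
  qed
  have u2_add: "u2 (f + g) = u2 f + u2 g" for f g by (simp add: u2_def u_add algebra_simps)
  have u2_scale: "u2 (smult (of_real t) f) = t * u2 f" for t f by (simp add: u2_def u_scale algebra_simps)
  obtain r2 where r2: "\<forall>x\<in>{f. Im (coeff f 0) = 0}. \<forall>t. u2 x + t * r2 \<le> N (x + smult (of_real t) [:\<i>:])"
    using hahn_banach_real_step[of N u2 "{f. Im (coeff f 0) = 0}" "[:\<i>:]"] N_add N_scale u2_add u2_scale le2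
        by auto
  \<comment> \<open>The sign of the imaginary part makes \<open>Re (c * x)\<close> equal to \<open>r1 * Re x + r2 * Im x\<close>.\<close>
  define c where "c = Complex r1 (- r2)"
  have Re_le: "Re (functional (case_nat c a) f) \<le> N f" for f
  proof -
    let ?g = "f - [:\<i> * of_real (Im (coeff f 0)):]"
    have "u2 ?g + Im (coeff f 0) * r2 \<le> N (?g + smult (of_real (Im (coeff f 0))) [:\<i>:])"
      using r2 by simp
    also have "?g + smult (of_real (Im (coeff f 0))) [:\<i>:] = f" by (simp add: mult.commute)
    also have "u2 ?g = u f + Re (coeff f 0) * r1" by (simp add: u2_def u_def functional_diff functional_pCons)
    finally show ?thesis by (subst functional_Suc) (simp add: c_def u_def mult.commute)
  qed
  have "norm (functional (case_nat c a) f) \<le> C * poly_norm 1 f" for f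
  proof (cases "functional (case_nat c a) f = 0")
    case False
    define Z where "Z = functional (case_nat c a) f"
    define e where "e = cnj Z / norm Z"
    have e: "norm e = 1" using False by (simp add: e_def Z_def norm_divide)
    have "e * Z = of_real (norm Z)" using False complex_norm_square[of Z] by
        (simp add: e_def Z_def power2_eq_square field_simps)
    then have "norm Z = Re (functional (case_nat c a) (smult e f))" by (simp add: functional_smult Z_def)
    also have "\<dots> \<le> N (smult e f)" by (rule Re_le)
    also have "\<dots> = C * poly_norm 1 f" by (simp add: N_def poly_norm_smult e)
    finally show ?thesis by (simp add: Z_def)
  qed (use C in auto)
  then show ?thesis by (auto simp: L1_bounded_def)
qed

lemma L1_bounded_extend_many:
  assumes "L1_bounded C a" "0 \<le> C"
  shows "\<exists>b. L1_bounded C b \<and> (\<forall>n. b (n + m) = a n)"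
proof (induction m)
  case 0
  then show ?case using assms by auto
next
  case (Suc m)
  then obtain b where b: "L1_bounded C b" "\<forall>n. b (n + m) = a n" by blast
  obtain c where "L1_bounded C (case_nat c b)" using L1_bounded_extend[OF b(1) assms(2)] by blast
  then show ?case using b(2) by (intro exI[of _ "case_nat c b"]) auto
qed

definition dirichlet :: "nat \<Rightarrow> complex poly" where
  "dirichlet n = (\<Sum>i<n. monom 1 i)"

lemma coeff_dirichlet: "coeff (dirichlet n) i = (if i < n then 1 else 0)"
  by (simp add: dirichlet_def coeff_sum)

lemma integral_norm_dirichlet_sq: "(LINT z|circle. (norm (poly (dirichlet n) z))\<^sup>2) = real n"
proof -
  have "complex_of_real (LINT z|circle. (norm (poly (dirichlet n) z))\<^sup>2)
      = (LINT z|circle. complex_of_real ((norm (poly (dirichlet n) z))\<^sup>2))"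
    by (rule integral_complex_of_real[symmetric])
  also have "\<dots> = (LINT z|circle. (\<Sum>i<n. \<Sum>j<n. z ^ i * cnj z ^ j))"
    unfolding complex_norm_square by (simp add: dirichlet_def poly_sum poly_monom sum_product)
  also have "\<dots> = (\<Sum>i<n. \<Sum>j<n. LINT z|circle. z ^ i * cnj z ^ j)"
    by (subst Bochner_Integration.integral_sum)
       (auto intro!: integrable_circle_continuous continuous_intros sum.cong Bochner_Integration.integral_sum)
  also have "\<dots> = of_real (real n)" by (simp add: integral_power_circle)
  finally show ?thesis using of_real_eq_iff by blast
qed

text \<open>
  The product of two Dirichlet kernels of lengths \<open>A\<close> and \<open>2 A\<close>, divided by \<open>A\<close>, has a plateau of
  coefficients 1. By the inequality of the means and Parseval's identity its \<open>L^1\<close> norm is at most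
  \<open>(A + 2 A) / (2 A)\<close>.
\<close>

lemma trapezoid_kernel:
  obtains v :: "complex poly" where "\<And>i. M \<le> i \<Longrightarrow> i \<le> 2 * M \<Longrightarrow> coeff v i = 1" "poly_norm 1 v \<le> 3/2"
proof
  define A where "A = Suc M"
  define v where "v = smult (1 / of_nat A) (dirichlet A * dirichlet (2 * A))"
  show "coeff v i = 1" if "M \<le> i" "i \<le> 2 * M" for i
  proof -
    have "coeff (dirichlet A * dirichlet (2 * A)) i = (\<Sum>j\<le>i. if j < A then 1 else 0)"
      unfolding coeff_mult using that by (intro sum.cong) (auto simp: coeff_dirichlet A_def)
    also have "\<dots> = of_nat (card ({..i} \<inter> {..<A}))" by (simp add: sum.If_cases lessThan_def)
    also have "{..i} \<inter> {..<A} = {..<A}" using that by (auto simp: A_def)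
    finally show ?thesis by (simp add: v_def A_def del: of_nat_Suc)
  qed
  have "(LINT z|circle. norm (poly v z) powr 1) \<le> (LINT z|circle. 1 / (2 * real A) * ((norm (poly (dirichlet
      A) z))\<^sup>2 + (norm (poly (dirichlet (2 * A)) z))\<^sup>2))"
  proof (intro integral_mono integrable_circle_continuous)
    fix z
    have "norm (poly v z) = 1 / real A * (norm (poly (dirichlet A) z) * norm (poly (dirichlet (2 * A)) z))"
      by (simp add: v_def norm_mult norm_divide)
    also have "\<dots> \<le> 1 / real A * (((norm (poly (dirichlet A) z))\<^sup>2 + (norm (poly (dirichlet (2 * A)) z))\<^sup>2) / 2)"
      using sum_squares_bound[of "norm (poly (dirichlet A) z)" "norm (poly (dirichlet (2 * A)) z)"]
      by (intro mult_left_mono) auto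
    finally show "norm (poly v z) powr 1 \<le> 1 / (2 * real A) * ((norm (poly (dirichlet A) z))\<^sup>2
        + (norm (poly (dirichlet (2 * A)) z))\<^sup>2)"
      by simp
  qed (auto intro!: continuous_intros simp: A_def)
  also have "\<dots> = 1 / (2 * real A) * (real A + real (2 * A))"
    by (subst integral_mult_right_zero, subst Bochner_Integration.integral_add)
       (auto simp: integral_norm_dirichlet_sq intro!: integrable_circle_continuous continuous_intros)
  also have "\<dots> = (3/2) powr 1" by (simp add: A_def field_simps)
  finally show "poly_norm 1 v \<le> 3/2" by (intro Lp_norm_le) auto
qed

text \<open>
  After an extension to \<open>M\<close> negative frequencies, the functional is evaluated at the rotations of the
  trapezoidal kernel. The values form a trigonometric polynomial bounded by \<open>3/2 * C\<close>; its
  coefficients at the frequencies \<open>1, ..., M + 1\<close> lie on the plateau and equal \<open>a 0, ..., a M\<close>.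
\<close>

lemma finite_symbol:
  assumes a: "L1_bounded C a" "0 \<le> C" and fin: "\<And>n. M < n \<Longrightarrow> a n = 0"
  shows "\<exists>B. continuous_on (sphere 0 1) B \<and> (\<forall>z\<in>sphere 0 1. norm (B z) \<le> 3/2 * C)
      \<and> (\<forall>n::nat. fourier_coeff B (int n + 1) = a n)"
proof -
  obtain v :: "complex poly" where v: "\<And>i. M \<le> i \<Longrightarrow> i \<le> 2 * M \<Longrightarrow> coeff v i = 1" "poly_norm 1 v \<le> 3/2"
    by (rule trapezoid_kernel[of M]) blast
  obtain b where b: "L1_bounded C b" "\<forall>n. b (n + M) = a n" using L1_bounded_extend_many[OF a] by blast
  define B where "B z = (\<Sum>i\<le>degree v. (b i * coeff v i) * chi (int i - int M + 1) z)" for z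
  have cont: "continuous_on (sphere 0 1) B" unfolding B_def by (intro continuous_intros)
  moreover have "norm (B z) \<le> 3/2 * C" if z: "z \<in> sphere 0 1" for z
  proof -
    have nz: "z \<noteq> 0" using z by auto
    have "B z = chi (1 - int M) z * functional b (dilate z v)"
    proof -
      have "chi (int i - int M + 1) z = chi (1 - int M) z * z ^ i" for i
        using chi_mult[of z "1 - int M" "int i"] z by (simp add: chi_def algebra_simps)
      then show ?thesis by (simp add: B_def functional_dilate sum_distrib_left mult_ac)
    qed
    then have "norm (B z) = norm (functional b (dilate z v))" using z by (simp add: norm_mult)
    also have "\<dots> \<le> C * poly_norm 1 (dilate z v)" using b(1) by (simp add: L1_bounded_def)
    also have "\<dots> = C * poly_norm 1 v" using z by (simp add: poly_norm_rotation)
    also have "\<dots> \<le> C * (3/2)" using v(2) a(2) by (intro mult_left_mono)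
    finally show ?thesis by simp
  qed
  moreover have "fourier_coeff B (int n + 1) = a n" for n
  proof -
    have "fourier_coeff B (int n + 1) = (\<Sum>i\<le>degree v. fourier_coeff (\<lambda>z. (b i * coeff v i) * chi (int i -
        int M + 1) z) (int n + 1))"
      unfolding B_def by (intro fourier_coeff_sum integrable_circle_continuous continuous_intros)
    also have "\<dots> = (\<Sum>i\<le>degree v. if i = n + M then b i * coeff v i else 0)"
      by (intro sum.cong) (auto simp: fourier_coeff_monomial)
    also have "\<dots> = b (n + M) * coeff v (n + M)" by (auto simp: coeff_eq_0)
    also have "\<dots> = a n" using b(2) v(1)[of "n + M"] fin[of n] by (cases "n \<le> M") auto
    finally show ?thesis .
  qed
  ultimately show ?thesis by blast
qed

section \<open>Continuous symbols\<close>

definition fejer_coeffs :: "nat \<Rightarrow> (nat \<Rightarrow> complex) \<Rightarrow> nat \<Rightarrow> complex" where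
  "fejer_coeffs N a i = of_real (fejer_weight N (int i)) * a i"

text \<open>
  The functional with coefficients \<open>a\<close> minus its Fejer mean is an average of the functionals
  \<open>h \<mapsto> functional a (h - dilate w h)\<close> against the Fejer kernel. Those with \<open>w\<close> near 1 are small by
  hypothesis, and the others carry a total mass of order \<open>1 / N\<close>.
\<close>

lemma fejer_coeffs_approximation:
  assumes C: "L1_bounded C a" "0 \<le> C"
    and rot: "\<And>\<epsilon>. \<epsilon> > 0 \<Longrightarrow> \<exists>\<delta>>0. \<forall>w h. norm w = 1 \<longrightarrow> norm (w - 1) < \<delta> \<longrightarrow> norm (functional a (h - dilate w h))
        \<le> \<epsilon> * poly_norm 1 h"
    and \<epsilon>: "\<epsilon> > 0"
  shows "\<exists>N0. \<forall>N\<ge>N0. L1_bounded \<epsilon> (\<lambda>i. a i - fejer_coeffs N a i)"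
proof -
  obtain \<delta> where \<delta>: "\<delta> > 0" "\<And>w h. norm w = 1 \<Longrightarrow> norm (w - 1) < \<delta> \<Longrightarrow> norm (functional a (h - dilate w h))
      \<le> \<epsilon> / 2 * poly_norm 1 h"
    using rot[of "\<epsilon>/2"] \<epsilon> by auto
  have step: "norm (functional a (h - dilate w h)) \<le> (\<epsilon> / 2 + 2 * C / \<delta>\<^sup>2 * (norm (w - 1))\<^sup>2) * poly_norm 1
      h" if w: "norm w = 1" for w h
  proof (cases "norm (w - 1) < \<delta>")
    case True
    have "norm (functional a (h - dilate w h)) \<le> \<epsilon> / 2 * poly_norm 1 h" by (rule \<delta>(2)[OF w True])
    also have "\<dots> \<le> (\<epsilon> / 2 + 2 * C / \<delta>\<^sup>2 * (norm (w - 1))\<^sup>2) * poly_norm 1 h"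
      using C(2) by (intro mult_right_mono) auto
    finally show ?thesis .
  next
    case False
    have "norm (functional a (h - dilate w h)) \<le> norm (functional a h) + norm (functional a (dilate w h))"
      unfolding functional_diff by (rule norm_triangle_ineq4)
    also have "\<dots> \<le> C * poly_norm 1 h + C * poly_norm 1 (dilate w h)"
      using C(1) by (intro add_mono) (auto simp: L1_bounded_def)
    also have "\<dots> = 2 * C * 1 * poly_norm 1 h" using w by (simp add: poly_norm_rotation)
    also have "\<dots> \<le> 2 * C * ((norm (w - 1))\<^sup>2 / \<delta>\<^sup>2) * poly_norm 1 h"
      using False \<delta>(1) C(2) by (intro mult_right_mono mult_left_mono) (auto simp: power_mono)
    also have "\<dots> \<le> (\<epsilon> / 2 + 2 * C / \<delta>\<^sup>2 * (norm (w - 1))\<^sup>2) * poly_norm 1 h"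
      using \<epsilon> by (intro mult_right_mono) auto
    finally show ?thesis .
  qed
  have main: "norm (functional (\<lambda>i. a i - fejer_coeffs N a i) h) \<le> (\<epsilon> / 2
      + 8 * C / \<delta>\<^sup>2 / real N) * poly_norm 1 h" if N: "N > 0" for N h
  proof -
    \<comment> \<open>Enough nodes to integrate all frequencies of \<open>h\<close> without aliasing.\<close>
    define M where "M = N + degree h"
    obtain c :: "nat \<Rightarrow> real" and w :: "nat \<Rightarrow> complex" where cw: "\<And>k. 0 \<le> c k" "\<And>k. norm (w k) = 1"
        "(\<Sum>k<M. c k) = 1"
      "\<And>k. c k * (norm (w k - 1))\<^sup>2 \<le> 4 / (real N * real M)"
      "\<And>n::int. \<bar>n\<bar> + int N \<le> int M \<Longrightarrow> (\<Sum>k<M. of_real (c k) * w k powi n) = of_real (fejer_weight N n)"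
      by (rule fejer_nodes[OF N, of M]) (auto simp: M_def)
    have M0: "M > 0" using N by (simp add: M_def)
    have "functional (\<lambda>i. a i - fejer_coeffs N a i) h = (\<Sum>k<M. of_real (c k) * functional a (h - dilate (w
        k) h))"
    proof -
      have "(\<Sum>k<M. of_real (c k) * functional a (dilate (w k) h)) = (\<Sum>k<M.
          \<Sum>i\<le>degree h. (of_real (c k) * w k ^ i) * (a i * coeff h i))"
        by (simp add: functional_dilate sum_distrib_left mult_ac)
      also have "\<dots> = (\<Sum>i\<le>degree h. (\<Sum>k<M. of_real (c k) * w k ^ i) * (a i * coeff h i))"
        by (subst sum.swap) (simp add: sum_distrib_right)
      also have "\<dots> = (\<Sum>i\<le>degree h. of_real (fejer_weight N (int i)) * (a i * coeff h i))"
      proof (intro sum.cong refl)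
        fix i assume "i \<in> {..degree h}"
        then have "(\<Sum>k<M. of_real (c k) * w k powi (int i)) = of_real (fejer_weight N (int i))"
          by (intro cw(5)) (auto simp: M_def)
        then show "(\<Sum>k<M. of_real (c k) * w k ^ i) * (a i * coeff h i)
            = of_real (fejer_weight N (int i)) * (a i * coeff h i)"
          by simp
      qed
      also have "\<dots> = functional (fejer_coeffs N a) h" by (simp add: functional_def fejer_coeffs_def mult_ac)
      finally have 1: "(\<Sum>k<M. of_real (c k) * functional a (dilate (w k) h))
          = functional (fejer_coeffs N a) h" .
      have "(\<Sum>k<M. complex_of_real (c k)) = 1" using cw(3) by (simp flip: of_real_sum)
      then have "functional a h = (\<Sum>k<M. of_real (c k) * functional a h)" by (simp flip: sum_distrib_right)
      with 1 show ?thesis by (simp add: functional_diff_left functional_diff right_diff_distrib sum_subtractf)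
    qed
    also have "norm \<dots> \<le> (\<Sum>k<M. (c k * (\<epsilon> / 2) + 2 * C / \<delta>\<^sup>2 * (4 / (real N * real M))) * poly_norm 1 h)"
    proof (intro sum_norm_le)
      fix k
      have "norm (of_real (c k) * functional a (h - dilate (w k) h))
          = c k * norm (functional a (h - dilate (w k) h))"
        using cw(1)[of k] by (simp add: norm_mult)
      also have "\<dots> \<le> c k * ((\<epsilon> / 2 + 2 * C / \<delta>\<^sup>2 * (norm (w k - 1))\<^sup>2) * poly_norm 1 h)"
        using cw step by (intro mult_left_mono) auto
      also have "\<dots> = (c k * (\<epsilon> / 2) + 2 * C / \<delta>\<^sup>2 * (c k * (norm (w k - 1))\<^sup>2)) * poly_norm 1 h"
        by (simp add: algebra_simps)
      also have "\<dots> \<le> (c k * (\<epsilon> / 2) + 2 * C / \<delta>\<^sup>2 * (4 / (real N * real M))) * poly_norm 1 h"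
        using cw(4)[of k] C(2) by (intro mult_right_mono add_left_mono mult_left_mono) auto
      finally show "norm (of_real (c k) * functional a (h - dilate (w k) h)) \<le> (c k * (\<epsilon> / 2)
          + 2 * C / \<delta>\<^sup>2 * (4 / (real N * real M))) * poly_norm 1 h" .
    qed
    also have "\<dots> = ((\<Sum>k<M. c k) * (\<epsilon> / 2) + real M * (2 * C / \<delta>\<^sup>2 * (4 / (real N * real M)))) * poly_norm 1 h"
      by (simp only: sum_distrib_right[symmetric] sum.distrib sum_constant card_lessThan mult.assoc)
    also have "\<dots> = (\<epsilon> / 2 + 8 * C / \<delta>\<^sup>2 / real N) * poly_norm 1 h" using M0 N by (simp add: cw(3))
    finally show ?thesis .
  qed
  have "(\<lambda>N. 8 * C / \<delta>\<^sup>2 / real N) \<longlonglongrightarrow> 0" by (rule lim_const_over_n)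
  then have "\<forall>\<^sub>F N in sequentially. 8 * C / \<delta>\<^sup>2 / real N < \<epsilon> / 2"
    using \<epsilon> by (intro order_tendstoD(2)) auto
  then have "\<forall>\<^sub>F N in sequentially. L1_bounded \<epsilon> (\<lambda>i. a i - fejer_coeffs N a i)"
    using eventually_gt_at_top[of 0]
  proof eventually_elim
    case (elim N)
    show ?case unfolding L1_bounded_def
    proof
      fix h
      have "(\<epsilon> / 2 + 8 * C / \<delta>\<^sup>2 / real N) * poly_norm 1 h \<le> \<epsilon> * poly_norm 1 h"
        using elim(1) by (intro mult_right_mono) auto
      then show "norm (functional (\<lambda>i. a i - fejer_coeffs N a i) h) \<le> \<epsilon> * poly_norm 1 h"
        using main[OF elim(2), of h] by linarith
    qed
  qed
  then show ?thesis by (simp add: eventually_sequentially)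
qed

lemma L1_bounded_diff:
  assumes "L1_bounded C a" "L1_bounded D b"
  shows "L1_bounded (C + D) (\<lambda>i. a i - b i)"
  unfolding L1_bounded_def
proof
  fix h
  have "norm (functional (\<lambda>i. a i - b i) h) \<le> norm (functional a h) + norm (functional b h)"
    unfolding functional_diff_left by (rule norm_triangle_ineq4)
  also have "\<dots> \<le> C * poly_norm 1 h + D * poly_norm 1 h" using assms by (intro add_mono)
      (auto simp: L1_bounded_def)
  finally show "norm (functional (\<lambda>i. a i - b i) h) \<le> (C + D) * poly_norm 1 h" by (simp add: algebra_simps)
qed

text \<open>
  Consecutive Fejer means along a fast subsequence differ by functionals of geometrically decreasing
  norm with finitely many coefficients; the sum of their symbols converges uniformly.
\<close>

theorem continuous_symbol:
  assumes C: "L1_bounded C a" "0 \<le> C"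
    and rot: "\<And>\<epsilon>. \<epsilon> > 0 \<Longrightarrow> \<exists>\<delta>>0. \<forall>w h. norm w = 1 \<longrightarrow> norm (w - 1) < \<delta> \<longrightarrow> norm (functional a (h - dilate w h))
        \<le> \<epsilon> * poly_norm 1 h"
  shows "\<exists>b. continuous_on (sphere 0 1) b \<and> (\<forall>n::nat. fourier_coeff b (int n + 1) = a n)"
proof -
  have "\<exists>N\<ge>k. L1_bounded ((1/2) ^ k) (\<lambda>i. a i - fejer_coeffs N a i)" for k :: nat
    using fejer_coeffs_approximation[OF C rot, of "(1/2) ^ k"]
        by (meson max.cobounded1 max.cobounded2 zero_less_power half_gt_zero_iff zero_less_one)
  then obtain N where N: "\<And>k. N k \<ge> k" "\<And>k. L1_bounded ((1/2) ^ k) (\<lambda>i. a i - fejer_coeffs (N k) a i)" by metis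
  have fin: "fejer_coeffs (N (Suc k)) a n = 0" if "n > N (Suc k)" for n k
    using that N(1)[of "Suc k"] by (simp add: fejer_coeffs_def fejer_weight_eq_0)
  define s where "s k = fejer_coeffs (N (Suc k)) a" for k
  define d where "d k = (case k of 0 \<Rightarrow> s 0 | Suc j \<Rightarrow> (\<lambda>i. s (Suc j) i - s j i))" for k
  define D where "D k = (case k of 0 \<Rightarrow> C + 1 | Suc j \<Rightarrow> 2 * (1/2::real) ^ j)" for k
  have D0: "0 \<le> D k" for k using C(2) by (auto simp: D_def split: nat.split)
  have bs: "L1_bounded ((1/2) ^ Suc k) (\<lambda>i. a i - s k i)" for k unfolding s_def by (rule N(2))
  \<comment> \<open>Both approximations involved in \<open>d (Suc j)\<close> have error at most \<open>(1/2) ^ (j + 1)\<close>; hence the constants \<open>D\<close>.\<close>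
  have mono: "L1_bounded x b" if "L1_bounded y b" "y \<le> x" for x y b
    using that mult_right_mono[OF that(2) Lp_norm_nonneg] unfolding L1_bounded_def by (meson order.trans)
  have dD: "L1_bounded (D k) (d k)" for k
  proof (cases k)
    case 0
    have "L1_bounded (C + (1/2) ^ Suc 0) (\<lambda>i. a i - (a i - s 0 i))" by (intro L1_bounded_diff C bs)
    then show ?thesis by (auto simp: 0 D_def d_def intro: mono)
  next
    case (Suc j)
    have "L1_bounded ((1/2) ^ Suc j + (1/2) ^ Suc (Suc j)) (\<lambda>i. (a i - s j i) - (a i - s (Suc j) i))"
        by (intro L1_bounded_diff bs)
    then show ?thesis by (auto simp: Suc D_def d_def intro: mono)
  qed
  have dfin: "d k n = 0" if "n > max (N (Suc k)) (N k)" for k n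
    using that fin by (cases k) (auto simp: d_def s_def)
  have "\<exists>B. continuous_on (sphere 0 1) B \<and> (\<forall>z\<in>sphere 0 1. norm (B z) \<le> 3/2 * D k)
      \<and> (\<forall>n::nat. fourier_coeff B (int n + 1) = d k n)" for k
    using finite_symbol[OF dD D0 dfin] by blast
  then obtain B where B: "\<And>k. continuous_on (sphere 0 1) (B k)" "\<And>k z. z \<in> sphere 0 1 \<Longrightarrow> norm (B k z)
      \<le> 3/2 * D k"
    "\<And>k n. fourier_coeff (B k) (int n + 1) = d k n" by metis
  have "summable (\<lambda>k. D (Suc k))" by (simp add: D_def)
  then have sm: "summable (\<lambda>k. 3/2 * D k)" by (simp add: summable_Suc_iff)
  define b where "b z = suminf (\<lambda>k. B k z)" for z
  have u: "uniform_limit (sphere 0 1) (\<lambda>n z. \<Sum>k<n. B k z) b sequentially"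
    unfolding b_def by (rule Weierstrass_m_test[OF _ sm]) (use B(2) in auto)
  have cS: "continuous_on (sphere 0 1) (\<lambda>z. \<Sum>k<n. B k z)" for n
    by (intro continuous_intros B)
  have cb: "continuous_on (sphere 0 1) b"
    by (rule uniform_limit_theorem[OF _ u]) (use cS in auto)
  have "fourier_coeff b (int n + 1) = a n" for n
  proof -
    have "(\<lambda>m. fourier_coeff (\<lambda>z. \<Sum>k<m. B k z) (int n + 1)) \<longlonglongrightarrow> fourier_coeff b (int n + 1)"
    proof (rule LIMSEQ_I)
      fix e :: real assume e: "e > 0"
      have "\<forall>\<^sub>F m in sequentially. \<forall>z\<in>sphere 0 1. dist (\<Sum>k<m. B k z) (b z) < e/2"
        using e by (intro uniform_limitD[OF u]) auto
      then have "\<forall>\<^sub>F m in sequentially. norm (fourier_coeff (\<lambda>z. \<Sum>k<m. B k z) (int n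
          + 1) - fourier_coeff b (int n + 1)) < e"
      proof eventually_elim
        case (elim m)
        have c: "continuous_on (sphere 0 1) (\<lambda>z. (\<Sum>k<m. B k z) - b z)" by (intro continuous_intros cS cb)
        have "norm (fourier_coeff (\<lambda>z. (\<Sum>k<m. B k z) - b z) (int n + 1)) \<le> Lp_norm 2 (\<lambda>z. (\<Sum>k<m. B k z) - b z)"
          by (intro norm_fourier_coeff_le_Lp Lp_continuous c) auto
        also have "\<dots> \<le> e/2"
          using elim by (intro Lp_norm_le_on_circle(2) borel_measurable_circle_continuous c)
              (auto simp: dist_norm intro: less_imp_le)
        finally show ?case using e by (simp add: fourier_coeff_diff integrable_circle_continuous cS cb)
      qed
      then show "\<exists>no. \<forall>m\<ge>no. norm (fourier_coeff (\<lambda>z. \<Sum>k<m. B k z) (int n + 1) - fourier_coeff b (int n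
          + 1)) < e"
        by (simp add: eventually_sequentially)
    qed
    then have l1: "(\<lambda>m. fourier_coeff (\<lambda>z. \<Sum>k<Suc m. B k z) (int n + 1)) \<longlonglongrightarrow> fourier_coeff b (int n + 1)"
      by (rule LIMSEQ_Suc)
    have "fourier_coeff (\<lambda>z. \<Sum>k<Suc m. B k z) (int n + 1) = s m n" for m
    proof -
      have "fourier_coeff (\<lambda>z. \<Sum>k<Suc m. B k z) (int n + 1) = (\<Sum>k<Suc m. d k n)"
        unfolding B(3)[symmetric] by (intro fourier_coeff_sum integrable_circle_continuous B)
      also have "\<dots> = s m n" by (induction m) (auto simp: d_def)
      finally show ?thesis .
    qed
    moreover have "(\<lambda>m. s m n) \<longlonglongrightarrow> of_real 1 * a n"
    proof -
      have "filterlim (\<lambda>m. N (Suc m)) at_top sequentially"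
        by (rule filterlim_at_top_mono[OF filterlim_Suc]) (use N(1) in auto)
      then have "(\<lambda>m. fejer_weight (N (Suc m)) (int n)) \<longlonglongrightarrow> 1"
        by (rule filterlim_compose[OF fejer_weight_tendsto])
      then show ?thesis unfolding s_def fejer_coeffs_def by (intro tendsto_intros)
    qed
    ultimately show ?thesis using LIMSEQ_unique[OF l1] by simp
  qed
  with cb show ?thesis by blast
qed

section \<open>Hardy spaces and pairings with polynomials\<close>

lemma chi_eq_poly: "chi (int n) = poly (monom 1 n)"
  by (rule ext) (simp add: chi_def poly_monom)

lemma Dplus_eq: "Dplus = range poly"
proof (intro equalityI subsetI)
  fix f assume "f \<in> Dplus"
  then obtain n c where f: "f = (\<lambda>z. \<Sum>j<n. c j * chi (int j) z)" by (auto simp: Dplus_def)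
  have "f = poly (\<Sum>j<n. monom (c j) j)" by (simp add: f poly_sum[abs_def] poly_monom chi_def)
  then show "f \<in> range poly" by blast
next
  fix f assume "f \<in> range (poly :: complex poly \<Rightarrow> complex \<Rightarrow> complex)"
  then obtain h where f: "f = poly h" by blast
  have "f = (\<lambda>z. \<Sum>j<Suc (degree h). coeff h j * chi (int j) z)"
    by (rule ext) (simp add: f poly_altdef chi_def lessThan_Suc_atMost)
  then show "f \<in> Dplus" unfolding Dplus_def by blast
qed

lemma fourier_coeff_poly: "fourier_coeff (poly h) n = (if n < 0 then 0 else coeff h (nat n))"
proof -
  have "poly h = (\<lambda>z. \<Sum>i\<le>degree h. coeff h i * chi (int i) z)" by (rule ext) (simp add: poly_altdef chi_def)
  then have "fourier_coeff (poly h) n = fourier_coeff (\<lambda>z. \<Sum>i\<le>degree h. coeff h i * chi (int i) z) n" by simp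
  also have "\<dots> = (\<Sum>i\<le>degree h. fourier_coeff (\<lambda>z. coeff h i * chi (int i) z) n)"
    by (intro fourier_coeff_sum integrable_circle_continuous continuous_intros)
  also have "\<dots> = (\<Sum>i\<le>degree h. if i = nat n \<and> 0 \<le> n then coeff h i else 0)"
    by (intro sum.cong) (auto simp: fourier_coeff_monomial)
  also have "\<dots> = (if n < 0 then 0 else coeff h (nat n))" by (cases "n < 0") (auto simp: coeff_eq_0)
  finally show ?thesis .
qed

lemma HpD: "f \<in> Hp p \<Longrightarrow> f \<in> Lp p" "f \<in> Hp p \<Longrightarrow> n < 0 \<Longrightarrow> fourier_coeff f n = 0"
  by (auto simp: Hp_def)

lemma Hp_poly: "0 < p \<Longrightarrow> poly h \<in> Hp p"
  by (simp add: Hp_def poly_Lp fourier_coeff_poly)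

lemma Hp_linear:
  assumes "1 < p" "f \<in> Hp p" "g \<in> Hp p"
  shows "(\<lambda>z. a * f z + b * g z) \<in> Hp p"
proof -
  have "(\<lambda>z. a * f z + b * g z) \<in> Lp p" using assms by (intro Lp_add Lp_cmult HpD) auto
  moreover have "fourier_coeff (\<lambda>z. a * f z + b * g z) n = 0" if "n < 0" for n
    using that assms by (simp add: fourier_coeff_linear HpD Lp_imp_integrable(1)[of p])
  ultimately show ?thesis by (simp add: Hp_def)
qed

text \<open>
  The Fejer means of a function in \<open>H^p\<close> are analytic polynomials.
\<close>

lemma Hp_poly_dense:
  assumes p: "1 < p" and f: "f \<in> Hp p" and e: "0 < e"
  shows "\<exists>k. Lp_norm p (\<lambda>z. f z - poly k z) < e"
proof -
  obtain N where N: "Lp_norm p (\<lambda>z. f z - fejer_mean N f z) < e"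
    using order_tendstoD(2)[OF fejer_mean_tendsto[OF p HpD(1)[OF f]] e] by (auto simp: eventually_sequentially)
  define k where "k = (\<Sum>i\<le>N. monom (of_real (fejer_weight N (int i)) * fourier_coeff f (int i)) i)"
  have "fejer_mean N f z = poly k z" for z
  proof -
    have "fejer_mean N f z = (\<Sum>n\<in>int ` {..N}. of_real (fejer_weight N n) * fourier_coeff f n * chi n z)"
      unfolding fejer_mean_def
    proof (intro sum.mono_neutral_right ballI)
      fix n assume "n \<in> {- int N..int N} - int ` {..N}"
      then have "n < 0" by (auto simp: image_iff) (metis atMost_iff nat_int nat_le_iff not_le nat_0_le)
      then show "of_real (fejer_weight N n) * fourier_coeff f n * chi n z = 0" using HpD(2)[OF f] by simp
    qed auto
    also have "\<dots> = (\<Sum>i\<le>N. of_real (fejer_weight N (int i)) * fourier_coeff f (int i) * chi (int i) z)"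
      by (subst sum.reindex) auto
    finally show ?thesis by (simp add: k_def poly_sum poly_monom chi_def)
  qed
  then show ?thesis using N by auto
qed

text \<open>
  Conjugates the coefficients, so that \<open>pairing F (poly (cnj_poly g))\<close> is linear in \<open>g\<close>.
\<close>

abbreviation cnj_poly :: "complex poly \<Rightarrow> complex poly" where
  "cnj_poly \<equiv> map_poly cnj"

lemma poly_cnj_poly: "poly (cnj_poly h) z = cnj (poly h (cnj z))"
  by (simp add: poly_altdef degree_map_poly coeff_map_poly)

lemma poly_norm_cnj_poly: "poly_norm q (cnj_poly h) = poly_norm q h"
proof -
  have "(\<lambda>z. norm (poly h z) powr q) \<in> borel_measurable circle"
    using LpD(1)[OF poly_Lp[of 1 h]] by measurable
  then have "(LINT z|circle. norm (poly h (cnj z)) powr q) = (LINT z|circle. norm (poly h z) powr q)"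
    by (rule integral_circle_cnj)
  then show ?thesis by (simp add: Lp_norm_def poly_cnj_poly)
qed

lemma pairing_cnj_poly:
  assumes "integrable circle F"
  shows "pairing F (poly (cnj_poly g)) = (\<Sum>i\<le>degree g. coeff g i * fourier_coeff F (int i))"
proof -
  have "pairing F (poly (cnj_poly g)) = (LINT z|circle. (\<Sum>i\<le>degree g. coeff g i * (F z * cnj (chi (int i) z))))"
    unfolding pairing_def poly_cnj_poly by (simp add: poly_altdef sum_distrib_left chi_def mult_ac)
  also have "\<dots> = (\<Sum>i\<le>degree g. coeff g i * fourier_coeff F (int i))"
    unfolding fourier_coeff_def pairing_def using integrable_fourier[OF assms]
    by (subst Bochner_Integration.integral_sum) auto
  finally show ?thesis .
qed

lemma pairing_bound:
  assumes p: "1 < p" "1 < q" "1 / p + 1 / q = 1" and F: "F \<in> Lp p"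
  shows "norm (pairing F (poly (cnj_poly g))) \<le> Lp_norm p F * poly_norm q g"
proof -
  define G where "G z = cnj (poly (cnj_poly g) z)" for z
  have G: "G \<in> Lp q" using p unfolding G_def by (intro Lp_continuous continuous_intros) auto
  have "norm (pairing F (poly (cnj_poly g))) \<le> (LINT z|circle. norm (F z * G z))"
    unfolding pairing_def G_def by (rule integral_norm_bound)
  also have "\<dots> \<le> Lp_norm p F * Lp_norm q G" by (rule Hoelder_circle(2)[OF p F G])
  also have "Lp_norm q G = poly_norm q (cnj_poly g)" by (intro Lp_norm_cong) (simp add: G_def)
  finally show ?thesis by (simp only: poly_norm_cnj_poly)
qed

lemma pairing_diff_bound:
  assumes p: "1 < p" "1 < q" "1 / p + 1 / q = 1" and F: "F \<in> Lp p" "h \<in> Lp p"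
  shows "norm (pairing F (poly (cnj_poly g)) - pairing h (poly (cnj_poly g)))
      \<le> Lp_norm p (\<lambda>z. F z - h z) * poly_norm q g"
proof -
  have i: "integrable circle F" "integrable circle h" using F p by (auto intro: Lp_imp_integrable)
  have d: "(\<lambda>z. F z - h z) \<in> Lp p" using p F by (intro Lp_diff) auto
  have "pairing F (poly (cnj_poly g)) - pairing h (poly (cnj_poly g))
      = pairing (\<lambda>z. F z - h z) (poly (cnj_poly g))"
    using i Lp_imp_integrable(1)[OF p(1) d]
    by (simp add: pairing_cnj_poly fourier_coeff_diff right_diff_distrib sum_subtractf)
  then show ?thesis using pairing_bound[OF p d] by simp
qed

text \<open>
  \<open>h\<close> is approximated by a polynomial, whose pairing with \<open>G n\<close> involves only finitely many
  coefficients.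
\<close>

lemma pairing_weak_null:
  assumes p: "1 < p" "1 < q" "1 / p + 1 / q = 1" and h: "h \<in> Hp p"
    and G: "\<And>n::nat. poly_norm q (G n) \<le> B" "\<And>i. (\<lambda>n. coeff (G n) i) \<longlonglongrightarrow> 0"
  shows "(\<lambda>n. pairing h (poly (cnj_poly (G n)))) \<longlonglongrightarrow> 0"
proof (rule LIMSEQ_I)
  fix e :: real assume e: "e > 0"
  have B: "0 \<le> B" using G(1)[of 0] Lp_norm_nonneg order.trans by blast
  obtain k where k: "Lp_norm p (\<lambda>z. h z - poly k z) < e / 2 / (B + 1)"
    using Hp_poly_dense[OF p(1) h, of "e / 2 / (B + 1)"] e B by auto
  have pk: "poly k \<in> Lp p" using p by (intro poly_Lp) auto
  have pair: "pairing (poly k) (poly (cnj_poly g)) = (\<Sum>i\<le>degree k. coeff g i * coeff k i)" for g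
  proof -
    have "pairing (poly k) (poly (cnj_poly g)) = functional (coeff k) g"
      using Lp_imp_integrable(1)[OF p(1) pk]
      by (simp add: pairing_cnj_poly fourier_coeff_poly functional_def mult.commute)
    also have "\<dots> = functional (coeff g) k"
      by (simp add: functional_altdef[of g "max (degree g) (degree k)"] functional_altdef[of k
          "max (degree g) (degree k)"] mult.commute)
    finally show ?thesis by (simp add: functional_def)
  qed
  have "(\<lambda>n. \<Sum>i\<le>degree k. coeff (G n) i * coeff k i) \<longlonglongrightarrow> (\<Sum>i\<le>degree k. 0 * coeff k i)"
    by (intro tendsto_intros G)
  then have "(\<lambda>n. norm (\<Sum>i\<le>degree k. coeff (G n) i * coeff k i)) \<longlonglongrightarrow> 0"
    by (simp add: tendsto_norm_zero)
  then have "\<forall>\<^sub>F n in sequentially. norm (\<Sum>i\<le>degree k. coeff (G n) i * coeff k i) < e / 2"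
    using e by (intro order_tendstoD(2)) auto
  then have "\<forall>\<^sub>F n in sequentially. norm (pairing h (poly (cnj_poly (G n)))) < e"
  proof eventually_elim
    case (elim n)
    have "norm (pairing h (poly (cnj_poly (G n))) - pairing (poly k) (poly (cnj_poly (G n))))
        \<le> Lp_norm p (\<lambda>z. h z - poly k z) * poly_norm q (G n)"
      by (intro pairing_diff_bound p HpD h pk)
    also have "\<dots> \<le> e / 2 / (B + 1) * B" using k G(1)[of n] e B by (intro mult_mono) auto
    also have "\<dots> \<le> e / 2" using e B by (simp add: field_simps)
    finally have "norm (pairing h (poly (cnj_poly (G n))) - pairing (poly k) (poly (cnj_poly (G n)))) \<le> e / 2" .
    then show ?case using elim
      norm_triangle_sub[of "pairing h (poly (cnj_poly (G n)))" "pairing (poly k) (poly (cnj_poly (G n)))"]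
          unfolding pair by linarith
  qed
  then show "\<exists>no. \<forall>n\<ge>no. norm (pairing h (poly (cnj_poly (G n))) - 0) < e" by
      (simp add: eventually_sequentially)
qed

lemma functional_monom: "functional a (monom c n) = a n * c"
proof -
  have "functional a (monom c n) = (\<Sum>i\<le>n. a i * coeff (monom c n) i)"
      by (rule functional_altdef[OF degree_monom_le])
  also have "\<dots> = (\<Sum>i\<le>n. if i = n then a n * c else 0)" by (intro sum.cong) auto
  finally show ?thesis by simp
qed

lemma functional_mult: "functional a (f * g) = (\<Sum>i\<le>degree g. coeff g i * functional (\<lambda>k. a (i + k)) f)"
proof -
  have "functional a (f * g) = functional a ((\<Sum>k\<le>degree f. monom (coeff f k) k) * (\<Sum>i\<le>degree g. monom (coeff
      g i) i))"
    by (simp add: poly_as_sum_of_monoms)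
  also have "\<dots> = (\<Sum>k\<le>degree f. \<Sum>i\<le>degree g. a (k + i) * (coeff f k * coeff g i))"
    by (simp add: sum_product functional_sum mult_monom functional_monom)
  also have "\<dots> = (\<Sum>i\<le>degree g. coeff g i * functional (\<lambda>k. a (i + k)) f)"
    by (subst sum.swap) (simp add: functional_def sum_distrib_left mult_ac add.commute)
  finally show ?thesis .
qed

section \<open>Compact operators\<close>

lemma linear_operatorD:
  assumes "linear_operator_on_Hp p A"
  shows "f \<in> Hp p \<Longrightarrow> A f \<in> Hp p"
    and "f \<in> Hp p \<Longrightarrow> g \<in> Hp p \<Longrightarrow> AE z in circle. f z = g z \<Longrightarrow> AE z in circle. A f z = A g z"
    and "f \<in> Hp p \<Longrightarrow> g \<in> Hp p \<Longrightarrow> AE z in circle. A (\<lambda>w. a * f w + b * g w) z = a * A f z + b * A g z"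
  using assms unfolding linear_operator_on_Hp_def by blast+

lemma compact_operatorD:
  assumes "compact_operator_on_Hp p A"
  shows "linear_operator_on_Hp p A"
    and "(\<And>n. F n \<in> Hp p) \<Longrightarrow> (\<And>n. Lp_norm p (F n) \<le> M) \<Longrightarrow> \<exists>r h. strict_mono (r :: nat \<Rightarrow> nat) \<and> h \<in> Hp p
        \<and> (\<lambda>n. Lp_norm p (\<lambda>z. A (F (r n)) z - h z)) \<longlonglongrightarrow> 0"
  using assms unfolding compact_operator_on_Hp_def by blast+

text \<open>
  If \<open>A\<close> were unbounded, there would be unit vectors whose images have norms tending to infinity, and
  these have no convergent subsequence.
\<close>

lemma compact_operator_bounded:
  assumes p: "1 < p" and A: "compact_operator_on_Hp p A"
  shows "\<exists>K\<ge>0. \<forall>f\<in>Hp p. Lp_norm p (A f) \<le> K * Lp_norm p f"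
proof (rule ccontr)
  note L = linear_operatorD[OF compact_operatorD(1)[OF A]]
  assume neg: "\<not> ?thesis"
  have "\<forall>n::nat. \<exists>f\<in>Hp p. Lp_norm p (A f) > real n * Lp_norm p f"
  proof
    fix n :: nat
    have "\<not> (\<forall>f\<in>Hp p. Lp_norm p (A f) \<le> real n * Lp_norm p f)" using neg of_nat_0_le_iff[of n] by blast
    then show "\<exists>f\<in>Hp p. Lp_norm p (A f) > real n * Lp_norm p f" by (simp add: not_le)
  qed
  then obtain f where f: "\<And>n::nat. f n \<in> Hp p" "\<And>n. Lp_norm p (A (f n)) > real n * Lp_norm p (f n)" by metis
  have scale: "AE z in circle. A (\<lambda>w. c * f n w) z = c * A (f n) z" for n c
    using L(3)[OF f(1)[of n] f(1)[of n], of c 0] by simp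
  have pos: "Lp_norm p (f n) > 0" for n
  proof (rule ccontr)
    assume "\<not> Lp_norm p (f n) > 0"
    then have z: "Lp_norm p (f n) = 0" using Lp_norm_nonneg[of p "f n"] by linarith
    have "AE z in circle. f n z = 0 * f n z"
      using AE_eq_0_of_Lp_norm_eq_0[OF HpD(1)[OF f(1)] z] by simp
    moreover have "(\<lambda>z. 0 * f n z) \<in> Hp p" using Hp_linear[OF p f(1) f(1), of 0 n 0 n] by simp
    ultimately have "AE z in circle. A (f n) z = A (\<lambda>z. 0 * f n z) z" using L(2) f(1) by blast
    with scale[of 0 n] have "AE z in circle. A (f n) z = 0" by eventually_elim simp
    then have "Lp_norm p (A (f n)) = 0" by (rule Lp_norm_eq_0_of_AE)
    with f(2)[of n] z show False by simp
  qed
  define F where "F n = (\<lambda>w. complex_of_real (1 / Lp_norm p (f n)) * f n w)" for n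
  have F: "F n \<in> Hp p" for n using Hp_linear[OF p f(1) f(1), of "of_real (1 / Lp_norm p (f n))" n 0 n]
      unfolding F_def by simp
  have nc: "norm (complex_of_real (1 / Lp_norm p (f n))) = 1 / Lp_norm p (f n)" for n
    unfolding norm_of_real using pos[of n] by simp
  have F1: "Lp_norm p (F n) \<le> 1" for n
  proof -
    have "Lp_norm p (F n) = norm (complex_of_real (1 / Lp_norm p (f n))) * Lp_norm p (f n)"
      unfolding F_def using p by (intro Lp_norm_cmult) auto
    then show ?thesis unfolding nc using pos[of n] by simp
  qed
  obtain r h where r: "strict_mono r" "h \<in> Hp p" "(\<lambda>n. Lp_norm p (\<lambda>z. A (F (r n)) z - h z)) \<longlonglongrightarrow> 0"
    using compact_operatorD(2)[OF A, of F 1] F F1 by blast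
  have big: "Lp_norm p (A (F n)) > real n" for n
  proof -
    have "AE z in circle. A (F n) z = complex_of_real (1 / Lp_norm p (f n)) * A (f n) z"
      unfolding F_def by (rule scale)
    then have "Lp_norm p (A (F n)) = Lp_norm p (\<lambda>z. complex_of_real (1 / Lp_norm p (f n)) * A (f n) z)"
      using LpD(1)[OF HpD(1)[OF L(1)[OF F]]] LpD(1)[OF Lp_cmult[OF HpD(1)[OF L(1)[OF f(1)]]]]
      by (rule Lp_norm_cong_AE)
    also have "\<dots> = norm (complex_of_real (1 / Lp_norm p (f n))) * Lp_norm p (A (f n))"
      using p by (intro Lp_norm_cmult) auto
    also have "\<dots> = 1 / Lp_norm p (f n) * Lp_norm p (A (f n))" unfolding nc ..
    finally have "Lp_norm p (A (F n)) = Lp_norm p (A (f n)) / Lp_norm p (f n)" by simp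
    then show ?thesis using f(2)[of n] pos[of n] by (simp only: pos_less_divide_eq)
  qed
  have "\<forall>\<^sub>F n in sequentially. Lp_norm p (\<lambda>z. A (F (r n)) z - h z) < 1"
    using r(3) by (intro order_tendstoD(2)) auto
  moreover have "\<forall>\<^sub>F n in sequentially. real n > Lp_norm p h + 1"
    by (rule eventually_compose_filterlim[OF eventually_gt_at_top filterlim_real_sequentially])
  ultimately have "\<forall>\<^sub>F n in sequentially. False"
  proof eventually_elim
    case (elim n)
    have "\<bar>Lp_norm p (A (F (r n))) - Lp_norm p h\<bar> \<le> Lp_norm p (\<lambda>z. A (F (r n)) z - h z)"
      using p r(2) F L(1) by (intro Lp_norm_diff_ge HpD) auto
    moreover have "real n \<le> real (r n)" using seq_suble[OF r(1), of n] by simp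
    ultimately show False using elim big[of "r n"] by linarith
  qed
  then show False by simp
qed

text \<open>
  If the entries stayed away from zero along a subsequence, the images of these monomials would have
  a limit point \<open>h\<close>; the entries are then close to coefficients of \<open>h\<close> at frequencies tending to
  infinity, which tend to zero.
\<close>

lemma compact_operator_diagonal_tendsto_0:
  assumes p: "1 < p" and A: "compact_operator_on_Hp p A"
  shows "(\<lambda>n. fourier_coeff (A (chi (int (n + k)))) (int (n + j))) \<longlonglongrightarrow> 0"
proof (rule LIMSEQ_I, rule ccontr)
  define x where "x n = fourier_coeff (A (chi (int (n + k)))) (int (n + j))" for n
  note L = linear_operatorD[OF compact_operatorD(1)[OF A]]
  fix e :: real assume e: "0 < e"
  assume neg: "\<not> (\<exists>no. \<forall>n\<ge>no. norm (fourier_coeff (A (chi (int (n + k)))) (int (n + j)) - 0) < e)"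
  have "\<exists>n\<ge>m. n \<in> {n. \<not> norm (x n) < e}" for m
  proof (rule ccontr)
    assume "\<not> (\<exists>n\<ge>m. n \<in> {n. \<not> norm (x n) < e})"
    then have "\<forall>n\<ge>m. norm (x n) < e" by simp
    then have "\<forall>n\<ge>m. norm (fourier_coeff (A (chi (int (n + k)))) (int (n + j)) - 0) < e"
      unfolding x_def diff_0_right .
    with neg show False by (elim notE) (rule exI)
  qed
  then have inf: "infinite {n. \<not> norm (x n) < e}" unfolding infinite_nat_iff_unbounded_le by (rule allI)
  obtain s :: "nat \<Rightarrow> nat" where s: "strict_mono s" "\<And>n. s n \<in> {n. \<not> norm (x n) < e}"
    using infinite_enumerate[OF inf] by (elim exE conjE) simp
  define F where "F n = chi (int (s n + k))" for n
  have F: "F n \<in> Hp p" for n unfolding F_def chi_eq_poly using p by (intro Hp_poly) auto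
  have F1: "Lp_norm p (F n) \<le> 1" for n
  proof (rule Lp_norm_le_on_circle(2)[OF _ LpD(1)[OF HpD(1)[OF F]]])
    show "norm (F n z) \<le> 1" if "norm z = 1" for z unfolding F_def using norm_chi[OF that] by (rule eq_refl)
  qed (use p in simp)
  obtain r h where r: "strict_mono r" "h \<in> Hp p" "(\<lambda>n. Lp_norm p (\<lambda>z. A (F (r n)) z - h z)) \<longlonglongrightarrow> 0"
    using compact_operatorD(2)[OF A, of F 1] F F1 by blast
  have hL: "h \<in> Lp p" and AL: "A (F n) \<in> Lp p" for n using r F L(1) by (auto intro: HpD)
  define y where "y n = fourier_coeff h (int (s (r n) + j))" for n
  have "filterlim (\<lambda>n. s (r n) + j) sequentially sequentially"
    by (rule filterlim_at_top_mono[OF filterlim_subseq[OF strict_mono_o[OF s(1) r(1)]]]) auto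
  then have "y \<longlonglongrightarrow> 0" unfolding y_def by (rule filterlim_compose[OF fourier_coeff_tendsto_0[OF p hL]])
  then have "(\<lambda>n. Lp_norm p (\<lambda>z. A (F (r n)) z - h z) + norm (y n)) \<longlonglongrightarrow> 0 + 0"
    by (intro tendsto_add r(3) tendsto_norm_zero)
  then have "\<forall>\<^sub>F n in sequentially. Lp_norm p (\<lambda>z. A (F (r n)) z - h z) + norm (y n) < e"
    using e by (intro order_tendstoD(2)) auto
  then have "\<forall>\<^sub>F n in sequentially. False"
  proof eventually_elim
    case (elim n)
    have "norm (x (s (r n)) - y n) \<le> Lp_norm p (\<lambda>z. A (F (r n)) z - h z)"
    proof -
      have "norm (fourier_coeff (\<lambda>z. A (F (r n)) z - h z) (int (s (r n) + j)))
          \<le> Lp_norm p (\<lambda>z. A (F (r n)) z - h z)"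
        using p by (intro norm_fourier_coeff_le_Lp Lp_diff AL hL) auto
      also have "fourier_coeff (\<lambda>z. A (F (r n)) z - h z) (int (s (r n) + j)) = x (s (r n)) - y n"
        by (subst fourier_coeff_diff[OF Lp_imp_integrable(1)[OF p AL] Lp_imp_integrable(1)[OF p hL]])
            (simp only: x_def y_def F_def)
      finally show ?thesis .
    qed
    then have "norm (x (s (r n))) \<le> Lp_norm p (\<lambda>z. A (F (r n)) z - h z) + norm (y n)"
      using norm_triangle_sub[of "x (s (r n))" "y n"] by linarith
    then show False using elim s(2)[of "r n"] by simp
  qed
  then show False by simp
qed

lemma fourier_coeff_operator_linear:
  assumes p: "1 < p" and A: "linear_operator_on_Hp p A" and f: "f \<in> Hp p" "g \<in> Hp p"
  shows "fourier_coeff (A (\<lambda>z. a * f z + b * g z)) n = a * fourier_coeff (A f) n + b * fourier_coeff (A g) n"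
proof -
  note L = linear_operatorD[OF A]
  have "fourier_coeff (A (\<lambda>z. a * f z + b * g z)) n = fourier_coeff (\<lambda>z. a * A f z + b * A g z) n"
    by (intro fourier_coeff_cong_AE L(3) f LpD(1)[of _ p] Lp_add Lp_cmult HpD(1) L(1) Hp_linear[OF p]) (use
        p in auto)
  also have "\<dots> = a * fourier_coeff (A f) n + b * fourier_coeff (A g) n"
    by (intro fourier_coeff_linear Lp_imp_integrable(1)[OF p] HpD(1) L(1) f)
  finally show ?thesis .
qed

lemma fourier_coeff_operator_poly:
  assumes p: "1 < p" and A: "linear_operator_on_Hp p A"
  shows "fourier_coeff (A (poly h)) n = functional (\<lambda>k. fourier_coeff (A (chi (int k))) n) h"
proof -
  define \<phi> where "\<phi> h = fourier_coeff (A (poly h)) n" for h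
  have pH: "poly h \<in> Hp p" for h using p by (intro Hp_poly) auto
  have lin: "\<phi> (smult a f + smult b g) = a * \<phi> f + b * \<phi> g" for a b f g
    using fourier_coeff_operator_linear[OF p A pH pH, of a f b g n] by (simp add: \<phi>_def poly_add[abs_def])
  have add: "\<phi> (f + g) = \<phi> f + \<phi> g" for f g using lin[of 1 f 1 g] by simp
  have smult: "\<phi> (smult a f) = a * \<phi> f" for a f using lin[of a f 0 f] by simp
  have zero: "\<phi> 0 = 0" using smult[of 0 0] by simp
  have sum: "\<phi> (\<Sum>i\<in>I. f i) = (\<Sum>i\<in>I. \<phi> (f i))" for I :: "nat set" and f
    by (induction I rule: infinite_finite_induct) (auto simp: zero add)
  have "\<phi> h = \<phi> (\<Sum>k\<le>degree h. smult (coeff h k) (monom 1 k))"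
    by (simp add: smult_monom poly_as_sum_of_monoms)
  also have "\<dots> = (\<Sum>k\<le>degree h. coeff h k * \<phi> (monom 1 k))" by (simp add: sum smult)
  finally show ?thesis by (simp add: \<phi>_def functional_def chi_eq_poly mult.commute)
qed

section \<open>Compact Hankel operators under small rotations\<close>

lemma factors_pos_of_product_bound:
  fixes x y K e n :: real
  assumes "e * x * y < n" "n \<le> K * x * y" "0 \<le> x" "0 \<le> y"
  shows "0 < x" "0 < y"
  using assms by (auto simp: less_le)

text \<open>
  Turns sequential compactness into a uniform estimate: a failure of the estimate produces sequences
  that, normalized to norm 1, stay away from zero.
\<close>

lemma uniformly_small_of_sequences:
  fixes \<Psi> :: "complex \<Rightarrow> complex poly \<Rightarrow> complex poly \<Rightarrow> complex"
  assumes hom: "\<And>w c d f g. \<Psi> w (smult c f) (smult d g) = c * d * \<Psi> w f g"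
    and bdd: "\<And>w f g. norm w = 1 \<Longrightarrow> norm (\<Psi> w f g) \<le> K * poly_norm p f * poly_norm q g"
    and seq: "\<And>w f g. (\<And>n::nat. norm (w n) = 1) \<Longrightarrow> w \<longlonglongrightarrow> 1 \<Longrightarrow> (\<And>n. poly_norm p (f n) \<le> 1)
        \<Longrightarrow> (\<And>n. poly_norm q (g n) \<le> 1)
       \<Longrightarrow> \<exists>r. strict_mono (r :: nat \<Rightarrow> nat) \<and> (\<lambda>n. \<Psi> (w (r n)) (f (r n)) (g (r n))) \<longlonglongrightarrow> 0"
    and e: "0 < e" and pq: "0 < p" "0 < q"
  shows "\<exists>\<delta>>0. \<forall>w f g. norm w = 1 \<longrightarrow> norm (w - 1) < \<delta> \<longrightarrow> norm (\<Psi> w f g) \<le> e * poly_norm p f * poly_norm q g"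
proof (rule ccontr)
  assume neg: "\<not> ?thesis"
  have "\<exists>w f g. norm w = 1 \<and> norm (w - 1) < 1 / real (Suc n) \<and> e * poly_norm p f * poly_norm q g < norm (\<Psi> w
      f g)" for n
  proof (rule ccontr)
    assume "\<not> (\<exists>w f g. norm w = 1 \<and> norm (w - 1) < 1 / real (Suc n)
        \<and> e * poly_norm p f * poly_norm q g < norm (\<Psi> w f g))"
    then have "\<forall>w f g. norm w = 1 \<longrightarrow> norm (w - 1) < 1 / real (Suc n) \<longrightarrow> norm (\<Psi> w f g)
        \<le> e * poly_norm p f * poly_norm q g"
      by (meson not_le)
    moreover have "1 / real (Suc n) > 0" by simp
    ultimately show False using neg by blast
  qed
  then obtain w f g where w: "\<And>n. norm (w n) = 1" "\<And>n. norm (w n - 1) < 1 / real (Suc n)"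
    and fg: "\<And>n. e * poly_norm p (f n) * poly_norm q (g n) < norm (\<Psi> (w n) (f n) (g n))" by metis
  have pos: "0 < poly_norm p (f n)" "0 < poly_norm q (g n)" for n
    using factors_pos_of_product_bound[OF fg[of n] bdd[OF w(1)]] by auto
  define c where "c n = complex_of_real (1 / poly_norm p (f n))" for n
  define d where "d n = complex_of_real (1 / poly_norm q (g n))" for n
  have c: "norm (c n) = 1 / poly_norm p (f n)" for n unfolding c_def norm_of_real using pos[of n] by simp
  have d: "norm (d n) = 1 / poly_norm q (g n)" for n unfolding d_def norm_of_real using pos[of n] by simp
  have "w \<longlonglongrightarrow> 1"
  proof (rule LIM_zero_cancel, rule Lim_null_comparison)
    show "\<forall>\<^sub>F n in sequentially. norm (w n - 1) \<le> 1 / real (Suc n)" using w(2)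
        by (intro always_eventually allI less_imp_le)
    show "(\<lambda>n. 1 / real (Suc n)) \<longlonglongrightarrow> 0" using LIMSEQ_inverse_real_of_nat by (simp only: inverse_eq_divide)
  qed
  moreover have "poly_norm p (smult (c n) (f n)) \<le> 1" "poly_norm q (smult (d n) (g n)) \<le> 1" for n
    using pos[of n] pq by (simp_all only: poly_norm_smult c d) simp_all
  ultimately obtain r where r: "strict_mono (r :: nat \<Rightarrow> nat)"
      "(\<lambda>n. \<Psi> (w (r n)) (smult (c (r n)) (f (r n))) (smult (d (r n)) (g (r n)))) \<longlonglongrightarrow> 0"
    using seq[of w "\<lambda>n. smult (c n) (f n)" "\<lambda>n. smult (d n) (g n)"] w(1) by blast
  have big: "norm (\<Psi> (w n) (smult (c n) (f n)) (smult (d n) (g n))) > e" for n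
  proof -
    have "norm (\<Psi> (w n) (smult (c n) (f n)) (smult (d n) (g n)))
        = norm (\<Psi> (w n) (f n) (g n)) / (poly_norm p (f n) * poly_norm q (g n))"
      by (simp add: hom norm_mult c d)
    then show ?thesis using fg[of n] pos[of n] by (simp add: pos_less_divide_eq mult.assoc)
  qed
  have "\<forall>\<^sub>F n in sequentially. norm (\<Psi> (w (r n)) (smult (c (r n)) (f (r n))) (smult (d (r n)) (g (r n)))) < e"
    using tendsto_norm_zero[OF r(2)] e by (rule order_tendstoD(2))
  then obtain n where "norm (\<Psi> (w (r n)) (smult (c (r n)) (f (r n))) (smult (d (r n)) (g (r n)))) < e"
    by (auto simp: eventually_sequentially)
  with big[of "r n"] show False by simp
qed

text \<open>
  The index of \<open>a\<close> is shifted against the symbol to be found: \<open>a n\<close> will be its coefficient at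
  \<open>n + 1\<close>.
\<close>

locale compact_hankel =
  fixes p q :: real and A :: "(complex \<Rightarrow> complex) \<Rightarrow> complex \<Rightarrow> complex" and a :: "nat \<Rightarrow> complex"
  assumes p: "1 < p" and q: "1 < q" and pq: "1 / p + 1 / q = 1"
    and compact: "compact_operator_on_Hp p A"
    and hankel: "\<And>j k. fourier_coeff (A (chi (int k))) (int j) = a (j + k)"
begin

lemmas linear = compact_operatorD(1)[OF compact]
lemmas A_Hp = linear_operatorD(1)[OF linear]

lemma poly_in_Hp: "poly f \<in> Hp p"
  using p by (intro Hp_poly) auto

lemma A_poly_Lp: "A (poly f) \<in> Lp p"
  by (intro HpD A_Hp poly_in_Hp)

lemma fourier_coeff_A_poly: "fourier_coeff (A (poly f)) (int j) = functional (\<lambda>k. a (j + k)) f"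
  by (simp add: fourier_coeff_operator_poly[OF p linear] hankel)

lemma functional_eq_pairing: "functional a (f * g) = pairing (A (poly f)) (poly (cnj_poly g))"
  by (simp add: functional_mult pairing_cnj_poly[OF Lp_imp_integrable(1)[OF p A_poly_Lp]] fourier_coeff_A_poly)

lemma bounded_form:
  "\<exists>K\<ge>0. \<forall>f g. norm (functional a (f * g)) \<le> K * poly_norm p f * poly_norm q g"
proof -
  obtain K where K: "0 \<le> K" "\<And>f. f \<in> Hp p \<Longrightarrow> Lp_norm p (A f) \<le> K * Lp_norm p f"
    using compact_operator_bounded[OF p compact] by blast
  have "norm (functional a (f * g)) \<le> K * poly_norm p f * poly_norm q g" for f g
  proof -
    have "norm (functional a (f * g)) \<le> Lp_norm p (A (poly f)) * poly_norm q g"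
      unfolding functional_eq_pairing by (rule pairing_bound[OF p q pq A_poly_Lp])
    also have "\<dots> \<le> K * poly_norm p f * poly_norm q g" by (intro mult_right_mono K poly_in_Hp) simp
    finally show ?thesis .
  qed
  with K(1) show ?thesis by (intro exI[of _ K] conjI allI)
qed

lemma poly_norm_diff_rotation: "norm w = 1 \<Longrightarrow> 1 \<le> s \<Longrightarrow> poly_norm s (g - dilate w g) \<le> 2 * poly_norm s g"
  using Lp_norm_diff_le[OF _ poly_Lp poly_Lp, of s g "dilate w g"] poly_norm_rotation[of w s g]
  by (simp add: poly_diff[abs_def])

lemma dilate_smult: "dilate w (smult c f) = smult c (dilate w f)"
  by (simp add: dilate_def pcompose_smult)

lemma norm_coeff_le: "1 < s \<Longrightarrow> norm (coeff f i) \<le> poly_norm s f"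
  using norm_fourier_coeff_le_Lp[OF _ poly_Lp, of s f "int i"] by (simp add: fourier_coeff_poly)

text \<open>
  Along a subsequence the images \<open>A f\<close> converge to some \<open>h\<close>, and \<open>g - dilate w g\<close> is bounded with
  coefficients tending to zero, so its pairing with \<open>h\<close> tends to zero.
\<close>

lemma rotation_right_small:
  assumes e: "0 < e"
  shows "\<exists>\<delta>>0. \<forall>w f g. norm w = 1 \<longrightarrow> norm (w - 1) < \<delta> \<longrightarrow>
    norm (functional a (f * (g - dilate w g))) \<le> e * poly_norm p f * poly_norm q g"
proof -
  obtain K where K: "0 \<le> K" "\<And>f g. norm (functional a (f * g)) \<le> K * poly_norm p f * poly_norm q g"
    using bounded_form by (elim exE conjE) simp
  show ?thesis
  proof (rule uniformly_small_of_sequences[where K = "2 * K", OF _ _ _ e])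
    fix w c d :: complex and f g :: "complex poly"
    have "smult c f * (smult d g - dilate w (smult d g)) = smult (c * d) (f * (g - dilate w g))"
      unfolding dilate_smult smult_diff_right[symmetric] mult_smult_left mult_smult_right smult_smult by
          (simp only: mult.commute)
    then show "functional a (smult c f * (smult d g - dilate w (smult d g)))
        = c * d * functional a (f * (g - dilate w g))"
      by (simp only: functional_smult)
  next
    fix w :: complex and f g :: "complex poly" assume w: "norm w = 1"
    have "norm (functional a (f * (g - dilate w g))) \<le> K * poly_norm p f * poly_norm q (g - dilate w g)"
        by (rule K)
    also have "\<dots> \<le> K * poly_norm p f * (2 * poly_norm q g)"
      using w K(1) q by (intro mult_left_mono poly_norm_diff_rotation) auto
    finally show "norm (functional a (f * (g - dilate w g))) \<le> 2 * K * poly_norm p f * poly_norm q g" by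
        (simp add: mult_ac)
  next
    fix w :: "nat \<Rightarrow> complex" and f g :: "nat \<Rightarrow> complex poly" assume w: "\<And>n. norm (w n) = 1" "w \<longlonglongrightarrow> 1"
      and f: "\<And>n. poly_norm p (f n) \<le> 1" and g: "\<And>n. poly_norm q (g n) \<le> 1"
    obtain r h where r: "strict_mono (r :: nat \<Rightarrow> nat)" "h \<in> Hp p"
        "(\<lambda>n. Lp_norm p (\<lambda>z. A (poly (f (r n))) z - h z)) \<longlonglongrightarrow> 0"
      using compact_operatorD(2)[OF compact, of "\<lambda>n. poly (f n)" 1, OF poly_in_Hp f] by (elim exE conjE)
    define G where "G n = g (r n) - dilate (w (r n)) (g (r n))" for n
    have G: "poly_norm q (G n) \<le> 2" for n
      using poly_norm_diff_rotation[OF w(1)[of "r n"], of q "g (r n)"] g[of "r n"] q by (simp add: G_def)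
    have wr: "(\<lambda>n. w (r n)) \<longlonglongrightarrow> 1" using LIMSEQ_subseq_LIMSEQ[OF w(2) r(1)] by (simp add: o_def)
    have "(\<lambda>n. coeff (G n) i) \<longlonglongrightarrow> 0" for i
    proof (rule Lim_null_comparison)
      show "(\<lambda>n. norm (1 - w (r n) ^ i)) \<longlonglongrightarrow> 0"
        using tendsto_norm[OF tendsto_diff[OF tendsto_const tendsto_power[OF wr]], of 1 i] by simp
      show "\<forall>\<^sub>F n in sequentially. norm (coeff (G n) i) \<le> norm (1 - w (r n) ^ i)"
      proof (intro always_eventually allI)
        fix n
        have "coeff (G n) i = (1 - w (r n) ^ i) * coeff (g (r n)) i" by (simp add: G_def algebra_simps)
        then have "norm (coeff (G n) i) = norm (1 - w (r n) ^ i) * norm (coeff (g (r n)) i)" by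
            (simp add: norm_mult)
        also have "\<dots> \<le> norm (1 - w (r n) ^ i) * 1"
          using norm_coeff_le[OF q, of "g (r n)" i] g[of "r n"] by (intro mult_left_mono) auto
        finally show "norm (coeff (G n) i) \<le> norm (1 - w (r n) ^ i)" by simp
      qed
    qed
    then have null: "(\<lambda>n. pairing h (poly (cnj_poly (G n)))) \<longlonglongrightarrow> 0"
      by (rule pairing_weak_null[OF p q pq r(2) G])
    have "(\<lambda>n. functional a (f (r n) * G n)) \<longlonglongrightarrow> 0"
    proof (rule Lim_null_comparison)
      show "(\<lambda>n. Lp_norm p (\<lambda>z. A (poly (f (r n))) z - h z) * 2 + norm (pairing h (poly (cnj_poly (G n))))) \<longlonglongrightarrow> 0"
        using tendsto_add[OF tendsto_mult[OF r(3) tendsto_const[of 2]] tendsto_norm_zero[OF null]] by simp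
      show "\<forall>\<^sub>F n in sequentially. norm (functional a (f (r n) * G n))
          \<le> Lp_norm p (\<lambda>z. A (poly (f (r n))) z - h z) * 2 + norm (pairing h (poly (cnj_poly (G n))))"
      proof (intro always_eventually allI)
        fix n
        have "norm (pairing (A (poly (f (r n)))) (poly (cnj_poly (G n))) - pairing h (poly (cnj_poly (G n))))
           \<le> Lp_norm p (\<lambda>z. A (poly (f (r n))) z - h z) * poly_norm q (G n)"
          by (intro pairing_diff_bound p q pq A_poly_Lp HpD r)
        also have "\<dots> \<le> Lp_norm p (\<lambda>z. A (poly (f (r n))) z - h z) * 2" using G by (intro mult_left_mono) auto
        finally show "norm (functional a (f (r n) * G n))
          \<le> Lp_norm p (\<lambda>z. A (poly (f (r n))) z - h z) * 2 + norm (pairing h (poly (cnj_poly (G n))))"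
          using norm_triangle_sub[of "pairing (A (poly (f (r n)))) (poly (cnj_poly (G n)))"
              "pairing h (poly (cnj_poly (G n)))"]
          unfolding functional_eq_pairing by linarith
      qed
    qed
    then show "\<exists>r. strict_mono (r :: nat \<Rightarrow> nat) \<and> (\<lambda>n. functional a (f (r n) * (g (r n) - dilate (w (r n))
        (g (r n))))) \<longlonglongrightarrow> 0"
      using r(1) unfolding G_def by blast
  qed (use p q in auto)
qed

lemma rotation_small:
  assumes e: "0 < e"
  shows "\<exists>\<delta>>0. \<forall>w f. norm w = 1 \<longrightarrow> norm (w - 1) < \<delta> \<longrightarrow> norm (functional a (f - dilate w f)) \<le> e * poly_norm p f"
proof -
  obtain K where K: "0 \<le> K" "\<And>f g. norm (functional a (f * g)) \<le> K * poly_norm p f * poly_norm q g"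
    using bounded_form by (elim exE conjE) simp
  have Kp: "norm (functional a f) \<le> K * poly_norm p f" for f
  proof -
    have "poly_norm q 1 \<le> 1" using q by (intro poly_norm_le_sup) auto
    then have "K * poly_norm p f * poly_norm q 1 \<le> K * poly_norm p f * 1" using K(1)
        by (intro mult_left_mono) auto
    then show ?thesis using K(2)[of f 1] by simp
  qed
  obtain m where m: "q / p < real m" using reals_Archimedean2 by blast
  have "0 < q / p" using p q by simp
  with m have m0: "0 < m" by (cases m) auto
  have mq: "q \<le> real m * p" using m p by (simp add: pos_divide_less_eq)
  define C where "C = 2 * (real m * (1 + 3 * 2 powr (real m * p)))\<^sup>2"
  have "1 + 3 * 2 powr (real m * p) > 0" by (intro add_pos_nonneg) auto
  then have C: "C > 0" using m0 unfolding C_def by (intro mult_pos_pos zero_less_power) auto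
  obtain \<delta> where \<delta>: "\<delta> > 0" "\<And>w f g. norm w = 1 \<Longrightarrow> norm (w - 1) < \<delta> \<Longrightarrow>
      norm (functional a (f * (g - dilate w g))) \<le> e / C * poly_norm p f * poly_norm q g"
    using rotation_right_small[of "e / C"] e C by auto
  have "norm (functional a (f - dilate w f)) \<le> e * poly_norm p f" if w: "norm w = 1" "norm (w - 1) < \<delta>" for w f
  proof -
    have "norm (functional a (f - dilate w f)) \<le> e / C * C * poly_norm p f"
      unfolding C_def[symmetric] using functional_rotation_bound[OF p q m0 mq w(1) _ K(1) Kp \<delta>(2)[OF w], of
          f] e C
      by (simp add: C_def[symmetric])
    then show ?thesis using C by simp
  qed
  with \<delta>(1) show ?thesis by blast
qed

text \<open>
  Along a subsequence the images of \<open>f - dilate w f\<close> converge to some \<open>h\<close>. The coefficients of \<open>h\<close> are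
  limits of values covered by \<open>rotation_small\<close>, so they vanish and \<open>h\<close> does not contribute.
\<close>

lemma rotation_left_small:
  assumes e: "0 < e"
  shows "\<exists>\<delta>>0. \<forall>w f g. norm w = 1 \<longrightarrow> norm (w - 1) < \<delta> \<longrightarrow>
    norm (functional a ((f - dilate w f) * g)) \<le> e * poly_norm p f * poly_norm q g"
proof -
  obtain K where K: "0 \<le> K" "\<And>f g. norm (functional a (f * g)) \<le> K * poly_norm p f * poly_norm q g"
    using bounded_form by (elim exE conjE) simp
  show ?thesis
  proof (rule uniformly_small_of_sequences[where K = "2 * K", OF _ _ _ e])
    fix w c d :: complex and f g :: "complex poly"
    have "(smult c f - dilate w (smult c f)) * smult d g = smult (c * d) ((f - dilate w f) * g)"
      unfolding dilate_smult smult_diff_right[symmetric] mult_smult_left mult_smult_right smult_smult by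
          (simp only: mult.commute)
    then show "functional a ((smult c f - dilate w (smult c f)) * smult d g)
        = c * d * functional a ((f - dilate w f) * g)"
      by (simp only: functional_smult)
  next
    fix w :: complex and f g :: "complex poly" assume w: "norm w = 1"
    have "norm (functional a ((f - dilate w f) * g)) \<le> K * poly_norm p (f - dilate w f) * poly_norm q g"
        by (rule K)
    also have "\<dots> \<le> K * (2 * poly_norm p f) * poly_norm q g"
      using w K(1) p by (intro mult_left_mono mult_right_mono poly_norm_diff_rotation) auto
    finally show "norm (functional a ((f - dilate w f) * g)) \<le> 2 * K * poly_norm p f * poly_norm q g" by
        (simp add: mult_ac)
  next
    fix w :: "nat \<Rightarrow> complex" and f g :: "nat \<Rightarrow> complex poly" assume w: "\<And>n. norm (w n) = 1" "w \<longlonglongrightarrow> 1"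
      and f: "\<And>n. poly_norm p (f n) \<le> 1" and g: "\<And>n. poly_norm q (g n) \<le> 1"
    define F where "F n = f n - dilate (w n) (f n)" for n
    have F: "poly_norm p (F n) \<le> 2" for n
      using poly_norm_diff_rotation[OF w(1)[of n], of p "f n"] f[of n] p by (simp add: F_def)
    obtain r h where r: "strict_mono (r :: nat \<Rightarrow> nat)" "h \<in> Hp p"
        "(\<lambda>n. Lp_norm p (\<lambda>z. A (poly (F (r n))) z - h z)) \<longlonglongrightarrow> 0"
      using compact_operatorD(2)[OF compact, of "\<lambda>n. poly (F n)" 2, OF poly_in_Hp F] by (elim exE conjE)
    have AL: "A (poly (F n)) \<in> Lp p" and hL: "h \<in> Lp p" for n using A_poly_Lp HpD(1)[OF r(2)] by auto
    have coef_F: "(\<lambda>n. functional a (F n * monom 1 j)) \<longlonglongrightarrow> 0" for j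
    proof (rule LIMSEQ_I)
      fix d :: real assume d: "0 < d"
      obtain \<delta> where \<delta>: "\<delta> > 0" "\<And>w f. norm w = 1 \<Longrightarrow> norm (w - 1) < \<delta> \<Longrightarrow> norm (functional a (f - dilate w f))
          \<le> d / 2 * poly_norm p f"
        using rotation_small[of "d/2"] d by auto
      have "\<forall>\<^sub>F n in sequentially. norm (w n - 1) < \<delta>"
        using w(2) \<delta>(1) by (auto simp: tendsto_iff dist_norm)
      moreover have "(\<lambda>n. norm (w n ^ j - 1) * K) \<longlonglongrightarrow> 0"
        using tendsto_mult[OF tendsto_norm[OF tendsto_diff[OF tendsto_power[OF w(2), of j] tendsto_const[of
            1]]] tendsto_const[of K]] by simp
      then have "\<forall>\<^sub>F n in sequentially. norm (w n ^ j - 1) * K < d / 2"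
        using d by (intro order_tendstoD(2)) auto
      ultimately have "\<forall>\<^sub>F n in sequentially. norm (functional a (F n * monom 1 j)) < d"
      proof eventually_elim
        case (elim n)
        \<comment> \<open>The rotation multiplies the monomial by \<open>w n ^ j\<close>, which is close to 1; so it nearly commutes
            with the shift.\<close>
        let ?f = "monom 1 j * f n"
        let ?R = "dilate (w n)"
        have nf: "poly_norm p ?f = poly_norm p (f n)"
          by (intro Lp_norm_cong) (simp add: norm_mult poly_monom norm_power)
        have "dilate (w n) (monom 1 j) = smult (w n ^ j) (monom 1 j)"
          by (intro poly_eqI) simp
        then have "?R ?f = smult (w n ^ j) (monom 1 j * ?R (f n))" by (simp add: dilate_mult)
        then have "F n * monom 1 j = (?f - ?R ?f) + smult (w n ^ j - 1) (?R (f n) * monom 1 j)"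
          by (simp add: F_def algebra_simps smult_diff_left)
        then have "norm (functional a (F n * monom 1 j)) \<le> norm (functional a (?f - ?R ?f))
            + norm (w n ^ j - 1) * norm (functional a (?R (f n) * monom 1 j))"
          using norm_triangle_ineq[of "functional a (?f - ?R ?f)"
              "(w n ^ j - 1) * functional a (?R (f n) * monom 1 j)"]
          by (simp only: functional_add functional_smult norm_mult)
        also have "norm (functional a (?f - ?R ?f)) \<le> d / 2 * poly_norm p ?f" by (rule \<delta>(2)[OF w(1) elim(1)])
        also have "\<dots> \<le> d / 2" using nf f[of n] d by simp
        also have "norm (functional a (?R (f n) * monom 1 j)) \<le> K"
        proof -
          have "poly_norm q (monom 1 j) \<le> 1" using q by (intro poly_norm_le_sup)
              (auto simp: poly_monom norm_power)
          moreover have "poly_norm p (?R (f n)) \<le> 1" using f[of n] p by (simp add: poly_norm_rotation[OF w(1)])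
          ultimately have "K * poly_norm p (?R (f n)) * poly_norm q (monom 1 j) \<le> K * 1 * 1"
            using K(1) by (intro mult_mono) auto
          then show ?thesis using K(2)[of "?R (f n)" "monom 1 j"] by simp
        qed
        finally have "norm (functional a (F n * monom 1 j)) \<le> d / 2 + norm (w n ^ j - 1) * K"
          by (simp add: mult_left_mono)
        then show ?case using elim(2) by linarith
      qed
      then show "\<exists>no. \<forall>n\<ge>no. norm (functional a (F n * monom 1 j) - 0) < d" by
          (simp add: eventually_sequentially)
    qed
    have h0: "fourier_coeff h (int j) = 0" for j
    proof -
      have "(\<lambda>n. fourier_coeff (A (poly (F (r n)))) (int j)) \<longlonglongrightarrow> fourier_coeff h (int j)"
      proof (rule LIM_zero_cancel, rule Lim_null_comparison[OF _ r(3)], intro always_eventually allI)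
        fix n
        show "norm (fourier_coeff (A (poly (F (r n)))) (int j) - fourier_coeff h (int j))
            \<le> Lp_norm p (\<lambda>z. A (poly (F (r n))) z - h z)"
          unfolding fourier_coeff_diff[OF Lp_imp_integrable(1)[OF p AL] Lp_imp_integrable(1)[OF p hL],
              symmetric]
          using p by (intro norm_fourier_coeff_le_Lp Lp_diff AL hL) auto
      qed
      moreover have "fourier_coeff (A (poly (F n))) (int j) = functional a (F n * monom 1 j)" for n
        by (subst functional_mult) (simp add: degree_monom_eq fourier_coeff_A_poly if_distrib[of
            "\<lambda>x. x * _"] cong: if_cong)
      moreover have "(\<lambda>n. functional a (F (r n) * monom 1 j)) \<longlonglongrightarrow> 0"
        using LIMSEQ_subseq_LIMSEQ[OF coef_F r(1)] by (simp add: o_def)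
      ultimately show ?thesis using LIMSEQ_unique by simp
    qed
    have "(\<lambda>n. functional a (F (r n) * g (r n))) \<longlonglongrightarrow> 0"
    proof (rule Lim_null_comparison[OF _ r(3)], intro always_eventually allI)
      fix n
      have "pairing h (poly (cnj_poly (g (r n)))) = 0"
        by (simp add: pairing_cnj_poly[OF Lp_imp_integrable(1)[OF p hL]] h0)
      then have "norm (functional a (F (r n) * g (r n))) \<le> Lp_norm p (\<lambda>z. A (poly (F (r n))) z - h z) *
          poly_norm q (g (r n))"
        using pairing_diff_bound[OF p q pq AL hL, of "r n" "g (r n)"] by (simp add: functional_eq_pairing)
      also have "\<dots> \<le> Lp_norm p (\<lambda>z. A (poly (F (r n))) z - h z) * 1" using g by (intro mult_left_mono) auto
      finally show "norm (functional a (F (r n) * g (r n))) \<le> Lp_norm p (\<lambda>z. A (poly (F (r n))) z - h z)"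
          by simp
    qed
    then show "\<exists>r. strict_mono (r :: nat \<Rightarrow> nat) \<and> (\<lambda>n. functional a ((f (r n) - dilate (w (r n)) (f (r n)))
        * g (r n))) \<longlonglongrightarrow> 0"
      using r(1) unfolding F_def by blast
  qed (use p q in auto)
qed

text \<open>
  Since \<open>f g - R f R g = (f - R f) g + R f (g - R g)\<close>, the two estimates for products bound the
  functional \<open>h \<mapsto> functional a (h - R h)\<close> on products, and factorization carries this bound over to
  the \<open>L^1\<close> norm.
\<close>

lemma rotation_L1_small:
  assumes e: "0 < e"
  shows "\<exists>\<delta>>0. \<forall>w h. norm w = 1 \<longrightarrow> norm (w - 1) < \<delta> \<longrightarrow> norm (functional a (h - dilate w h)) \<le> e * poly_norm 1 h"
proof -
  obtain \<delta>1 where \<delta>1: "\<delta>1 > 0" "\<And>w f g. norm w = 1 \<Longrightarrow> norm (w - 1) < \<delta>1 \<Longrightarrow>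
      norm (functional a (f * (g - dilate w g))) \<le> e / 2 * poly_norm p f * poly_norm q g"
    using rotation_right_small[of "e / 2"] e by auto
  obtain \<delta>2 where \<delta>2: "\<delta>2 > 0" "\<And>w f g. norm w = 1 \<Longrightarrow> norm (w - 1) < \<delta>2 \<Longrightarrow>
      norm (functional a ((f - dilate w f) * g)) \<le> e / 2 * poly_norm p f * poly_norm q g"
    using rotation_left_small[of "e / 2"] e by auto
  have "norm (functional a (h - dilate w h)) \<le> e * poly_norm 1 h" if w: "norm w = 1"
      "norm (w - 1) < min \<delta>1 \<delta>2" for w h
  proof -
    define b where "b i = a i * (1 - w ^ i)" for i
    have fb: "functional a (f - dilate w f) = functional b f" for f
      unfolding functional_diff functional_dilate functional_def[of a f] functional_def[of b f] b_def
      by (simp add: algebra_simps sum_subtractf)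
    have "norm (functional b (f * g)) \<le> e * poly_norm p f * poly_norm q g" for f g
    proof -
      have "f * g - dilate w (f * g) = (f - dilate w f) * g + dilate w f * (g - dilate w g)"
        by (simp add: dilate_mult algebra_simps)
      then have "norm (functional b (f * g)) \<le> norm (functional a ((f - dilate w f) * g))
          + norm (functional a (dilate w f * (g - dilate w g)))"
        unfolding fb[symmetric] by (simp only: functional_add norm_triangle_ineq)
      also have "\<dots> \<le> e / 2 * poly_norm p f * poly_norm q g + e / 2 * poly_norm p (dilate w f) * poly_norm q g"
        using w by (intro add_mono \<delta>1 \<delta>2) auto
      also have "\<dots> = e * poly_norm p f * poly_norm q g" using p w(1) by (simp add: poly_norm_rotation)
      finally show ?thesis .
    qed
    then show ?thesis unfolding fb using e by (intro functional_L1_bound[OF p q pq]) auto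
  qed
  then show ?thesis using \<delta>1(1) \<delta>2(1) by (intro exI[of _ "min \<delta>1 \<delta>2"]) auto
qed

theorem continuous_symbol_exists:
  "\<exists>b. continuous_on (sphere 0 1) b \<and> (\<forall>n::nat. fourier_coeff b (int n + 1) = a n)"
proof -
  obtain K where K: "0 \<le> K" "\<And>f g. norm (functional a (f * g)) \<le> K * poly_norm p f * poly_norm q g"
    using bounded_form by (elim exE conjE) simp
  have "L1_bounded K a" unfolding L1_bounded_def using functional_L1_bound[OF p q pq K] by blast
  then show ?thesis using K(1) rotation_L1_small by (rule continuous_symbol)
qed

end

section \<open>Hankel operators with continuous symbol\<close>

lemma flip_integrable:
  assumes "integrable circle f"
  shows "integrable circle (flip f)" "(LINT z|circle. norm (flip f z)) = (LINT z|circle. norm (f z))"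
proof -
  have "integrable circle (\<lambda>z. f (cnj z) * cnj z)"
    by (intro integrable_mult_continuous integrable_circle_cnj assms continuous_intros)
  then show "integrable circle (flip f)" by (simp add: flip_def[abs_def] mult.commute)
  have "(LINT z|circle. norm (flip f z)) = (LINT z|circle. norm (f (cnj z)))"
    by (intro Bochner_Integration.integral_cong) (auto simp: flip_def norm_mult)
  also have "\<dots> = (LINT z|circle. norm (f z))"
    using assms by (intro integral_circle_cnj borel_measurable_norm) auto
  finally show "(LINT z|circle. norm (flip f z)) = (LINT z|circle. norm (f z))" .
qed

lemma fourier_coeff_hankel_bound:
  assumes b: "continuous_on (sphere 0 1) b" and B: "\<And>z. norm z = 1 \<Longrightarrow> norm (b z) \<le> B" and f:
      "integrable circle f"
  shows "integrable circle (\<lambda>t. b t * flip f t)"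
    "norm (fourier_coeff (\<lambda>t. b t * flip f t) n) \<le> B * (LINT z|circle. norm (f z))"
proof -
  have i: "integrable circle (\<lambda>t. flip f t * b t)" by (intro integrable_mult_continuous flip_integrable f b)
  then show i': "integrable circle (\<lambda>t. b t * flip f t)" by (simp add: mult.commute)
  have "norm (fourier_coeff (\<lambda>t. b t * flip f t) n) \<le> (LINT z|circle. norm (b z * flip f z))"
    by (rule norm_fourier_coeff_le[OF i'])
  also have "\<dots> \<le> (LINT z|circle. B * norm (flip f z))"
    using B integrable_norm[OF i'] integrable_norm[OF flip_integrable(1)[OF f]]
    by (intro integral_mono integrable_mult_right) (auto simp: norm_mult intro!: mult_right_mono)
  also have "\<dots> = B * (LINT z|circle. norm (f z))" by (simp add: flip_integrable(2)[OF f])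
  finally show "norm (fourier_coeff (\<lambda>t. b t * flip f t) n) \<le> B * (LINT z|circle. norm (f z))" .
qed

lemma fourier_coeff_hankel_poly:
  assumes b: "continuous_on (sphere 0 1) b"
  shows "fourier_coeff (\<lambda>t. b t * flip (poly h) t) n = functional (\<lambda>k. fourier_coeff b (n + int k + 1)) h"
proof -
  have eq: "b t * flip (poly h) t * cnj (chi n t) = (\<Sum>k\<le>degree h. coeff h k * (b t * cnj (chi (n + int k
      + 1) t)))" if t: "norm t = 1" for t
  proof -
    have c: "cnj (chi (n + int k + 1) t) = cnj (chi n t) * cnj t ^ k * cnj t" for k
    proof -
      have "chi (n + int k + 1) t = chi n t * chi (int k) t * chi 1 t" using t by (simp add: chi_mult)
      then show ?thesis by (simp add: chi_def)
    qed
    show ?thesis unfolding c by (simp add: flip_def poly_altdef sum_distrib_left sum_distrib_right mult_ac)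
  qed
  have "fourier_coeff (\<lambda>t. b t * flip (poly h) t) n = (LINT t|circle. (\<Sum>k\<le>degree h. coeff h k * (b t * cnj
      (chi (n + int k + 1) t))))"
    unfolding fourier_coeff_def pairing_def by (intro Bochner_Integration.integral_cong) (auto simp: eq)
  also have "\<dots> = (\<Sum>k\<le>degree h. LINT t|circle. coeff h k * (b t * cnj (chi (n + int k + 1) t)))"
    by (intro Bochner_Integration.integral_sum integrable_circle_continuous continuous_intros b)
  also have "\<dots> = functional (\<lambda>k. fourier_coeff b (n + int k + 1)) h"
    by (simp add: functional_def fourier_coeff_def pairing_def mult.commute)
  finally show ?thesis .
qed

lemma compact_operator_cong_AE:
  assumes p: "1 < p" and A: "compact_operator_on_Hp p A"
    and B: "\<And>f. f \<in> Hp p \<Longrightarrow> B f \<in> Hp p" "\<And>f. f \<in> Hp p \<Longrightarrow> AE z in circle. B f z = A f z"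
  shows "compact_operator_on_Hp p B"
proof -
  note L = linear_operatorD[OF compact_operatorD(1)[OF A]]
  have "linear_operator_on_Hp p B"
    unfolding linear_operator_on_Hp_def
  proof (intro conjI ballI allI impI)
    fix f assume "f \<in> Hp p" then show "B f \<in> Hp p" by (rule B)
  next
    fix f g assume f: "f \<in> Hp p" and g: "g \<in> Hp p" and fg: "AE z in circle. f z = g z"
    show "AE z in circle. B f z = B g z"
      using B(2)[OF f] B(2)[OF g] L(2)[OF f g fg] by eventually_elim simp
  next
    fix f g a b assume f: "f \<in> Hp p" and g: "g \<in> Hp p"
    show "AE z in circle. B (\<lambda>w. a * f w + b * g w) z = a * B f z + b * B g z"
      using B(2)[OF f] B(2)[OF g] B(2)[OF Hp_linear[OF p f g, of a b]] L(3)[OF f g, of a b]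
          by eventually_elim simp
  qed
  moreover have "\<exists>r h. strict_mono r \<and> h \<in> Hp p \<and> (\<lambda>n. Lp_norm p (\<lambda>z. B (F (r n)) z - h z)) \<longlonglongrightarrow> 0"
    if F: "(\<forall>n. F n \<in> Hp p) \<and> (\<exists>M. \<forall>n. Lp_norm p (F n) \<le> M)" for F :: "nat \<Rightarrow> complex \<Rightarrow> complex"
  proof -
    have FH: "F n \<in> Hp p" for n using F by blast
    obtain r h where r: "strict_mono (r :: nat \<Rightarrow> nat)" "h \<in> Hp p"
        "(\<lambda>n. Lp_norm p (\<lambda>z. A (F (r n)) z - h z)) \<longlonglongrightarrow> 0"
      using A F unfolding compact_operator_on_Hp_def by blast
    have "Lp_norm p (\<lambda>z. B (F (r n)) z - h z) = Lp_norm p (\<lambda>z. A (F (r n)) z - h z)" for n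
    proof (rule Lp_norm_cong_AE)
      show "AE z in circle. B (F (r n)) z - h z = A (F (r n)) z - h z"
        using B(2)[OF FH[of "r n"]] by eventually_elim simp
      show "(\<lambda>z. B (F (r n)) z - h z) \<in> borel_measurable circle"
          "(\<lambda>z. A (F (r n)) z - h z) \<in> borel_measurable circle"
        using LpD(1)[OF HpD(1)[OF B(1)[OF FH]]] LpD(1)[OF HpD(1)[OF L(1)[OF FH]]] LpD(1)[OF HpD(1)[OF r(2)]]
            by auto
    qed
    then have "(\<lambda>n. Lp_norm p (\<lambda>z. B (F (r n)) z - h z)) \<longlonglongrightarrow> 0" using r(3) by simp
    then show ?thesis using r(1,2) by blast
  qed
  ultimately show ?thesis unfolding compact_operator_on_Hp_def by blast
qed

text \<open>
  Both sides of the coefficient identity are continuous in \<open>f\<close> for the \<open>L^p\<close> norm and agree for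
  polynomials. Thus \<open>A f\<close> qualifies as the Riesz projection of \<open>b * flip f\<close>, which therefore exists,
  and the choice in its definition agrees with \<open>A f\<close> by uniqueness of Fourier coefficients.
\<close>

lemma hankel_operator_eq_AE:
  assumes p: "1 < p" and A: "compact_operator_on_Hp p A"
    and b: "continuous_on (sphere 0 1) b"
    and hankel: "\<And>j k. fourier_coeff (A (chi (int k))) (int j) = fourier_coeff b (int (j + k) + 1)"
    and f: "f \<in> Hp p"
  shows "hankel_operator p b f \<in> Hp p" "AE z in circle. hankel_operator p b f z = A f z"
proof -
  note L = linear_operatorD[OF compact_operatorD(1)[OF A]]
  have fL: "f \<in> Lp p" and fI: "integrable circle f" and AfL: "A f \<in> Lp p" and AfI: "integrable circle (A f)"
    using HpD(1)[OF f] HpD(1)[OF L(1)[OF f]] Lp_imp_integrable(1)[OF p] by auto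
  obtain K where K: "0 \<le> K" "\<And>f. f \<in> Hp p \<Longrightarrow> Lp_norm p (A f) \<le> K * Lp_norm p f"
    using compact_operator_bounded[OF p A] by blast
  have "compact (b ` sphere 0 1)" by (intro compact_continuous_image b) auto
  then have "bounded (b ` sphere 0 1)" by (rule compact_imp_bounded)
  then obtain B where B': "\<And>z. z \<in> sphere 0 1 \<Longrightarrow> norm (b z) \<le> B" unfolding bounded_iff by (meson imageI)
  then have B: "\<And>z. norm z = 1 \<Longrightarrow> norm (b z) \<le> B" by simp
  have B0: "0 \<le> B" using B[of 1] norm_ge_zero[of "b 1"] by (simp add: order.trans[OF norm_ge_zero])
  have eq: "fourier_coeff (A f) (int n) = fourier_coeff (\<lambda>t. b t * flip f t) (int n)" for n
  proof -
    have "norm (fourier_coeff (A f) (int n) - fourier_coeff (\<lambda>t. b t * flip f t) (int n)) \<le> 0 + e" if e: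
        "e > 0" for e
    proof -
      obtain k where k: "Lp_norm p (\<lambda>z. f z - poly k z) < e / (K + B + 1)"
        using Hp_poly_dense[OF p f, of "e / (K + B + 1)"] e K(1) B0 by auto
      define d where "d = (\<lambda>z. f z - poly k z)"
      have kH: "poly k \<in> Hp p" using p by (intro Hp_poly) auto
      have dH: "d \<in> Hp p" using Hp_linear[OF p f kH, of 1 "-1"] by (simp add: d_def)
      have kI: "integrable circle (poly k)" and dI: "integrable circle d"
        using HpD(1)[OF kH] HpD(1)[OF dH] Lp_imp_integrable(1)[OF p] by auto
      have "fourier_coeff (A d) (int n) = fourier_coeff (A f) (int n) - fourier_coeff (A (poly k)) (int n)"
        using fourier_coeff_operator_linear[OF p compact_operatorD(1)[OF A] f kH, of 1 "-1"] by
            (simp add: d_def)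
      moreover have "(\<lambda>t. b t * flip d t) = (\<lambda>t. b t * flip f t - b t * flip (poly k) t)"
        by (simp add: d_def flip_def algebra_simps)
      then have "fourier_coeff (\<lambda>t. b t * flip d t) (int n) = fourier_coeff (\<lambda>t. b t * flip f t) (int n) -
          fourier_coeff (\<lambda>t. b t * flip (poly k) t) (int n)"
        by (simp add: fourier_coeff_diff fourier_coeff_hankel_bound(1)[OF b B] fI kI)
      moreover have "fourier_coeff (A (poly k)) (int n) = fourier_coeff (\<lambda>t. b t * flip (poly k) t) (int n)"
        by (simp add: fourier_coeff_operator_poly[OF p compact_operatorD(1)[OF A]]
            fourier_coeff_hankel_poly[OF b] hankel)
      ultimately have "fourier_coeff (A f) (int n) - fourier_coeff (\<lambda>t. b t * flip f t) (int n)
          = fourier_coeff (A d) (int n) - fourier_coeff (\<lambda>t. b t * flip d t) (int n)" by simp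
      also have "norm \<dots> \<le> norm (fourier_coeff (A d) (int n)) + norm (fourier_coeff (\<lambda>t. b t * flip d t) (int
          n))"
        by (rule norm_triangle_ineq4)
      also have "norm (fourier_coeff (A d) (int n)) \<le> K * Lp_norm p d"
        using norm_fourier_coeff_le_Lp[OF p HpD(1)[OF L(1)[OF dH]]] K(2)[OF dH] by (rule order.trans)
      also have "norm (fourier_coeff (\<lambda>t. b t * flip d t) (int n)) \<le> B * Lp_norm p d"
        using fourier_coeff_hankel_bound(2)[OF b B dI] mult_left_mono[OF Lp_imp_integrable(2)[OF p HpD(1)[OF
            dH]] B0] by (rule order.trans)
      also have "K * Lp_norm p d + B * Lp_norm p d \<le> (K + B + 1) * Lp_norm p d"
        by (simp add: algebra_simps)
      also have "\<dots> \<le> (K + B + 1) * (e / (K + B + 1))" using k K(1) B0 unfolding d_def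
          by (intro mult_left_mono) auto
      also have "\<dots> = e" using K(1) B0 by simp
      finally show ?thesis by simp
    qed
    then have "norm (fourier_coeff (A f) (int n) - fourier_coeff (\<lambda>t. b t * flip f t) (int n)) \<le> 0"
        by (rule field_le_epsilon)
    then show ?thesis by simp
  qed
  let ?P = "\<lambda>g. g \<in> Hp p \<and> (\<forall>n\<ge>0. fourier_coeff g n = fourier_coeff (\<lambda>t. b t * flip f t) n)"
  have "?P (A f)"
  proof (intro conjI allI impI L(1) f)
    fix n :: int assume "0 \<le> n"
    then show "fourier_coeff (A f) n = fourier_coeff (\<lambda>t. b t * flip f t) n" using eq[of "nat n"] by simp
  qed
  then have P: "?P (hankel_operator p b f)"
    unfolding hankel_operator_def riesz_projection_def by (rule someI[of ?P])
  then show H: "hankel_operator p b f \<in> Hp p" by blast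
  show "AE z in circle. hankel_operator p b f z = A f z"
  proof (rule AE_eq_of_fourier_coeff_eq[OF p HpD(1)[OF H] AfL])
    fix n :: int
    show "fourier_coeff (hankel_operator p b f) n = fourier_coeff (A f) n"
    proof (cases "0 \<le> n")
      case True
      then show ?thesis using P eq[of "nat n"] by simp
    next
      case False
      then show ?thesis using HpD(2)[OF H] HpD(2)[OF L(1)[OF f]] by simp
    qed
  qed
qed

section \<open>Sums of Toeplitz and Hankel forms\<close>

lemma chi_Dplus: "chi (int n) \<in> Dplus"
  by (simp add: Dplus_eq chi_eq_poly)

lemma Dplus_linear: "f \<in> Dplus \<Longrightarrow> g \<in> Dplus \<Longrightarrow> (\<lambda>z. a * f z + b * g z) \<in> Dplus"
proof -
  assume "f \<in> Dplus" "g \<in> Dplus"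
  then obtain h k where "f = poly h" "g = poly k" by (auto simp: Dplus_eq)
  then have "(\<lambda>z. a * f z + b * g z) = poly (smult a h + smult b k)" by auto
  then show ?thesis by (simp add: Dplus_eq)
qed

lemma sesquilinear_form_add:
  "sesquilinear_form B \<Longrightarrow> sesquilinear_form B' \<Longrightarrow> sesquilinear_form (\<lambda>f g. B f g + B' f g)"
  unfolding sesquilinear_form_def by (simp add: algebra_simps)

lemma sesquilinear_form_cong:
  assumes "sesquilinear_form B" "form_eq B B'"
  shows "sesquilinear_form B'"
  unfolding sesquilinear_form_def
proof (intro ballI allI)
  fix f g h a b assume D: "f \<in> Dplus" "g \<in> Dplus" "h \<in> Dplus"
  have eq: "B' u v = B u v" if "u \<in> Dplus" "v \<in> Dplus" for u v
    using assms(2) that by (simp add: form_eq_def)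
  have "B (\<lambda>z. a * f z + b * g z) h = a * B f h + b * B g h \<and> B h (\<lambda>z. a * f z + b * g z) = cnj a * B h f
      + cnj b * B h g"
    using assms(1) D unfolding sesquilinear_form_def by blast
  then show "B' (\<lambda>z. a * f z + b * g z) h = a * B' f h + b * B' g h \<and> B' h (\<lambda>z. a * f z + b * g z)
      = cnj a * B' h f + cnj b * B' h g"
    by (simp only: eq D Dplus_linear)
qed

lemma toeplitz_diagonal:
  assumes "toeplitz_form T"
  shows "T (chi (int (n + k))) (chi (int (n + j))) = T (chi (int k)) (chi (int j))"
proof (induction n)
  case (Suc n)
  have "T (chi (int (Suc n + k))) (chi (int (Suc n + j))) = T (chi (int (n + k))) (chi (int (n + j)))"
    using assms[unfolded toeplitz_form_def, THEN conjunct2, THEN spec, THEN spec, of "n + k" "n + j"]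
    by (simp only: add_Suc) (simp only: Suc_eq_plus1)
  then show ?case using Suc by simp
qed simp

text \<open>
  The entries at \<open>(n + k + 1, n + j)\<close> and \<open>(n + k, n + j + 1)\<close> have the same Hankel part, and the
  difference of their Toeplitz parts is the same for all \<open>n\<close>.
\<close>

lemma toeplitz_part_hankel:
  assumes T: "toeplitz_form T" and H: "hankel_form H"
    and diag: "\<And>j k. (\<lambda>n. T (chi (int (n + k))) (chi (int (n + j))) + H (chi (int (n + k))) (chi (int (n
        + j)))) \<longlonglongrightarrow> 0"
  shows "hankel_form T"
  unfolding hankel_form_def
proof (intro conjI allI)
  show "sesquilinear_form T" using T by (simp add: toeplitz_form_def)
  fix j k :: nat
  define d where "d = T (chi (int (k + 1))) (chi (int j)) - T (chi (int k)) (chi (int (j + 1)))"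
  have "T (chi (int (n + (k + 1)))) (chi (int (n + j))) + H (chi (int (n + (k + 1)))) (chi (int (n + j)))
      - (T (chi (int (n + k))) (chi (int (n + (j + 1)))) + H (chi (int (n + k))) (chi (int (n + (j + 1)))))
          = d" for n
  proof -
    have "H (chi (int (n + (k + 1)))) (chi (int (n + j))) = H (chi (int (n + k))) (chi (int (n + (j + 1))))"
      using H[unfolded hankel_form_def, THEN conjunct2, THEN spec, THEN spec, of "n + k" "n + j"]
      by (simp only: add.assoc[symmetric])
    then show ?thesis by (simp only: toeplitz_diagonal[OF T] d_def add_diff_add diff_self add_0_right)
  qed
  then have "(\<lambda>n. d) \<longlonglongrightarrow> 0 - 0"
    using tendsto_diff[OF diag[of "k + 1" j] diag[of k "j + 1"]] by (simp only:)
  then have "d = 0" by (simp add: LIMSEQ_const_iff)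
  then show "T (chi (int (k + 1))) (chi (int j)) = T (chi (int k)) (chi (int (j + 1)))" by (simp add: d_def)
qed

theorem corollary18:
  fixes p :: real and T H :: form
  assumes "1 < p"
    and "toeplitz_form T"
    and "hankel_form H"
    and "is_compact_operator_form p (\<lambda>f g. T f g + H f g)"
  shows "\<exists>C b. checkerboard_form C \<and> form_eq T C \<and>
           continuous_on (sphere 0 1) b \<and>
           compact_operator_on_Hp p (hankel_operator p b) \<and>
           hankel_form (operator_form (hankel_operator p b)) \<and>
           form_eq H (\<lambda>f g. operator_form (hankel_operator p b) f g - C f g)"
proof -
  note p = assms(1)
  obtain A where A: "compact_operator_on_Hp p A" and "form_eq (\<lambda>f g. T f g + H f g) (operator_form A)"
    using assms(4) unfolding is_compact_operator_form_def by blast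
  then have TH: "T f g + H f g = pairing (A f) g" if "f \<in> Dplus" "g \<in> Dplus" for f g
    using that by (simp add: form_eq_def operator_form_def)
  have entry: "T (chi (int k)) (chi (int j)) + H (chi (int k)) (chi (int j))
      = fourier_coeff (A (chi (int k))) (int j)" for j k
    by (simp add: TH chi_Dplus fourier_coeff_def)
  have HT: "hankel_form T"
  proof (rule toeplitz_part_hankel[OF assms(2,3)])
    show "(\<lambda>n. T (chi (int (n + k))) (chi (int (n + j))) + H (chi (int (n + k))) (chi (int (n + j)))) \<longlonglongrightarrow> 0"
        for j k
      unfolding entry by (rule compact_operator_diagonal_tendsto_0[OF p A])
  qed
  define S where "S = (\<lambda>f g. T f g + H f g)"
  have S: "hankel_form S"
    using HT assms(3) unfolding hankel_form_def S_def by (simp only: sesquilinear_form_add simp_thms)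
  define a where "a n = fourier_coeff (A (chi (int 0))) (int n)" for n
  have "fourier_coeff (A (chi (int k))) (int j) = a (j + k)" for j k
  proof (induction k arbitrary: j)
    case (Suc k)
    have "fourier_coeff (A (chi (int (Suc k)))) (int j) = S (chi (int (k + 1))) (chi (int j))"
      unfolding S_def entry by (simp only: Suc_eq_plus1)
    also have "\<dots> = S (chi (int k)) (chi (int (j + 1)))" using S unfolding hankel_form_def by blast
    also have "\<dots> = fourier_coeff (A (chi (int k))) (int (j + 1))" by (simp only: S_def entry)
    finally show ?case using Suc[of "j + 1"] by simp
  qed (simp add: a_def)
  note hankel = this
  define q where "q = p / (p - 1)"
  have q: "1 < q" "1 / p + 1 / q = 1" using p by (auto simp: q_def field_simps)
  interpret compact_hankel p q A a
    by unfold_locales (use p q A hankel in auto)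
  obtain b where b: "continuous_on (sphere 0 1) b" "\<And>n::nat. fourier_coeff b (int n + 1) = a n"
    using continuous_symbol_exists by blast
  have hankel_b: "fourier_coeff (A (chi (int k))) (int j) = fourier_coeff b (int (j + k) + 1)" for j k
    by (simp only: hankel b(2))
  note hb = hankel_operator_eq_AE[OF p A b(1) hankel_b]
  have compact_b: "compact_operator_on_Hp p (hankel_operator p b)"
    by (rule compact_operator_cong_AE[OF p A hb])
  have form_b: "operator_form (hankel_operator p b) f g = S f g" if fg: "f \<in> Dplus" "g \<in> Dplus" for f g
  proof -
    obtain h k where hk: "f = poly h" "g = poly k" using fg by (auto simp: Dplus_eq)
    have fH: "f \<in> Hp p" unfolding hk using p by (intro Hp_poly) auto
    have g: "(\<lambda>z. cnj (g z)) \<in> borel_measurable circle"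
      unfolding hk by (intro borel_measurable_circle_continuous continuous_intros)
    have "pairing (hankel_operator p b f) g = pairing (A f) g"
      unfolding pairing_def
    proof (rule integral_cong_AE)
      show "AE z in circle. hankel_operator p b f z * cnj (g z) = A f z * cnj (g z)"
        using hb(2)[OF fH] by eventually_elim simp
    qed (intro borel_measurable_times g LpD(1)[OF HpD(1)[OF hb(1)[OF fH]]] LpD(1)[OF HpD(1)[OF A_Hp[OF fH]]])+
    then show ?thesis using TH[OF fg] by (simp add: operator_form_def S_def)
  qed
  have "hankel_form (operator_form (hankel_operator p b))"
    unfolding hankel_form_def
  proof (intro conjI allI)
    show "sesquilinear_form (operator_form (hankel_operator p b))"
      by (rule sesquilinear_form_cong[of S]) (use S form_b in \<open>auto simp: hankel_form_def form_eq_def\<close>)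
    show "operator_form (hankel_operator p b) (chi (int (k + 1))) (chi (int j))
        = operator_form (hankel_operator p b) (chi (int k)) (chi (int (j + 1)))" for j k
      using S unfolding form_b[OF chi_Dplus chi_Dplus] hankel_form_def by blast
  qed
  moreover have "checkerboard_form T" using assms(2) HT by (simp add: checkerboard_form_def)
  moreover have "form_eq T T" by (simp add: form_eq_def)
  moreover have "form_eq H (\<lambda>f g. operator_form (hankel_operator p b) f g - T f g)"
    by (simp add: form_eq_def form_b S_def)
  ultimately show ?thesis using b(1) compact_b by blast
qed

end
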